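(* For every $m\in\omega\setminus\{0,2\}$ and every $n\in\omega\setminus\{0,1\}$ there is a unary expansion $\widehat{T}$ of the theory $T_n$ (i.e. a complete theory obtained by adding unary predicate symbols to the language of $T_n$ and containing $T_n$) such that $\widehat{T}$ has exactly $m$ pairwise non-isomorphic countable models, i.e. $I(\widehat{T},\omega)=m$.
   Context: An $n$-spherical order is a structure $\langle A,K_n\rangle$ with $K_n$ an $n$-ary relation. For $n=2$, $K_2$ is a linear order (non-strict). For $n=3$, $K_3$ is a circular order, i.e. satisfies: (co1) $K_3(x,y,z)\to K_3(y,z,x)$; (co2) $K_3(x,y,z)\wedge K_3(y,x,z)\leftrightarrow x=y\vee y=z\vee z=x$; (co3) $K_3(x,y,z)\to\forall t\,(K_3(x,y,t)\vee K_3(t,y,z))$; (co4) $K_3(x,y,z)\vee K_3(y,x,z)$ (all universally quantified). For $n\geq 4$, $K_n$ satisfies: (nso1) $K_n(x_1,x_2,\ldots,x_n)\to K_n(x_2,\ldots,x_n,x_1)$; (nso2) for all $1\le i<j\le n$: $K_n(x_1,\ldots,x_i,\ldots,x_j,\ldots,x_n)\wedge K_n(x_1,\ldots,x_j,\ldots,x_i,\ldots,x_n)\leftrightarrow\bigvee_{1\le k<l\le n}x_k=x_l$; (nso3) $K_n(x_1,\ldots,x_n)\to\forall t\bigvee_{i=1}^n K_n(x_1,\ldots,x_{i-1},t,x_{i+1},\ldots,x_n)$; (nso4) for all $1\le i<j\le n$: $K_n(x_1,\ldots,x_i,\ldots,x_j,\ldots,x_n)\vee K_n(x_1,\ldots,x_j,\ldots,x_i,\ldots,x_n)$.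 An $n$-spherical order is dense if it has at least two elements and for every $(a_1,a_2,a_3,\ldots,a_n)\in K_n$ with $a_1\neq a_2$ there is $b\notin\{a_1,\ldots,a_n\}$ with $K_n(a_1,b,a_3,\ldots,a_n)$ and $K_n(b,a_2,a_3,\ldots,a_n)$. $T_n=\mathrm{Th}(\mathcal A_n)$ where $\mathcal A_n$ is a countable dense $n$-spherical order (without endpoints when $n=2$). $I(T,\omega)$ denotes the number of pairwise non-isomorphic countable models of $T$.
   Formalization: For even n≥4 axiom (nso1), which with (nso2), (nso4) rules out any dense order, is dropped; for n≥4, where Th(A_n) depends on A_n and the claim fails for some A_n, one suitable T_n serving all m is shown to exist; for n=2,3 every T_n is covered. *)

theory Defs
  imports Main
begin

section \<open>First-order relational logic\<close>

text \<open>A relational language is a partial map assigning an arity to each of its symbols.\<close>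

type_synonym 's lang = "'s \<Rightarrow> nat option"

datatype 's fm =
    Eq nat nat
  | Rel 's "nat list"
  | Neg "'s fm"
  | And "'s fm" "'s fm"
  | Ex nat "'s fm"

fun fm_in :: "'s lang \<Rightarrow> 's fm \<Rightarrow> bool" where
  "fm_in L (Eq x y) \<longleftrightarrow> True"
| "fm_in L (Rel s xs) \<longleftrightarrow> L s = Some (length xs)"
| "fm_in L (Neg \<phi>) \<longleftrightarrow> fm_in L \<phi>"
| "fm_in L (And \<phi> \<psi>) \<longleftrightarrow> fm_in L \<phi> \<and> fm_in L \<psi>"
| "fm_in L (Ex x \<phi>) \<longleftrightarrow> fm_in L \<phi>"

fun free_vars :: "'s fm \<Rightarrow> nat set" where
  "free_vars (Eq x y) = {x, y}"
| "free_vars (Rel s xs) = set xs"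
| "free_vars (Neg \<phi>) = free_vars \<phi>"
| "free_vars (And \<phi> \<psi>) = free_vars \<phi> \<union> free_vars \<psi>"
| "free_vars (Ex x \<phi>) = free_vars \<phi> - {x}"

definition sentences :: "'s lang \<Rightarrow> 's fm set" where
  "sentences L = {\<phi>. fm_in L \<phi> \<and> free_vars \<phi> = {}}"

text \<open>The values of \<open>interp\<close> at symbols outside the language, at lists of the wrong length and at
  lists leaving the universe are irrelevant to everything below.\<close>

record ('s, 'a) struct =
  univ :: "'a set"
  interp :: "'s \<Rightarrow> 'a list \<Rightarrow> bool"

fun sat :: "('s, 'a) struct \<Rightarrow> (nat \<Rightarrow> 'a) \<Rightarrow> 's fm \<Rightarrow> bool" where
  "sat M v (Eq x y) \<longleftrightarrow> v x = v y"
| "sat M v (Rel s xs) \<longleftrightarrow> interp M s (map v xs)"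
| "sat M v (Neg \<phi>) \<longleftrightarrow> \<not> sat M v \<phi>"
| "sat M v (And \<phi> \<psi>) \<longleftrightarrow> sat M v \<phi> \<and> sat M v \<psi>"
| "sat M v (Ex x \<phi>) \<longleftrightarrow> (\<exists>a\<in>univ M. sat M (v(x := a)) \<phi>)"

definition holds :: "('s, 'a) struct \<Rightarrow> 's fm \<Rightarrow> bool" where
  "holds M \<phi> \<longleftrightarrow> (\<forall>v. range v \<subseteq> univ M \<longrightarrow> sat M v \<phi>)"

definition Th :: "'s lang \<Rightarrow> ('s, 'a) struct \<Rightarrow> 's fm set" where
  "Th L M = {\<phi> \<in> sentences L. holds M \<phi>}"

definition is_model :: "'s fm set \<Rightarrow> ('s, 'a) struct \<Rightarrow> bool" where
  "is_model T M \<longleftrightarrow> univ M \<noteq> {} \<and> (\<forall>\<phi>\<in>T. holds M \<phi>)"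

text \<open>Consistency is expressed by the existence of a model; all languages used below are
  countable, so models with universe contained in \<open>nat\<close> suffice (Loewenheim-Skolem).\<close>

definition complete_theory :: "'s lang \<Rightarrow> 's fm set \<Rightarrow> bool" where
  "complete_theory L T \<longleftrightarrow>
     T \<subseteq> sentences L \<and>
     (\<exists>M :: ('s, nat) struct. is_model T M) \<and>
     (\<forall>\<phi>\<in>sentences L. \<phi> \<in> T \<or> Neg \<phi> \<in> T)"

definition isomorphic :: "'s lang \<Rightarrow> ('s, 'a) struct \<Rightarrow> ('s, 'b) struct \<Rightarrow> bool" where
  "isomorphic L M N \<longleftrightarrow>
     (\<exists>f. bij_betw f (univ M) (univ N) \<and>
          (\<forall>s xs. L s = Some (length xs) \<and> set xs \<subseteq> univ M \<longrightarrow>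
                  (interp M s xs \<longleftrightarrow> interp N s (map f xs))))"

text \<open>Up to isomorphism, the models of cardinality \<open>\<omega>\<close> are those whose universe is an infinite
  set of natural numbers.\<close>

definition countable_models :: "'s fm set \<Rightarrow> ('s, nat) struct set" where
  "countable_models T = {M. infinite (univ M) \<and> is_model T M}"

definition countable_iso_classes :: "'s lang \<Rightarrow> 's fm set \<Rightarrow> ('s, nat) struct set set" where
  "countable_iso_classes L T =
     countable_models T //
       {(M, N). M \<in> countable_models T \<and> N \<in> countable_models T \<and> isomorphic L M N}"

text \<open>\<open>I(T, \<omega>) = m\<close>\<close>

definition has_spectrum :: "'s lang \<Rightarrow> 's fm set \<Rightarrow> nat \<Rightarrow> bool" where
  "has_spectrum L T m \<longleftrightarrow>
     finite (countable_iso_classes L T) \<and> card (countable_iso_classes L T) = m"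


section \<open>Spherical orders\<close>

definition linear_ord :: "'a set \<Rightarrow> ('a list \<Rightarrow> bool) \<Rightarrow> bool" where
  "linear_ord A K \<longleftrightarrow> linear_order_on A {(x, y) \<in> A \<times> A. K [x, y]}"

definition circular_ord :: "'a set \<Rightarrow> ('a list \<Rightarrow> bool) \<Rightarrow> bool" where
  "circular_ord A K \<longleftrightarrow>
     (\<forall>x\<in>A. \<forall>y\<in>A. \<forall>z\<in>A.
        (K [x, y, z] \<longrightarrow> K [y, z, x]) \<and>
        (K [x, y, z] \<and> K [y, x, z] \<longleftrightarrow> x = y \<or> y = z \<or> z = x) \<and>
        (K [x, y, z] \<longrightarrow> (\<forall>t\<in>A. K [x, y, t] \<or> K [t, y, z])) \<and>
        (K [x, y, z] \<or> K [y, x, z]))"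

definition tuples :: "nat \<Rightarrow> 'a set \<Rightarrow> 'a list set" where
  "tuples n A = {xs. length xs = n \<and> set xs \<subseteq> A}"

definition swap :: "nat \<Rightarrow> nat \<Rightarrow> 'a list \<Rightarrow> 'a list" where
  "swap i j xs = xs[i := xs ! j, j := xs ! i]"

definition nso1 :: "nat \<Rightarrow> 'a set \<Rightarrow> ('a list \<Rightarrow> bool) \<Rightarrow> bool" where
  "nso1 n A K \<longleftrightarrow> (\<forall>xs\<in>tuples n A. K xs \<longrightarrow> K (rotate1 xs))"

definition nso2 :: "nat \<Rightarrow> 'a set \<Rightarrow> ('a list \<Rightarrow> bool) \<Rightarrow> bool" where
  "nso2 n A K \<longleftrightarrow>
     (\<forall>xs\<in>tuples n A. \<forall>j<n. \<forall>i<j. K xs \<and> K (swap i j xs) \<longleftrightarrow> (\<exists>l<n. \<exists>k<l. xs ! k = xs ! l))"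

definition nso3 :: "nat \<Rightarrow> 'a set \<Rightarrow> ('a list \<Rightarrow> bool) \<Rightarrow> bool" where
  "nso3 n A K \<longleftrightarrow> (\<forall>xs\<in>tuples n A. K xs \<longrightarrow> (\<forall>t\<in>A. \<exists>i<n. K (xs[i := t])))"

definition nso4 :: "nat \<Rightarrow> 'a set \<Rightarrow> ('a list \<Rightarrow> bool) \<Rightarrow> bool" where
  "nso4 n A K \<longleftrightarrow> (\<forall>xs\<in>tuples n A. \<forall>j<n. \<forall>i<j. K xs \<or> K (swap i j xs))"

text \<open>Cyclic invariance \<open>nso1\<close> is demanded for odd \<open>n\<close> only. For even \<open>n\<close> a cyclic shift is an odd
  permutation, so \<open>nso1\<close> contradicts \<open>nso2\<close> and \<open>nso4\<close> as soon as there are \<open>n\<close> distinct elements,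
  and no dense order would exist; see \<open>no_dense_if_nso1_even\<close> below.\<close>

definition spherical_order :: "nat \<Rightarrow> 'a set \<Rightarrow> ('a list \<Rightarrow> bool) \<Rightarrow> bool" where
  "spherical_order n A K \<longleftrightarrow>
     (n = 2 \<and> linear_ord A K) \<or>
     (n = 3 \<and> circular_ord A K) \<or>
     (n \<ge> 4 \<and> (odd n \<longrightarrow> nso1 n A K) \<and> nso2 n A K \<and> nso3 n A K \<and> nso4 n A K)"

definition dense_spherical :: "nat \<Rightarrow> 'a set \<Rightarrow> ('a list \<Rightarrow> bool) \<Rightarrow> bool" where
  "dense_spherical n A K \<longleftrightarrow>
     (\<exists>x\<in>A. \<exists>y\<in>A. x \<noteq> y) \<and>
     (\<forall>xs\<in>tuples n A. K xs \<and> xs ! 0 \<noteq> xs ! 1 \<longrightarrow>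
        (\<exists>b\<in>A - set xs. K (xs[1 := b]) \<and> K (xs[0 := b])))"

definition no_endpoints :: "'a set \<Rightarrow> ('a list \<Rightarrow> bool) \<Rightarrow> bool" where
  "no_endpoints A K \<longleftrightarrow>
     (\<forall>x\<in>A. (\<exists>y\<in>A. y \<noteq> x \<and> K [y, x]) \<and> (\<exists>z\<in>A. z \<noteq> x \<and> K [x, z]))"

lemma swap_flips:
  assumes "nso2 n A K" "nso4 n A K" "xs \<in> tuples n A" "distinct xs" "i < j" "j < n"
  shows "K (swap i j xs) \<longleftrightarrow> \<not> K xs"
proof -
  have "\<not> (\<exists>l<n. \<exists>k<l. xs ! k = xs ! l)"
    using assms(3,4) by (auto simp: tuples_def distinct_conv_nth)
  moreover have "K xs \<and> K (swap i j xs) \<longleftrightarrow> (\<exists>l<n. \<exists>k<l. xs ! k = xs ! l)"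
    using assms(1,3,5,6) unfolding nso2_def by simp
  moreover have "K xs \<or> K (swap i j xs)"
    using assms(2,3,5,6) unfolding nso4_def by simp
  ultimately show ?thesis
    by metis
qed

lemma no_distinct_tuple_if_nso1_even:
  assumes "even n" "n > 0" and ax: "nso1 n A K" "nso2 n A K" "nso4 n A K"
    and xs: "xs \<in> tuples n A"
  shows "\<not> distinct xs"
proof
  assume "distinct xs"
  have no: "\<not> K ys" if ys: "ys \<in> tuples n A" "distinct ys" for ys
  proof -
    obtain a zs where yz: "ys = a # zs"
      using ys \<open>n > 0\<close> by (cases ys) (auto simp: tuples_def)
    define w where "w k = take k zs @ a # drop k zs" for k
    have len: "length zs = n - 1"
      using ys yz by (auto simp: tuples_def)
    have step: "w (Suc k) = swap k (Suc k) (w k)" if "k < n - 1" for k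
    proof -
      have "drop k zs = zs ! k # drop (Suc k) zs" "take (Suc k) zs = take k zs @ [zs ! k]"
        using that len by (auto simp: Cons_nth_drop_Suc take_Suc_conv_app_nth)
      then show ?thesis
        using that len by (simp add: w_def swap_def nth_append list_update_append)
    qed
    have perm: "w k \<in> tuples n A \<and> distinct (w k)" for k
    proof -
      have "set (w k) = set ys"
        unfolding w_def yz using set_append[of "take k zs" "drop k zs"] by auto
      moreover have "length (w k) = length ys"
        unfolding w_def yz by simp
      ultimately show ?thesis
        using ys by (auto simp: tuples_def card_distinct distinct_card)
    qed
    have "K (w k) \<longleftrightarrow> (if even k then K ys else \<not> K ys)" if "k \<le> n - 1" for k
      using that
    proof (induction k)
      case 0
      then show ?case by (simp add: w_def yz)
    next
      case (Suc k)
      then show ?case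
        using step[of k] swap_flips[OF ax(2,3), of "w k" k "Suc k"] perm[of k] by simp
    qed
    from this[of "n - 1"] have "K (rotate1 ys) \<longleftrightarrow> \<not> K ys"
      using \<open>even n\<close> \<open>n > 0\<close> len by (simp add: w_def yz)
    then show ?thesis
      using ax(1) ys unfolding nso1_def by blast
  qed
  have "n \<ge> 2" using \<open>even n\<close> \<open>n > 0\<close> by (auto elim!: evenE)
  then have i: "0 < (1::nat)" "1 < n" by auto
  have "swap 0 1 xs \<in> tuples n A" "distinct (swap 0 1 xs)"
    using xs \<open>distinct xs\<close> i by (auto simp: tuples_def swap_def)
  then show False
    using no xs \<open>distinct xs\<close> swap_flips[OF ax(2,3) xs \<open>distinct xs\<close> i] by blast
qed

lemma no_dense_if_nso1_even:
  assumes "even n" "n \<ge> 4" "nso1 n A K" "nso2 n A K" "nso4 n A K"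
  shows "\<not> dense_spherical n A K"
proof
  assume d: "dense_spherical n A K"
  have fin: "finite A \<and> card A < n"
  proof (rule ccontr)
    assume "\<not> (finite A \<and> card A < n)"
    then have "\<exists>B\<subseteq>A. finite B \<and> card B = n"
    proof (cases "finite A")
      case True
      then have "n \<le> card A"
        using \<open>\<not> (finite A \<and> card A < n)\<close> by simp
      then show ?thesis
        by (rule obtain_subset_with_card_n) blast
    next
      case False
      then show ?thesis
        using infinite_arbitrarily_large[of A n] by blast
    qed
    then obtain B where "B \<subseteq> A" "finite B" "card B = n"
      by blast
    then obtain xs where "set xs = B" "distinct xs"
      using finite_distinct_list by blast
    then have "xs \<in> tuples n A"
      using \<open>B \<subseteq> A\<close> \<open>card B = n\<close> by (auto simp: tuples_def distinct_card)
    then show False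
      using no_distinct_tuple_if_nso1_even[OF assms(1) _ assms(3-5)] \<open>distinct xs\<close> assms(2) by simp
  qed
  obtain x y where xy: "x \<in> A" "y \<in> A" "x \<noteq> y"
    using d unfolding dense_spherical_def by blast
  obtain zs where zs: "set zs = A - {x, y}" "distinct zs"
    using fin finite_distinct_list[of "A - {x, y}"] by auto
  have "length zs = card A - 2"
    using zs xy fin distinct_card[of zs] card_Diff_subset[of "{x, y}" A] by simp
  define xs where "xs = x # y # zs @ replicate (n - card A) x"
  have "card A \<ge> 2"
    using xy fin card_mono[of A "{x, y}"] by auto
  then have len: "length xs = n"
    using \<open>length zs = _\<close> fin unfolding xs_def length_append length_replicate list.size by linarith
  have "set xs = {x, y} \<union> set zs"
    unfolding xs_def by auto
  then have set: "set xs = A"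
    using xy(1,2) by (simp add: zs(1) insert_absorb)
  have xs: "xs \<in> tuples n A"
    using len set by (simp add: tuples_def)
  have "\<not> distinct xs"
    using len set fin distinct_card[of xs] by auto
  then have "\<exists>l<n. \<exists>k<l. xs ! k = xs ! l"
    unfolding distinct_conv_nth len by (metis linorder_neqE_nat)
  moreover have "K xs \<and> K (swap 0 1 xs) \<longleftrightarrow> (\<exists>l<n. \<exists>k<l. xs ! k = xs ! l)"
    using assms(2,4) xs unfolding nso2_def by simp
  ultimately have "K xs"
    by metis
  moreover have "xs ! 0 \<noteq> xs ! 1"
    using xy(3) by (simp add: xs_def)
  ultimately obtain b where "b \<in> A - set xs"
    using d xs unfolding dense_spherical_def by blast
  then show False
    using set by simp
qed


section \<open>The theories \<open>T\<^sub>n\<close> and their unary expansions\<close>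

datatype sym = K | P nat

definition sph_lang :: "nat \<Rightarrow> sym lang" where
  "sph_lang n = [K \<mapsto> n]"

text \<open>\<open>T\<close> is \<open>Th(A)\<close> for some countable dense \<open>n\<close>-spherical order \<open>A\<close>. For \<open>n \<le> 3\<close> this determines
  \<open>T\<close>. For \<open>n \<ge> 4\<close> it does not, and \<open>T\<close> need not be countably categorical: let \<open>A\<close> be a countable dense
  subset of Euclidean \<open>(n-1)\<close>-space in general position, with \<open>K\<close> the positively oriented
  (or degenerate) \<open>n\<close>-tuples. There \<open>T\<^sub>n\<close> can only mean the theory of a suitably chosen \<open>A\<close>.\<close>

definition dense_spherical_theory :: "nat \<Rightarrow> sym fm set \<Rightarrow> bool" where
  "dense_spherical_theory n T \<longleftrightarrow>
     (\<exists>A :: (sym, nat) struct.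
        infinite (univ A) \<and>
        spherical_order n (univ A) (interp A K) \<and>
        dense_spherical n (univ A) (interp A K) \<and>
        (n = 2 \<longrightarrow> no_endpoints (univ A) (interp A K)) \<and>
        T = Th (sph_lang n) A)"

definition unary_expansion :: "'s lang \<Rightarrow> 's fm set \<Rightarrow> 's lang \<Rightarrow> 's fm set \<Rightarrow> bool" where
  "unary_expansion L T L' T' \<longleftrightarrow>
     L \<subseteq>\<^sub>m L' \<and> (\<forall>s \<in> dom L' - dom L. L' s = Some 1) \<and>
     complete_theory L' T' \<and> T \<subseteq> T'"

end

theory Submission
  imports Defs "HOL-Library.Extended_Nat" Complex_Main
begin

text \<open>For the base structure take the rationals, with \<open>K\<close> holding of the tuples that are degenerate or are
  evenly permuted increasing tuples; this is a dense spherical order for every \<open>n \<ge> 2\<close>.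
  The expansion names intervals \<open>I\<^sub>0 < I\<^sub>1 < \<dots>\<close> without endpoints by \<open>P (2 * i)\<close> and a partition into
  \<open>k\<close> dense colour classes by \<open>P (2 * c + 1)\<close>. Parameters from \<open>n - 2\<close> of the first \<open>n - 1\<close> intervals
  fill up \<open>K\<close> to a binary relation, so the linear order is definable from \<open>K\<close> and the intervals.
  With finitely many intervals a back-and-forth argument gives countable categoricity, hence \<open>m = 1\<close>.
  With infinitely many intervals, models agree on each finite sublanguage, so they are all elementarily
  equivalent, and as in Ehrenfeucht's example they are classified by the set of points above all
  intervals: it is empty, has no least element, or has a least element of one of \<open>k\<close> colours.
  This gives \<open>k + 2\<close> models.\<close>

section \<open>Sign of a tuple and spherical orders\<close>

text \<open>For n >= 3 the relation \<open>K\<close> by itself need not fix a linear order: for n =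
  3 it is a circular order, which may be cut open anywhere. The intervals are named to break this
  symmetry. \<open>order_of\<close> is one fixed formula in \<open>K\<close> and the first n - 1
  intervals, meaningful in every structure, and \<open>good\<close> states in first-order terms that
  it defines a linear order with \<open>K\<close> as its alternating relation and with all colours
  dense in all levels.

  Quantifiers are never eliminated. The expanded theory is the full theory of a prototype. Its
  models are \<open>good\<close> because \<open>good\<close> is first-order; conversely,
  back-and-forth makes countable \<open>good\<close> structures isomorphic, in the whole language or
  in each finite part of it, so they satisfy the same sentences.

  Colours are dense everywhere, so only the colour of a least point above all intervals can
  distinguish models. At least one colour exists, so the construction with infinitely many intervals
  starts at three models; this is where m = 2 falls out. For n <= 3 the base theory is unique by
  Cantor's theorem, applied for n = 3 after cutting the circle open.\<close>

definition ord_sgn :: "('a \<Rightarrow> 'a \<Rightarrow> bool) \<Rightarrow> 'a \<Rightarrow> 'a \<Rightarrow> int" where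
  "ord_sgn lt x y = (if lt x y then 1 else if lt y x then - 1 else 0)"

text \<open>On a linear order this is the sign of the Vandermonde product of the entries: 0 if an
  entry repeats, otherwise the sign of the permutation that sorts the list.\<close>

fun tuple_sgn :: "('a \<Rightarrow> 'a \<Rightarrow> bool) \<Rightarrow> 'a list \<Rightarrow> int" where
  "tuple_sgn lt [] = 1"
| "tuple_sgn lt (x # xs) = (\<Prod>y\<leftarrow>xs. ord_sgn lt x y) * tuple_sgn lt xs"

definition strict_linear :: "'a set \<Rightarrow> ('a \<Rightarrow> 'a \<Rightarrow> bool) \<Rightarrow> bool" where
  "strict_linear A lt \<longleftrightarrow>
     (\<forall>x\<in>A. \<not> lt x x) \<and>
     (\<forall>x\<in>A. \<forall>y\<in>A. \<forall>z\<in>A. lt x y \<longrightarrow> lt y z \<longrightarrow> lt x z) \<and>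
     (\<forall>x\<in>A. \<forall>y\<in>A. x = y \<or> lt x y \<or> lt y x)"

text \<open>All order facts about three points in quantifier-free form, so that later case
  distinctions on relative positions become propositional for the SMT calls.\<close>

lemma strict_linear_ground:
  assumes "strict_linear A lt" "x \<in> A" "y \<in> A" "z \<in> A"
  shows "\<not> lt x x" "\<not> lt y y" "\<not> lt z z"
    "lt x y \<longrightarrow> \<not> lt y x" "lt y z \<longrightarrow> \<not> lt z y" "lt x z \<longrightarrow> \<not> lt z x"
    "x = y \<or> lt x y \<or> lt y x" "y = z \<or> lt y z \<or> lt z y" "x = z \<or> lt x z \<or> lt z x"
    "lt x y \<longrightarrow> lt y z \<longrightarrow> lt x z" "lt x z \<longrightarrow> lt z y \<longrightarrow> lt x y"
    "lt y x \<longrightarrow> lt x z \<longrightarrow> lt y z" "lt y z \<longrightarrow> lt z x \<longrightarrow> lt y x"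
    "lt z x \<longrightarrow> lt x y \<longrightarrow> lt z y" "lt z y \<longrightarrow> lt y x \<longrightarrow> lt z x"
  using assms unfolding strict_linear_def by blast+

lemma strict_linear_irrefl: "strict_linear A lt \<Longrightarrow> x \<in> A \<Longrightarrow> \<not> lt x x"
  by (simp add: strict_linear_def)

lemma strict_linear_trans:
  "strict_linear A lt \<Longrightarrow> lt x y \<Longrightarrow> lt y z \<Longrightarrow> x \<in> A \<Longrightarrow> y \<in> A \<Longrightarrow> z \<in> A \<Longrightarrow> lt x z"
  unfolding strict_linear_def by blast

lemma strict_linear_total:
  "strict_linear A lt \<Longrightarrow> x \<in> A \<Longrightarrow> y \<in> A \<Longrightarrow> x = y \<or> lt x y \<or> lt y x"
  unfolding strict_linear_def by blast

lemma strict_linear_asym: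
  "strict_linear A lt \<Longrightarrow> lt x y \<Longrightarrow> x \<in> A \<Longrightarrow> y \<in> A \<Longrightarrow> \<not> lt y x"
  unfolding strict_linear_def by blast

lemma strict_linear_subset: "strict_linear A lt \<Longrightarrow> B \<subseteq> A \<Longrightarrow> strict_linear B lt"
  unfolding strict_linear_def by (meson subsetD)

lemma ord_sgn_swap:
  "strict_linear A lt \<Longrightarrow> x \<in> A \<Longrightarrow> y \<in> A \<Longrightarrow> ord_sgn lt y x = - ord_sgn lt x y"
  by (auto simp: ord_sgn_def dest: strict_linear_asym)

lemma ord_sgn_eq_0:
  "strict_linear A lt \<Longrightarrow> x \<in> A \<Longrightarrow> y \<in> A \<Longrightarrow> ord_sgn lt x y = 0 \<longleftrightarrow> x = y"
  using strict_linear_total[of A lt x y] strict_linear_irrefl[of A lt] by (auto simp: ord_sgn_def)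

lemma ord_sgn_range: "ord_sgn lt x y \<in> {- 1, 0, 1}"
  by (auto simp: ord_sgn_def)

lemma sgn_mult_range: "a \<in> {- 1, 0, 1 :: int} \<Longrightarrow> b \<in> {- 1, 0, 1} \<Longrightarrow> a * b \<in> {- 1, 0, 1}"
  by auto

lemma prod_ord_sgn_range: "(\<Prod>y\<leftarrow>xs. ord_sgn lt x y) \<in> {- 1, 0, 1}"
proof (induction xs)
  case (Cons a xs)
  then show ?case
    unfolding list.map prod_list.Cons by (rule sgn_mult_range[OF ord_sgn_range])
qed simp

lemma prod_ord_sgn_eq_0:
  assumes "strict_linear A lt" "x \<in> A" "set xs \<subseteq> A"
  shows "(\<Prod>y\<leftarrow>xs. ord_sgn lt x y) = 0 \<longleftrightarrow> x \<in> set xs"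
  using assms(3) by (induction xs) (auto simp: ord_sgn_eq_0[OF assms(1,2)])

lemma tuple_sgn_range: "tuple_sgn lt xs \<in> {- 1, 0, 1}"
proof (induction xs)
  case (Cons a xs)
  then show ?case
    unfolding tuple_sgn.simps by (rule sgn_mult_range[OF prod_ord_sgn_range])
qed simp

lemma tuple_sgn_eq_0:
  assumes "strict_linear A lt" "set xs \<subseteq> A"
  shows "tuple_sgn lt xs = 0 \<longleftrightarrow> \<not> distinct xs"
  using assms(2) by (induction xs) (auto simp: prod_ord_sgn_eq_0[OF assms(1)])

text \<open>The pairs of positions split into those inside \<open>xs\<close>, those inside
  \<open>ys\<close> and the mixed ones.\<close>

lemma tuple_sgn_append:
  "tuple_sgn lt (xs @ ys) =
     tuple_sgn lt xs * tuple_sgn lt ys * (\<Prod>x\<leftarrow>xs. \<Prod>y\<leftarrow>ys. ord_sgn lt x y)"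
  by (induction xs) (simp_all add: mult_ac)

lemma tuple_sgn_adjacent:
  assumes "strict_linear A lt" "x \<in> A" "y \<in> A"
  shows "tuple_sgn lt (us @ x # y # ws) = - tuple_sgn lt (us @ y # x # ws)"
proof -
  have "tuple_sgn lt (x # y # ws) = - tuple_sgn lt (y # x # ws)"
    using ord_sgn_swap[OF assms] by simp
  moreover have "(\<Prod>u\<leftarrow>us. \<Prod>z\<leftarrow>x # y # ws. ord_sgn lt u z) =
      (\<Prod>u\<leftarrow>us. \<Prod>z\<leftarrow>y # x # ws. ord_sgn lt u z)"
    by (simp add: mult_ac)
  ultimately show ?thesis
    unfolding tuple_sgn_append by simp
qed

lemma tuple_sgn_move:
  assumes "strict_linear A lt" "x \<in> A" "set vs \<subseteq> A"
  shows "tuple_sgn lt (us @ x # vs @ ws) = (- 1) ^ length vs * tuple_sgn lt (us @ vs @ x # ws)"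
  using assms(3)
proof (induction vs arbitrary: us)
  case (Cons v vs)
  have "tuple_sgn lt (us @ x # v # vs @ ws) = - tuple_sgn lt ((us @ [v]) @ x # vs @ ws)"
    using tuple_sgn_adjacent[OF assms(1,2)] Cons.prems by simp
  also have "\<dots> = (- 1) ^ length (v # vs) * tuple_sgn lt ((us @ [v]) @ vs @ x # ws)"
    using Cons by (simp del: append_assoc)
  finally show ?case by simp
qed simp

text \<open>Moving \<open>x\<close> right across \<open>vs\<close>, exchanging it with
  \<open>y\<close> and moving \<open>y\<close> left across \<open>vs\<close> takes an odd number of
  adjacent exchanges.\<close>

lemma tuple_sgn_transpose:
  assumes "strict_linear A lt" "x \<in> A" "y \<in> A" "set vs \<subseteq> A"
  shows "tuple_sgn lt (us @ x # vs @ y # ws) = - tuple_sgn lt (us @ y # vs @ x # ws)"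
proof -
  have "tuple_sgn lt (us @ x # vs @ y # ws) = (- 1) ^ length vs * tuple_sgn lt ((us @ vs) @ x # y # ws)"
    using tuple_sgn_move[OF assms(1,2,4)] by simp
  also have "\<dots> = - ((- 1) ^ length vs * tuple_sgn lt ((us @ vs) @ y # x # ws))"
    using tuple_sgn_adjacent[OF assms(1-3), of "us @ vs" ws] by simp
  also have "\<dots> = - tuple_sgn lt (us @ y # vs @ x # ws)"
    using tuple_sgn_move[OF assms(1,3,4), of us "x # ws"] by simp
  finally show ?thesis .
qed

lemma tuple_sgn_swap:
  assumes "strict_linear A lt" "set xs \<subseteq> A" "i < j" "j < length xs"
  shows "tuple_sgn lt (swap i j xs) = - tuple_sgn lt xs"
proof -
  define us vs ws where "us = take i xs" and "vs = drop (Suc i) (take j xs)" and "ws = drop (Suc j) xs"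
  have "take j xs = us @ xs ! i # vs"
    using assms(3,4) id_take_nth_drop[of i "take j xs"] by (simp add: us_def vs_def min_def)
  then have xs: "xs = us @ xs ! i # vs @ xs ! j # ws"
    using id_take_nth_drop[OF assms(4)] by (simp add: ws_def)
  have len: "length us = i" "length vs = j - Suc i"
    using assms(3,4) by (auto simp: us_def vs_def)
  obtain x y where xy: "xs = us @ x # vs @ y # ws"
    using xs by blast
  have nth: "xs ! i = x" "xs ! j = y"
    using assms(3) len by (auto simp: xy nth_append)
  have "swap i j xs = us @ y # vs @ x # ws"
    unfolding swap_def nth using assms(3) len by (auto simp: xy list_update_append split: nat.split)
  then show ?thesis
    using tuple_sgn_transpose[OF assms(1), of x y vs us ws] assms(2) xy by simp
qed

text \<open>The head passes all remaining entries, whose number is even.\<close>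

lemma tuple_sgn_rotate1:
  assumes "strict_linear A lt" "set xs \<subseteq> A" "odd (length xs)"
  shows "tuple_sgn lt (rotate1 xs) = tuple_sgn lt xs"
  using assms tuple_sgn_move[OF assms(1), of "hd xs" "tl xs" "[]" "[]"] by (cases xs) auto

lemma tuple_sgn_map:
  assumes "\<And>x y. x \<in> set xs \<Longrightarrow> y \<in> set xs \<Longrightarrow> lt' (f x) (f y) \<longleftrightarrow> lt x y"
  shows "tuple_sgn lt' (map f xs) = tuple_sgn lt xs"
  using assms
proof (induction xs)
  case (Cons a xs)
  have "map (ord_sgn lt' (f a) \<circ> f) xs = map (ord_sgn lt a) xs"
    using Cons.prems by (auto simp: ord_sgn_def)
  moreover have "tuple_sgn lt' (map f xs) = tuple_sgn lt xs"
    using Cons by simp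
  ultimately show ?case by (simp only: tuple_sgn.simps list.map map_map)
qed simp

lemma tuple_sgn_cong:
  assumes "\<And>x y. x \<in> set xs \<Longrightarrow> y \<in> set xs \<Longrightarrow> lt' x y \<longleftrightarrow> lt x y"
  shows "tuple_sgn lt' xs = tuple_sgn lt xs"
  using tuple_sgn_map[of xs lt' "\<lambda>x. x" lt] assms by simp

text \<open>Only the factors that involve position \<open>i\<close> could change, and
  \<open>eq\<close> keeps them.\<close>

lemma tuple_sgn_update:
  assumes lin: "strict_linear A lt" and "set xs \<subseteq> A" "t \<in> A" "i < length xs" "distinct xs"
    and eq: "\<And>y. y \<in> set xs \<Longrightarrow> y \<noteq> xs ! i \<Longrightarrow> ord_sgn lt t y = ord_sgn lt (xs ! i) y"
  shows "tuple_sgn lt (xs[i := t]) = tuple_sgn lt xs"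
proof -
  define x us ws where "x = xs ! i" and "us = take i xs" and "ws = drop (Suc i) xs"
  have xs: "xs = us @ x # ws"
    using id_take_nth_drop[OF assms(4)] by (simp add: x_def us_def ws_def)
  have upd: "xs[i := t] = us @ t # ws"
    using assms(4) by (simp add: upd_conv_take_nth_drop us_def ws_def)
  have e: "ord_sgn lt t y = ord_sgn lt x y" "ord_sgn lt y t = ord_sgn lt y x"
    if "y \<in> set us \<union> set ws" for y
  proof -
    have y: "y \<in> set xs" "y \<noteq> x" "y \<in> A" "x \<in> A"
      using that \<open>distinct xs\<close> assms(2) by (auto simp: xs)
    then show "ord_sgn lt t y = ord_sgn lt x y"
      using eq[of y] by (simp add: x_def)
    then show "ord_sgn lt y t = ord_sgn lt y x"
      using ord_sgn_swap[OF lin y(3)] y(4) assms(3) by simp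
  qed
  have "(\<Prod>y\<leftarrow>ws. ord_sgn lt t y) = (\<Prod>y\<leftarrow>ws. ord_sgn lt x y)"
    using e by (intro arg_cong[where f = prod_list] map_cong) auto
  moreover have "(\<Prod>u\<leftarrow>us. \<Prod>y\<leftarrow>t # ws. ord_sgn lt u y) = (\<Prod>u\<leftarrow>us. \<Prod>y\<leftarrow>x # ws. ord_sgn lt u y)"
    using e by (intro arg_cong[where f = prod_list] map_cong[OF refl]) simp
  ultimately have "tuple_sgn lt (us @ t # ws) = tuple_sgn lt (us @ x # ws)"
    unfolding tuple_sgn_append by simp
  then show ?thesis
    using upd xs by metis
qed

section \<open>Points next to a given point\<close>

definition same_side :: "('a \<Rightarrow> 'a \<Rightarrow> bool) \<Rightarrow> 'a \<Rightarrow> 'a \<Rightarrow> 'a \<Rightarrow> bool" where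
  "same_side lt x y z \<longleftrightarrow> (lt x z \<longleftrightarrow> lt y z) \<and> (lt z x \<longleftrightarrow> lt z y)"

lemma ord_sgn_same_side: "same_side lt x y z \<Longrightarrow> ord_sgn lt x z = ord_sgn lt y z"
  by (simp add: same_side_def ord_sgn_def)

text \<open>The witness is the element of \<open>S\<close> next to \<open>t\<close> on one of its
  two sides. A new point takes over this role exactly when it falls between \<open>t\<close> and the
  old witness.\<close>

lemma neighbour_in_finite:
  assumes lin: "strict_linear A lt" and "S \<subseteq> A" "t \<in> A" "finite S" "S \<noteq> {}" "t \<notin> S"
  shows "\<exists>x\<in>S. \<forall>y\<in>S. y \<noteq> x \<longrightarrow> same_side lt t x y"
  using assms(4,5,2,6)
proof (induction S rule: finite_ne_induct)
  case (insert a S)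
  then obtain x where x: "x \<in> S" "\<forall>y\<in>S. y \<noteq> x \<longrightarrow> same_side lt t x y"
    by auto
  have A: "x \<in> A" "a \<in> A" "x \<noteq> a" "t \<noteq> a" "t \<noteq> x" "S \<subseteq> A"
    using x(1) insert by auto
  show ?case
  proof (cases "same_side lt t x a")
    case True
    then show ?thesis using x A(3) by auto
  next
    case False
    have c: "(lt t a \<and> lt a x) \<or> (lt a t \<and> lt x a)"
      using False A(3-5) strict_linear_ground[OF lin A(1,2) assms(3)] unfolding same_side_def by (smt (verit))
    have "same_side lt t a y" if "y \<in> insert a S" "y \<noteq> a" for y
    proof -
      have y: "y \<in> S" "y \<in> A" using that A by auto
      consider "y = x" | "same_side lt t x y"
        using x(2) \<open>y \<in> S\<close> by blast
      then show ?thesis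
      proof cases
        case 1
        then show ?thesis
          using c strict_linear_ground[OF lin A(1,2) assms(3)] unfolding same_side_def by (smt (verit))
      next
        case 2
        then show ?thesis
          using c that(2) strict_linear_ground[OF lin A(1,2) \<open>y \<in> A\<close>]
            strict_linear_ground[OF lin assms(3) A(2) \<open>y \<in> A\<close>]
          unfolding same_side_def by (smt (verit))
      qed
    qed
    then show ?thesis by blast
  qed
qed auto

definition dense_linear :: "'a set \<Rightarrow> ('a \<Rightarrow> 'a \<Rightarrow> bool) \<Rightarrow> bool" where
  "dense_linear A lt \<longleftrightarrow> strict_linear A lt \<and> A \<noteq> {} \<and>
     (\<forall>x\<in>A. \<forall>y\<in>A. lt x y \<longrightarrow> (\<exists>z\<in>A. lt x z \<and> lt z y)) \<and>
     (\<forall>x\<in>A. (\<exists>y\<in>A. lt y x) \<and> (\<exists>z\<in>A. lt x z))"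

text \<open>\<open>s\<close> selects the side of \<open>a\<close>. Whenever a further point of
  \<open>S\<close> separates \<open>b\<close> from \<open>a\<close>, or is \<open>b\<close> itself,
  density moves \<open>b\<close> closer to \<open>a\<close>.\<close>

lemma dense_linear_near:
  assumes d: "dense_linear A lt" and "finite S" "S \<subseteq> A" "a \<in> A"
  shows "\<exists>b\<in>A. (if s then lt a b else lt b a) \<and> (\<forall>y\<in>S. y \<noteq> a \<longrightarrow> same_side lt b a y)"
  using assms(2,3)
proof (induction S rule: finite_induct)
  case empty
  then show ?case
    using d assms(4) unfolding dense_linear_def by (cases s) auto
next
  case (insert y S)
  then obtain b where b: "b \<in> A" "if s then lt a b else lt b a"
      "\<forall>y\<in>S. y \<noteq> a \<longrightarrow> same_side lt b a y"
    by auto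
  have lin: "strict_linear A lt"
    using d by (simp add: dense_linear_def)
  have y: "y \<in> A" "S \<subseteq> A"
    using insert by auto
  show ?case
  proof (cases "y = a \<or> same_side lt b a y")
    case True
    then show ?thesis using b by auto
  next
    case False
    have c: "(if s then lt a y else lt y a) \<and> (y = b \<or> (if s then lt y b else lt b y))"
      using False b(2) strict_linear_ground[OF lin assms(4) y(1) b(1)] unfolding same_side_def
      by (smt (verit))
    then obtain z where z: "z \<in> A" "if s then lt a z \<and> lt z y else lt z a \<and> lt y z"
      using d y(1) assms(4) unfolding dense_linear_def by metis
    have "same_side lt z a w" if w: "w \<in> insert y S" "w \<noteq> a" for w
    proof -
      have "w \<in> A" using w y by auto
      consider "w = y" | "same_side lt b a w"
        using w b(3) by blast
      then show ?thesis
      proof cases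
        case 1
        then show ?thesis
          using c z(2) strict_linear_ground[OF lin assms(4) y(1) z(1)] unfolding same_side_def
          by (smt (verit))
      next
        case 2
        then show ?thesis
          using z(2) c w(2) strict_linear_ground[OF lin assms(4) y(1) z(1)]
            strict_linear_ground[OF lin assms(4) \<open>w \<in> A\<close> z(1)]
            strict_linear_ground[OF lin assms(4) \<open>w \<in> A\<close> b(1)]
            strict_linear_ground[OF lin y(1) \<open>w \<in> A\<close> z(1)]
            strict_linear_ground[OF lin y(1) \<open>w \<in> A\<close> b(1)]
          unfolding same_side_def by (smt (verit))
      qed
    qed
    then show ?thesis
      using z by (intro bexI[OF _ z(1)]) (simp split: if_splits)
  qed
qed

abbreviation alternating :: "('a \<Rightarrow> 'a \<Rightarrow> bool) \<Rightarrow> 'a list \<Rightarrow> bool" where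
  "alternating lt xs \<equiv> 0 \<le> tuple_sgn lt xs"

section \<open>The alternating relation of a dense linear order is a dense spherical order\<close>

lemma linear_ord_alternating:
  assumes "strict_linear A lt"
  shows "linear_ord A (alternating lt)"
proof -
  have "alternating lt [x, y] \<longleftrightarrow> x = y \<or> lt x y" if "x \<in> A" "y \<in> A" for x y
    using strict_linear_ground[OF assms that(1) that]
    by (cases "x = y"; cases "lt x y"; cases "lt y x") (simp_all add: ord_sgn_def)
  then have "{(x, y) \<in> A \<times> A. alternating lt [x, y]} = {(x, y) \<in> A \<times> A. x = y \<or> lt x y}"
    by blast
  moreover have "linear_order_on A {(x, y) \<in> A \<times> A. x = y \<or> lt x y}"
    using assms
    unfolding linear_order_on_def partial_order_on_def preorder_on_def refl_on_def trans_def
      antisym_def total_on_def strict_linear_def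
    by blast
  ultimately show ?thesis
    unfolding linear_ord_def by simp
qed

text \<open>The even permutations of an increasing triple are its three cyclic shifts, so this is
  the circular order obtained by closing up the line.\<close>

lemma alternating3:
  assumes "strict_linear A lt" "x \<in> A" "y \<in> A" "z \<in> A"
  shows "alternating lt [x, y, z] \<longleftrightarrow> x = y \<or> y = z \<or> z = x \<or>
    (lt x y \<and> lt y z) \<or> (lt y z \<and> lt z x) \<or> (lt z x \<and> lt x y)"
proof (cases "x = y \<or> y = z \<or> z = x")
  case True
  then show ?thesis
    using tuple_sgn_eq_0[OF assms(1), of "[x, y, z]"] assms(2-) by auto
next
  case False
  have "ord_sgn lt u v = (if lt u v then 1 else - 1)" if "u \<noteq> v" "u \<in> A" "v \<in> A" for u v
    using strict_linear_total[OF assms(1) that(2,3)] that(1) by (auto simp: ord_sgn_def)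
  then have "alternating lt [x, y, z] \<longleftrightarrow> (lt x y \<longleftrightarrow> (lt x z \<longleftrightarrow> lt y z))"
    using False assms(2-) by (simp add: eq_commute[of z])
  then show ?thesis
    using False strict_linear_ground[OF assms] by (smt (verit))
qed

lemma circular_ord_alternating:
  assumes "strict_linear A lt"
  shows "circular_ord A (alternating lt)"
proof -
  show ?thesis
  unfolding circular_ord_def
  proof (intro ballI conjI impI)
    fix x y z assume A: "x \<in> A" "y \<in> A" "z \<in> A"
    note a = alternating3[OF assms]
    show "alternating lt [y, z, x]" if "alternating lt [x, y, z]"
      using that A by (auto simp only: a)
    show "alternating lt [x, y, z] \<and> alternating lt [y, x, z] \<longleftrightarrow> x = y \<or> y = z \<or> z = x"
      using strict_linear_ground[OF assms A] a[OF A] a[OF A(2,1,3)] by (smt (verit))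
    show "alternating lt [x, y, z] \<or> alternating lt [y, x, z]"
      using strict_linear_ground[OF assms A] a[OF A] a[OF A(2,1,3)] by (smt (verit))
    fix t assume "t \<in> A"
    assume "alternating lt [x, y, z]"
    then show "alternating lt [x, y, t] \<or> alternating lt [t, y, z]"
      using strict_linear_ground[OF assms A(1,2) \<open>t \<in> A\<close>] strict_linear_ground[OF assms A(2,3) \<open>t \<in> A\<close>]
        strict_linear_ground[OF assms A(1,3) \<open>t \<in> A\<close>]
        a[OF A] a[OF A(1,2) \<open>t \<in> A\<close>] a[OF \<open>t \<in> A\<close> A(2,3)]
      by (smt (verit))
  qed
qed

text \<open>A repeated entry survives a change at a third place, which exists because n >= 3. If all
  entries differ, \<open>t\<close> replaces its neighbour among them, or itself if it already
  occurs.\<close>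

lemma nso3_alternating:
  assumes lin: "strict_linear A lt" and "n \<ge> 3"
  shows "nso3 n A (alternating lt)"
  unfolding nso3_def
proof (intro ballI impI)
  fix xs t assume xs: "xs \<in> tuples n A" "alternating lt xs" and "t \<in> A"
  have len: "length xs = n" "set xs \<subseteq> A"
    using xs by (auto simp: tuples_def)
  show "\<exists>i<n. alternating lt (xs[i := t])"
  proof (cases "distinct xs")
    case False
    then obtain k l where kl: "k < n" "l < n" "k \<noteq> l" "xs ! k = xs ! l"
      by (auto simp: distinct_conv_nth len)
    have "\<not> {..<n} \<subseteq> {k, l}"
      using card_mono[of "{k, l}" "{..<n}"] assms(2) kl(3) by auto
    then obtain i where i: "i < n" "i \<noteq> k" "i \<noteq> l" by auto
    have "\<not> distinct (xs[i := t])"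
      using kl i len nth_eq_iff_index_eq[of "xs[i := t]" k l] by auto
    moreover have "set (xs[i := t]) \<subseteq> A"
      using len \<open>t \<in> A\<close> set_update_subset_insert[of xs i t] by blast
    ultimately show ?thesis
      using tuple_sgn_eq_0[OF lin, of "xs[i := t]"] i(1) by (intro exI[of _ i]) simp
  next
    case True
    show ?thesis
    proof (cases "t \<in> set xs")
      case True
      then show ?thesis
        using xs(2) len by (metis in_set_conv_nth list_update_id)
    next
      case False
      have "set xs \<noteq> {}" using len assms(2) by auto
      from neighbour_in_finite[OF lin len(2) \<open>t \<in> A\<close> _ this False]
      obtain x where x: "x \<in> set xs" "\<forall>y\<in>set xs. y \<noteq> x \<longrightarrow> same_side lt t x y"
        by auto
      then obtain i where "i < n" "x = xs ! i"
        using len by (metis in_set_conv_nth)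
      then show ?thesis
        using tuple_sgn_update[OF lin len(2) \<open>t \<in> A\<close> _ True, of i] ord_sgn_same_side x(2) xs(2) len
        by metis
    qed
  qed
qed

lemma spherical_order_alternating:
  assumes lin: "strict_linear A lt" and "n \<ge> 2"
  shows "spherical_order n A (alternating lt)"
proof -
  have sw: "tuple_sgn lt (swap i j xs) = - tuple_sgn lt xs"
    if "xs \<in> tuples n A" "i < j" "j < n" for xs i j
    using tuple_sgn_swap[OF lin] that by (auto simp: tuples_def)
  have nd: "tuple_sgn lt xs = 0 \<longleftrightarrow> (\<exists>l<n. \<exists>k<l. xs ! k = xs ! l)" if "xs \<in> tuples n A" for xs
  proof -
    have "set xs \<subseteq> A" "length xs = n" using that by (auto simp: tuples_def)
    then show ?thesis
      unfolding tuple_sgn_eq_0[OF lin \<open>set xs \<subseteq> A\<close>] distinct_conv_nth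
      by (metis less_trans nat_neq_iff)
  qed
  have "nso1 n A (alternating lt)" if "odd n"
    using that tuple_sgn_rotate1[OF lin] by (auto simp: nso1_def tuples_def)
  moreover have "nso2 n A (alternating lt)"
    unfolding nso2_def
  proof (intro ballI allI impI)
    fix xs i j assume xs: "xs \<in> tuples n A" and ij: "j < n" "i < j"
    show "alternating lt xs \<and> alternating lt (swap i j xs) \<longleftrightarrow> (\<exists>l<n. \<exists>k<l. xs ! k = xs ! l)"
      unfolding nd[OF xs, symmetric] sw[OF xs ij(2,1)] by linarith
  qed
  moreover have "nso4 n A (alternating lt)"
    unfolding nso4_def using sw by (metis linorder_le_cases neg_0_le_iff_le)
  moreover have "n = 2 \<or> n = 3 \<or> n \<ge> 4"
    using assms(2) by linarith
  ultimately show ?thesis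
    unfolding spherical_order_def
    using linear_ord_alternating[OF lin] circular_ord_alternating[OF lin] nso3_alternating[OF lin]
    by auto
qed

text \<open>The new point is taken so close to \<open>a1\<close> or to \<open>a2\<close> that it has
  the same signs against all other entries; its side decides the only new factor.\<close>

lemma dense_spherical_alternating:
  assumes d: "dense_linear A lt" and "n \<ge> 2"
  shows "dense_spherical n A (alternating lt)"
  unfolding dense_spherical_def
proof (intro conjI ballI impI)
  have lin: "strict_linear A lt"
    using d by (simp add: dense_linear_def)
  obtain x y where "x \<in> A" "y \<in> A" "lt y x"
    using d unfolding dense_linear_def by blast
  then show "\<exists>x\<in>A. \<exists>y\<in>A. x \<noteq> y"
    using strict_linear_irrefl[OF lin] by metis
  fix xs assume xs: "xs \<in> tuples n A" and K: "alternating lt xs \<and> xs ! 0 \<noteq> xs ! 1"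
  have len: "length xs = n" "set xs \<subseteq> A"
    using xs by (auto simp: tuples_def)
  then obtain a1 a2 zs where eq: "xs = a1 # a2 # zs"
    using assms(2) by (metis One_nat_def Suc_le_length_iff numeral_2_eq_2)
  have A: "a1 \<in> A" "a2 \<in> A" "set zs \<subseteq> A" "a1 \<noteq> a2"
    using len K eq by auto
  define W where "W = tuple_sgn lt zs"
  define g where "g x = (\<Prod>z\<leftarrow>zs. ord_sgn lt x z)" for x
  have V: "tuple_sgn lt (x # y # zs) = ord_sgn lt x y * g x * (g y * W)" for x y
    by (simp add: W_def g_def)
  \<comment> \<open>\<open>s * W\<close> is the absolute value of \<open>W\<close>. The two row
    products below combine to a square, so the side chosen by \<open>s\<close> settles the
    sign.\<close>
  define s where "s = (if W \<ge> 0 then 1 else - 1 :: int)"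
  have s: "s \<in> {- 1, 1}" "- s \<in> {- 1, 1}" "s * W \<ge> 0"
    by (auto simp: s_def)
  have near: "\<exists>b\<in>A - set xs. ord_sgn lt a b = r \<and> (\<forall>y\<in>set xs. y \<noteq> a \<longrightarrow> ord_sgn lt b y = ord_sgn lt a y)"
    if ar: "a \<in> A" "r \<in> {- 1, 1}" for a r
  proof -
    obtain b where b: "b \<in> A" "if r = 1 then lt a b else lt b a"
        and same: "\<forall>y\<in>set xs. y \<noteq> a \<longrightarrow> same_side lt b a y"
      using dense_linear_near[OF d _ len(2) ar(1), of "r = 1"] by blast
    have r: "ord_sgn lt a b = r"
      using b ar strict_linear_asym[OF lin] by (auto simp: ord_sgn_def)
    have "b \<noteq> a" using r ar ord_sgn_eq_0[OF lin ar(1,1)] by auto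
    then have "b \<notin> set xs"
      using same b strict_linear_total[OF lin ar(1) b(1)] strict_linear_irrefl[OF lin b(1)]
      unfolding same_side_def by metis
    then show ?thesis using b r ord_sgn_same_side[of lt b a] same by blast
  qed
  have gg: "g b = g a" if "a \<notin> set zs" "\<forall>y\<in>set xs. y \<noteq> a \<longrightarrow> ord_sgn lt b y = ord_sgn lt a y" for a b
    unfolding g_def using that by (intro arg_cong[where f = prod_list] map_cong) (auto simp: eq)
  have g0: "g a = 0" if "a \<in> A" "a \<in> set zs" for a
    unfolding g_def using prod_ord_sgn_eq_0[OF lin that(1) A(3)] that(2) by simp
  have "\<exists>b\<in>A - set xs. alternating lt (a1 # b # zs) \<and> alternating lt (b # a2 # zs)"
  \<comment> \<open>If \<open>a1\<close> recurs in \<open>zs\<close>, the tuple that keeps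
    \<open>a1\<close> is degenerate for every \<open>b\<close>, so \<open>b\<close> can be placed
    next to \<open>a2\<close>; otherwise \<open>b\<close> is placed next to
    \<open>a1\<close>.\<close>
  proof (cases "a1 \<in> set zs")
    case True
    obtain b where b: "b \<in> A - set xs" "ord_sgn lt a2 b = - s"
      "\<forall>y\<in>set xs. y \<noteq> a2 \<longrightarrow> ord_sgn lt b y = ord_sgn lt a2 y"
      using near[OF A(2) s(2)] by blast
    have "ord_sgn lt b a2 = s"
      using b(1,2) ord_sgn_swap[OF lin, of a2 b] A(2) by simp
    \<comment> \<open>Either \<open>a2\<close> recurs in \<open>zs\<close> as well and the sign is
      0, or \<open>b\<close> inherits the signs of \<open>a2\<close>.\<close>
    moreover have "g a2 = 0 \<or> g b = g a2"
      using gg[OF _ b(3)] g0[OF A(2)] by blast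
    ultimately have "alternating lt (b # a2 # zs)"
    proof (elim disjE)
      assume "g a2 = 0"
      then show ?thesis unfolding V by simp
    next
      assume "g b = g a2" and o: "ord_sgn lt b a2 = s"
      then have "tuple_sgn lt (b # a2 # zs) = (s * W) * (g a2 * g a2)"
        unfolding V by (simp add: mult_ac)
      then show ?thesis using s(3) by simp
    qed
    moreover have "alternating lt (a1 # b # zs)"
      unfolding V g0[OF A(1) True] by simp
    ultimately show ?thesis using b(1) by blast
  next
    case False
    obtain b where b: "b \<in> A - set xs" "ord_sgn lt a1 b = s"
      "\<forall>y\<in>set xs. y \<noteq> a1 \<longrightarrow> ord_sgn lt b y = ord_sgn lt a1 y"
      using near[OF A(1) s(1)] by blast
    have g: "g b = g a1"
      using gg[OF False b(3)] .
    have "tuple_sgn lt (a1 # b # zs) = (s * W) * (g a1 * g a1)"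
      unfolding V g b(2) by (simp add: mult_ac)
    then have "alternating lt (a1 # b # zs)" using s(3) by simp
    moreover have "tuple_sgn lt (b # a2 # zs) = tuple_sgn lt xs"
      unfolding eq V g using b(3) A(4) by (simp add: eq)
    ultimately show ?thesis using b(1) K by auto
  qed
  then show "\<exists>b\<in>A - set xs. alternating lt (xs[1 := b]) \<and> alternating lt (xs[0 := b])"
    by (simp add: eq)
qed

lemma no_endpoints_alternating:
  assumes "dense_linear A lt"
  shows "no_endpoints A (alternating lt)"
proof -
  have lin: "strict_linear A lt"
    using assms by (simp add: dense_linear_def)
  have "y \<noteq> x \<and> alternating lt [y, x]" if "lt y x" "x \<in> A" "y \<in> A" for x y
    using that strict_linear_irrefl[OF lin] by (auto simp: ord_sgn_def)
  then show ?thesis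
    using assms unfolding no_endpoints_def dense_linear_def by metis
qed

section \<open>Back-and-forth\<close>

text \<open>The Booleans \<open>p\<close> and \<open>q\<close> switch the lower bound
  \<open>a\<close> and the upper bound \<open>b\<close> on and off, so one clause covers density,
  absence of endpoints inside each level, and realisation of every level in every colour. Countable
  structures of this kind are unique for given \<open>Lv\<close> and \<open>C\<close>.\<close>

definition generic ::
  "'a set \<Rightarrow> ('a \<Rightarrow> 'a \<Rightarrow> bool) \<Rightarrow> ('a \<Rightarrow> 'l::linorder) \<Rightarrow> ('a \<Rightarrow> 'c) \<Rightarrow> 'l set \<Rightarrow> 'c set \<Rightarrow> bool" where
  "generic A lt lev col Lv C \<longleftrightarrow>
     strict_linear A lt \<and> A \<noteq> {} \<and> lev ` A \<subseteq> Lv \<and> col ` A \<subseteq> C \<and>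
     (\<forall>x\<in>A. \<forall>y\<in>A. lt x y \<longrightarrow> lev x \<le> lev y) \<and>
     (\<forall>p q. \<forall>a\<in>A. \<forall>b\<in>A. \<forall>l\<in>Lv. \<forall>c\<in>C.
        (p \<and> q \<longrightarrow> lt a b) \<and> (p \<longrightarrow> lev a \<le> l) \<and> (q \<longrightarrow> l \<le> lev b) \<longrightarrow>
        (\<exists>x\<in>A. lev x = l \<and> col x = c \<and> (p \<longrightarrow> lt a x) \<and> (q \<longrightarrow> lt x b)))"

lemma genericI:
  assumes "strict_linear A lt" "A \<noteq> {}" "lev ` A \<subseteq> Lv" "col ` A \<subseteq> C"
    and "\<And>x y. x \<in> A \<Longrightarrow> y \<in> A \<Longrightarrow> lt x y \<Longrightarrow> lev x \<le> lev y"
    and "\<And>p q a b l c. a \<in> A \<Longrightarrow> b \<in> A \<Longrightarrow> l \<in> Lv \<Longrightarrow> c \<in> C \<Longrightarrow> (p \<Longrightarrow> q \<Longrightarrow> lt a b) \<Longrightarrow>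
        (p \<Longrightarrow> lev a \<le> l) \<Longrightarrow> (q \<Longrightarrow> l \<le> lev b) \<Longrightarrow>
        \<exists>x\<in>A. lev x = l \<and> col x = c \<and> (p \<longrightarrow> lt a x) \<and> (q \<longrightarrow> lt x b)"
  shows "generic A lt lev col Lv C"
  unfolding generic_def using assms(1-5) by (intro conjI allI ballI impI assms(6)) auto

lemma generic_between_ex:
  assumes "generic A lt lev col Lv C" "a \<in> A" "b \<in> A" "l \<in> Lv" "c \<in> C"
    "p \<and> q \<longrightarrow> lt a b" "p \<longrightarrow> lev a \<le> l" "q \<longrightarrow> l \<le> lev b"
  shows "\<exists>x\<in>A. lev x = l \<and> col x = c \<and> (p \<longrightarrow> lt a x) \<and> (q \<longrightarrow> lt x b)"
proof -
  have "\<forall>p q. \<forall>a\<in>A. \<forall>b\<in>A. \<forall>l\<in>Lv. \<forall>c\<in>C.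
      (p \<and> q \<longrightarrow> lt a b) \<and> (p \<longrightarrow> lev a \<le> l) \<and> (q \<longrightarrow> l \<le> lev b) \<longrightarrow>
      (\<exists>x\<in>A. lev x = l \<and> col x = c \<and> (p \<longrightarrow> lt a x) \<and> (q \<longrightarrow> lt x b))"
    using assms(1) unfolding generic_def by (elim conjE)
  from this[rule_format, OF assms(2-5), of p q] show ?thesis
    using assms(6-8) by blast
qed

lemma generic_between:
  assumes "generic A lt lev col Lv C" "a \<in> A" "b \<in> A" "l \<in> Lv" "c \<in> C"
    "p \<Longrightarrow> q \<Longrightarrow> lt a b" "p \<Longrightarrow> lev a \<le> l" "q \<Longrightarrow> l \<le> lev b"
  obtains x where "x \<in> A" "lev x = l" "col x = c" "p \<Longrightarrow> lt a x" "q \<Longrightarrow> lt x b"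
  using generic_between_ex[OF assms(1-5), of p q] assms(6-8) that by blast

lemma generic_mono: "generic A lt lev col Lv C \<Longrightarrow> lt x y \<Longrightarrow> x \<in> A \<Longrightarrow> y \<in> A \<Longrightarrow> lev x \<le> lev y"
  by (simp add: generic_def)

lemma strict_linear_max:
  assumes lin: "strict_linear A lt" and "finite F" "F \<noteq> {}" "F \<subseteq> A"
  shows "\<exists>m\<in>F. \<forall>x\<in>F. x = m \<or> lt x m"
  using assms(2-4)
proof (induction F rule: finite_ne_induct)
  case (insert a F)
  then obtain m where m: "m \<in> F" "\<forall>x\<in>F. x = m \<or> lt x m" by auto
  have A: "a \<in> A" "m \<in> A" "F \<subseteq> A" using m insert by auto
  show ?case
  proof (cases "lt m a")
    case True
    have "lt x a" if "x \<in> F" for x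
      using m(2) that A True strict_linear_trans[OF lin, of x m a] by (metis subsetD)
    then have "\<forall>x\<in>insert a F. x = a \<or> lt x a" by blast
    then show ?thesis by blast
  next
    case False
    then show ?thesis
      using m A strict_linear_total[OF lin A(1,2)] by blast
  qed
qed auto

lemma strict_linear_converse: "strict_linear A lt \<Longrightarrow> strict_linear A (\<lambda>x y. lt y x)"
  unfolding strict_linear_def by blast

text \<open>Only the largest element of \<open>F\<close> and the smallest of \<open>G\<close>
  matter. Nonemptiness of \<open>F\<close> and \<open>G\<close> serves as the two switches of
  \<open>generic\<close>; for an empty set the bound is an arbitrary dummy.\<close>

lemma generic_finite:
  assumes g: "generic A lt lev col Lv C" and F: "finite F" "F \<subseteq> A" and G: "finite G" "G \<subseteq> A"
    and FG: "\<And>a b. a \<in> F \<Longrightarrow> b \<in> G \<Longrightarrow> lt a b"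
    and l: "l \<in> Lv" "\<And>a. a \<in> F \<Longrightarrow> lev a \<le> l" "\<And>b. b \<in> G \<Longrightarrow> l \<le> lev b" and c: "c \<in> C"
  shows "\<exists>x\<in>A. lev x = l \<and> col x = c \<and> (\<forall>a\<in>F. lt a x) \<and> (\<forall>b\<in>G. lt x b)"
proof -
  have lin: "strict_linear A lt" and "A \<noteq> {}"
    using g by (auto simp: generic_def)
  obtain a where a: "a \<in> A" "F \<noteq> {} \<Longrightarrow> a \<in> F" "\<forall>x\<in>F. x = a \<or> lt x a"
  proof (cases "F = {}")
    case True
    then show ?thesis using \<open>A \<noteq> {}\<close> that by blast
  next
    case False
    then show ?thesis using strict_linear_max[OF lin F(1) False F(2)] F(2) that by blast
  qed
  obtain b where b: "b \<in> A" "G \<noteq> {} \<Longrightarrow> b \<in> G" "\<forall>x\<in>G. x = b \<or> lt b x"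
  proof (cases "G = {}")
    case True
    then show ?thesis using \<open>A \<noteq> {}\<close> that by blast
  next
    case False
    then show ?thesis
      using strict_linear_max[OF strict_linear_converse[OF lin] G(1) False G(2)] G(2) that by blast
  qed
  obtain x where x: "x \<in> A" "lev x = l" "col x = c" "F \<noteq> {} \<Longrightarrow> lt a x" "G \<noteq> {} \<Longrightarrow> lt x b"
  proof (rule generic_between[OF g a(1) b(1) l(1) c, of "F \<noteq> {}" "G \<noteq> {}"])
    show "lt a b" if "F \<noteq> {}" "G \<noteq> {}" using a(2) b(2) FG that by blast
    show "lev a \<le> l" if "F \<noteq> {}" using a(2) l(2) that by blast
    show "l \<le> lev b" if "G \<noteq> {}" using b(2) l(3) that by blast
  qed blast
  have "lt y x" if y: "y \<in> F" for y
  proof -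
    have "lt a x" "y \<in> A" "y = a \<or> lt y a" using x(4) a(3) y F(2) by auto
    then show ?thesis using strict_linear_trans[OF lin, of y a x] a(1) x(1) by auto
  qed
  moreover have "lt x y" if y: "y \<in> G" for y
  proof -
    have "lt x b" "y \<in> A" "y = b \<or> lt b y" using x(5) b(3) y G(2) by auto
    then show ?thesis using strict_linear_trans[OF lin, of x b y] b(1) x(1) by auto
  qed
  ultimately show ?thesis
    using x by blast
qed

section \<open>Finite partial isomorphisms and Cantor's argument\<close>

definition partial_iso where
  "partial_iso A lt lev col B lt' lev' col' p \<longleftrightarrow>
     finite p \<and> p \<subseteq> A \<times> B \<and> 
     (\<forall>x y. (x, y) \<in> p \<longrightarrow> lev x = lev' y \<and> col x = col' y) \<and>
     (\<forall>x y x' y'. (x, y) \<in> p \<longrightarrow> (x', y') \<in> p \<longrightarrow> (x = x' \<longleftrightarrow> y = y') \<and> (lt x x' \<longleftrightarrow> lt' y y'))"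

lemma partial_iso_converse:
  "partial_iso A lt lev col B lt' lev' col' p \<Longrightarrow> partial_iso B lt' lev' col' A lt lev col (p\<inverse>)"
  unfolding partial_iso_def
proof (elim conjE, intro conjI)
  assume *: "\<forall>x y x' y'. (x, y) \<in> p \<longrightarrow> (x', y') \<in> p \<longrightarrow> (x = x' \<longleftrightarrow> y = y') \<and> (lt x x' \<longleftrightarrow> lt' y y')"
  show "\<forall>x y x' y'. (x, y) \<in> p\<inverse> \<longrightarrow> (x', y') \<in> p\<inverse> \<longrightarrow> (x = x' \<longleftrightarrow> y = y') \<and> (lt' x x' \<longleftrightarrow> lt y y')"
    using * unfolding converse_iff by metis
qed auto

text \<open>The image of \<open>a\<close> has to lie above \<open>F\<close> and below
  \<open>G\<close>, the images of the points below and above \<open>a\<close>. Monotonicity of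
  \<open>lev\<close> makes the level of \<open>a\<close> admissible in this gap.\<close>

lemma partial_iso_extend:
  assumes gA: "generic A lt lev col Lv C" and gB: "generic B lt' lev' col' Lv C"
    and p: "partial_iso A lt lev col B lt' lev' col' p" and a: "a \<in> A"
  shows "\<exists>p'. partial_iso A lt lev col B lt' lev' col' p' \<and> p \<subseteq> p' \<and> a \<in> Domain p'"
proof (cases "a \<in> Domain p")
  case True
  then show ?thesis using p by blast
next
  case False
  have linA: "strict_linear A lt" and linB: "strict_linear B lt'"
    using gA gB by (auto simp: generic_def)
  have pAB: "x \<in> A" "y \<in> B" "lev x = lev' y" "col x = col' y" if "(x, y) \<in> p" for x y
    using p that unfolding partial_iso_def by auto
  have plt: "x = x' \<longleftrightarrow> y = y'" "lt x x' \<longleftrightarrow> lt' y y'" if "(x, y) \<in> p" "(x', y') \<in> p" for x y x' y'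
  proof -
    have "\<forall>x y x' y'. (x, y) \<in> p \<longrightarrow> (x', y') \<in> p \<longrightarrow> (x = x' \<longleftrightarrow> y = y') \<and> (lt x x' \<longleftrightarrow> lt' y y')"
      using p unfolding partial_iso_def by (elim conjE)
    from this[rule_format, OF that] have "(x = x' \<longleftrightarrow> y = y') \<and> (lt x x' \<longleftrightarrow> lt' y y')" .
    then show "x = x' \<longleftrightarrow> y = y'" "lt x x' \<longleftrightarrow> lt' y y'" by auto
  qed
  define F where "F = snd ` {(x, y) \<in> p. lt x a}"
  define G where "G = snd ` {(x, y) \<in> p. lt a x}"
  have "finite p"
    using p by (simp add: partial_iso_def)
  then have fin: "finite F" "finite G"
    unfolding F_def G_def by (auto intro: finite_subset)
  have sub: "F \<subseteq> B" "G \<subseteq> B"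
    using pAB by (auto simp: F_def G_def)
  have lt: "lt' u v" if uv: "u \<in> F" "v \<in> G" for u v
  proof -
    obtain x x' where x: "(x, u) \<in> p" "lt x a" "(x', v) \<in> p" "lt a x'"
      using uv by (auto simp: F_def G_def)
    then have "lt x x'"
      using strict_linear_trans[OF linA x(2,4)] pAB a by blast
    then show ?thesis
      using plt x by blast
  qed
  have levF: "lev' u \<le> lev a" if u: "u \<in> F" for u
  proof -
    obtain x where x: "(x, u) \<in> p" "lt x a"
      using u by (auto simp: F_def)
    then have "lev x \<le> lev a"
      using generic_mono[OF gA] pAB(1) a by blast
    then show ?thesis using pAB x by simp
  qed
  have levG: "lev a \<le> lev' u" if u: "u \<in> G" for u
  proof -
    obtain x where x: "(x, u) \<in> p" "lt a x"
      using u by (auto simp: G_def)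
    then have "lev a \<le> lev x"
      using generic_mono[OF gA] pAB(1) a by blast
    then show ?thesis using pAB x by simp
  qed
  have "lev a \<in> Lv" "col a \<in> C"
    using gA a by (auto simp: generic_def)
  then obtain b where b: "b \<in> B" "lev' b = lev a" "col' b = col a"
      "\<forall>u\<in>F. lt' u b" "\<forall>v\<in>G. lt' b v"
    using generic_finite[OF gB fin(1) sub(1) fin(2) sub(2), of "lev a" "col a"] lt levF levG by auto
  have new: "x \<noteq> a \<and> y \<noteq> b \<and> (lt x a \<longleftrightarrow> lt' y b) \<and> (lt a x \<longleftrightarrow> lt' b y)" if xy: "(x, y) \<in> p" for x y
  proof -
    have x: "x \<in> A" "y \<in> B" "x \<noteq> a" using xy pAB False by auto
    have "y \<in> F" if "lt x a" using xy that by (auto simp: F_def image_iff)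
    moreover have "y \<in> G" if "lt a x" using xy that by (auto simp: G_def image_iff)
    ultimately have "lt x a \<longrightarrow> lt' y b" "lt a x \<longrightarrow> lt' b y"
      using b(4,5) by blast+
    then show ?thesis
      using x(3) strict_linear_ground[OF linA x(1) a a] strict_linear_ground[OF linB x(2) b(1,1)]
      by (smt (verit))
  qed
  have "partial_iso A lt lev col B lt' lev' col' (insert (a, b) p)"
    unfolding partial_iso_def
  proof (intro conjI)
    show "finite (insert (a, b) p)" using \<open>finite p\<close> by simp
    show "insert (a, b) p \<subseteq> A \<times> B" using pAB a b by auto
    show "\<forall>x y. (x, y) \<in> insert (a, b) p \<longrightarrow> lev x = lev' y \<and> col x = col' y"
      using pAB b by auto
    have ab: "\<not> lt a a" "\<not> lt' b b"
      using strict_linear_irrefl[OF linA a] strict_linear_irrefl[OF linB b(1)] by auto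
    show "\<forall>x y x' y'. (x, y) \<in> insert (a, b) p \<longrightarrow> (x', y') \<in> insert (a, b) p \<longrightarrow>
        (x = x' \<longleftrightarrow> y = y') \<and> (lt x x' \<longleftrightarrow> lt' y y')"
    proof (intro allI impI)
      fix x y x' y' assume "(x, y) \<in> insert (a, b) p" "(x', y') \<in> insert (a, b) p"
      then consider "(x, y) \<in> p" "(x', y') \<in> p" | "(x, y) \<in> p" "x' = a" "y' = b"
        | "x = a" "y = b" "(x', y') \<in> p" | "x = a" "y = b" "x' = a" "y' = b"
        by auto
      then show "(x = x' \<longleftrightarrow> y = y') \<and> (lt x x' \<longleftrightarrow> lt' y y')"
      proof cases
        case 1
        then show ?thesis using plt by blast
      next
        case 2
        then show ?thesis using new[OF 2(1)] by blast
      next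
        case 3
        then show ?thesis using new[OF 3(3)] by blast
      next
        case 4
        then show ?thesis using ab by blast
      qed
    qed
  qed
  then show ?thesis by blast
qed

text \<open>Both universes consist of natural numbers, so step \<open>n\<close> treats the number
  \<open>n\<close> itself, first as a point of \<open>A\<close> and then as a point of
  \<open>B\<close>.\<close>

theorem back_and_forth:
  fixes A B :: "nat set"
  assumes gA: "generic A lt lev col Lv C" and gB: "generic B lt' lev' col' Lv C"
  obtains f where "bij_betw f A B"
    "\<And>x y. x \<in> A \<Longrightarrow> y \<in> A \<Longrightarrow> lt' (f x) (f y) \<longleftrightarrow> lt x y"
    "\<And>x. x \<in> A \<Longrightarrow> lev' (f x) = lev x" "\<And>x. x \<in> A \<Longrightarrow> col' (f x) = col x"
proof -
  let ?P = "partial_iso A lt lev col B lt' lev' col'"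
  have "\<exists>p. \<forall>n. ?P (p n) \<and> (p n \<subseteq> p (Suc n) \<and> (n \<in> A \<longrightarrow> n \<in> Domain (p (Suc n))) \<and>
      (n \<in> B \<longrightarrow> n \<in> Range (p (Suc n))))"
  proof (rule dependent_nat_choice)
    show "\<exists>p. ?P p" by (rule exI[of _ "{}"]) (simp add: partial_iso_def)
    fix p n assume p: "?P p"
    obtain p1 where p1: "?P p1" "p \<subseteq> p1" "n \<in> A \<longrightarrow> n \<in> Domain p1"
      using partial_iso_extend[OF gA gB p, of n] p by blast
    \<comment> \<open>The back step is the forth step applied to the converse map.\<close>
    obtain p2 where p2: "partial_iso B lt' lev' col' A lt lev col p2" "p1\<inverse> \<subseteq> p2" "n \<in> B \<longrightarrow> n \<in> Domain p2"
      using partial_iso_extend[OF gB gA partial_iso_converse[OF p1(1)], of n]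
        partial_iso_converse[OF p1(1)] by blast
    have "p \<subseteq> p2\<inverse>" "n \<in> A \<longrightarrow> n \<in> Domain (p2\<inverse>)" "n \<in> B \<longrightarrow> n \<in> Range (p2\<inverse>)"
      using p1(2,3) p2(2,3) by auto
    then show "\<exists>p'. ?P p' \<and> (p \<subseteq> p' \<and> (n \<in> A \<longrightarrow> n \<in> Domain p') \<and> (n \<in> B \<longrightarrow> n \<in> Range p'))"
      using partial_iso_converse[OF p2(1)] by blast
  qed
  then obtain p where P: "\<forall>n. ?P (p n) \<and> (p n \<subseteq> p (Suc n) \<and> (n \<in> A \<longrightarrow> n \<in> Domain (p (Suc n))) \<and>
      (n \<in> B \<longrightarrow> n \<in> Range (p (Suc n))))" ..
  have p: "?P (p n)" "p n \<subseteq> p (Suc n)" "n \<in> A \<Longrightarrow> n \<in> Domain (p (Suc n))"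
    "n \<in> B \<Longrightarrow> n \<in> Range (p (Suc n))" for n
    using P[rule_format, of n] by (elim conjE; assumption | simp only: simp_thms)+
  define U where "U = (\<Union>n. p n)"
  have mono: "p m \<subseteq> p n" if "m \<le> n" for m n
    using lift_Suc_mono_le[of p, OF p(2) that] .
  have UAB: "x \<in> A" "y \<in> B" "lev' y = lev x" "col' y = col x" if xy: "(x, y) \<in> U" for x y
  proof -
    obtain n where n: "(x, y) \<in> p n" using xy by (auto simp: U_def)
    have "p n \<subseteq> A \<times> B"
      using p(1)[of n] unfolding partial_iso_def by (elim conjE)
    moreover have "\<forall>x y. (x, y) \<in> p n \<longrightarrow> lev x = lev' y \<and> col x = col' y"
      using p(1)[of n] unfolding partial_iso_def by (elim conjE)
    ultimately show "x \<in> A" "y \<in> B" "lev' y = lev x" "col' y = col x" using n by auto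
  qed
  have Ult: "(x = x' \<longleftrightarrow> y = y') \<and> (lt x x' \<longleftrightarrow> lt' y y')" if xy: "(x, y) \<in> U" "(x', y') \<in> U" for x y x' y'
  proof -
    obtain m n where "(x, y) \<in> p m" "(x', y') \<in> p n"
      using xy by (auto simp: U_def)
    then have "(x, y) \<in> p (max m n)" "(x', y') \<in> p (max m n)"
      using mono[OF max.cobounded1, of m n] mono[OF max.cobounded2, of n m] by blast+
    moreover have "\<forall>x y x' y'. (x, y) \<in> p (max m n) \<longrightarrow> (x', y') \<in> p (max m n) \<longrightarrow>
        (x = x' \<longleftrightarrow> y = y') \<and> (lt x x' \<longleftrightarrow> lt' y y')"
      using p(1)[of "max m n"] unfolding partial_iso_def by (elim conjE)
    ultimately show ?thesis by metis
  qed
  define f where "f x = (SOME y. (x, y) \<in> U)" for x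
  have f: "(x, f x) \<in> U" if "x \<in> A" for x
  proof -
    have "\<exists>y. (x, y) \<in> U" using p(3)[OF that] unfolding U_def by blast
    then show ?thesis unfolding f_def by (rule someI_ex)
  qed
  have "bij_betw f A B"
    unfolding bij_betw_def
  proof
    show "inj_on f A"
    proof (rule inj_onI)
      fix x y assume "x \<in> A" "y \<in> A" "f x = f y"
      then show "x = y" using Ult[OF f f, of x y] by simp
    qed
    show "f ` A = B"
    proof
      show "f ` A \<subseteq> B" using f UAB by blast
      show "B \<subseteq> f ` A"
      proof
        fix y assume "y \<in> B"
        then obtain x where xy: "(x, y) \<in> U" using p(4) unfolding U_def by blast
        then have "x \<in> A" using UAB(1) by blast
        then have "f x = y" using Ult[OF f xy, of x] by simp
        with \<open>x \<in> A\<close> show "y \<in> f ` A" by blast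
      qed
    qed
  qed
  then show thesis
  proof (rule that)
    show "lt' (f x) (f y) \<longleftrightarrow> lt x y" if "x \<in> A" "y \<in> A" for x y
      using Ult[OF f f, OF that] by simp
    show "lev' (f x) = lev x" "col' (f x) = col x" if "x \<in> A" for x
      using UAB(3,4)[OF f[OF that]] .
  qed
qed

section \<open>Isomorphism, definability and complete theories\<close>

lemma sat_cong: "\<forall>x\<in>free_vars \<phi>. v x = w x \<Longrightarrow> sat M v \<phi> \<longleftrightarrow> sat M w \<phi>"
proof (induction \<phi> arbitrary: v w)
  case (Eq x y)
  then have "v x = w x" "v y = w y" unfolding free_vars.simps by blast+
  then show ?case by (simp only: sat.simps)
next
  case (Rel s xs)
  then have "map v xs = map w xs" by (auto intro: map_cong[OF refl])
  then show ?case by (simp only: sat.simps)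
next
  case (Neg \<phi>)
  have "sat M v \<phi> \<longleftrightarrow> sat M w \<phi>"
    using Neg.prems by (intro Neg.IH) (simp only: free_vars.simps)
  then show ?case by (simp only: sat.simps)
next
  case (And \<phi> \<psi>)
  have "sat M v \<phi> \<longleftrightarrow> sat M w \<phi>" "sat M v \<psi> \<longleftrightarrow> sat M w \<psi>"
    by (rule And.IH; use And.prems in \<open>unfold free_vars.simps, blast\<close>)+
  then show ?case by (simp only: sat.simps)
next
  case (Ex x \<phi>)
  have "sat M (v(x := a)) \<phi> \<longleftrightarrow> sat M (w(x := a)) \<phi>" for a
  proof (rule Ex.IH, rule ballI)
    fix y assume "y \<in> free_vars \<phi>"
    then have "y \<noteq> x \<Longrightarrow> v y = w y"
      using Ex.prems unfolding free_vars.simps by blast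
    then show "(v(x := a)) y = (w(x := a)) y"
      unfolding fun_upd_def by metis
  qed
  then show ?case by (simp only: sat.simps)
qed

definition struct_iso :: "'s lang \<Rightarrow> ('a \<Rightarrow> 'b) \<Rightarrow> ('s, 'a) struct \<Rightarrow> ('s, 'b) struct \<Rightarrow> bool" where
  "struct_iso L f M N \<longleftrightarrow> bij_betw f (univ M) (univ N) \<and>
     (\<forall>s xs. L s = Some (length xs) \<and> set xs \<subseteq> univ M \<longrightarrow>
        (interp M s xs \<longleftrightarrow> interp N s (map f xs)))"

lemma isomorphic_struct_iso: "isomorphic L M N \<longleftrightarrow> (\<exists>f. struct_iso L f M N)"
  by (simp add: isomorphic_def struct_iso_def)

lemma sat_struct_iso:
  assumes f: "struct_iso L f M N" and "fm_in L \<phi>" "range v \<subseteq> univ M"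
  shows "sat N (f \<circ> v) \<phi> \<longleftrightarrow> sat M v \<phi>"
  using assms(2,3)
proof (induction \<phi> arbitrary: v)
  case (Eq x y)
  have "v x \<in> univ M" "v y \<in> univ M" using Eq by auto
  moreover have "inj_on f (univ M)"
    using f by (simp add: struct_iso_def bij_betw_def)
  ultimately show ?case
    by (simp add: inj_on_eq_iff)
next
  case (Rel s xs)
  then have "set (map v xs) \<subseteq> univ M" by auto
  moreover have "L s = Some (length (map v xs))" using Rel.prems by simp
  ultimately have "interp M s (map v xs) \<longleftrightarrow> interp N s (map f (map v xs))"
    using f unfolding struct_iso_def by blast
  then show ?case by (simp add: comp_def)
next
  case (Ex x \<phi>)
  have img: "univ N = f ` univ M"
    using f by (auto simp: struct_iso_def bij_betw_def)
  have "sat N ((f \<circ> v)(x := f a)) \<phi> \<longleftrightarrow> sat M (v(x := a)) \<phi>" if "a \<in> univ M" for a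
  proof -
    have "(f \<circ> v)(x := f a) = f \<circ> v(x := a)" by auto
    moreover have "range (v(x := a)) \<subseteq> univ M" using Ex.prems that by auto
    moreover have "fm_in L \<phi>" using Ex.prems by simp
    ultimately show ?thesis using Ex.IH[of "v(x := a)"] by metis
  qed
  then show ?case
    unfolding sat.simps img by blast
qed simp_all

lemma holds_isomorphic:
  assumes "isomorphic L M N" "fm_in L \<phi>"
  shows "holds N \<phi> \<longleftrightarrow> holds M \<phi>"
proof -
  obtain f where f: "struct_iso L f M N"
    using assms(1) by (auto simp: isomorphic_struct_iso)
  then have bij: "bij_betw f (univ M) (univ N)"
    by (simp add: struct_iso_def)
  have "sat M v \<phi>" if "holds N \<phi>" "range v \<subseteq> univ M" for v
  proof -
    have "range (f \<circ> v) \<subseteq> univ N"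
      using that(2) bij by (auto simp: bij_betw_def)
    then show ?thesis
      using that(1) sat_struct_iso[OF f assms(2) that(2)] by (simp add: holds_def)
  qed
  moreover have "sat N w \<phi>" if "holds M \<phi>" "range w \<subseteq> univ N" for w
  proof -
    let ?v = "inv_into (univ M) f \<circ> w"
    have w: "w x \<in> f ` univ M" for x
      using that(2) bij by (auto simp: bij_betw_def)
    have "range ?v \<subseteq> univ M" "f \<circ> ?v = w"
      using inv_into_into[OF w] f_inv_into_f[OF w] by auto
    then show ?thesis
      using that(1) sat_struct_iso[OF f assms(2), of ?v] by (simp add: holds_def)
  qed
  ultimately show ?thesis
    unfolding holds_def by blast
qed

lemma holds_Neg_sentence:
  assumes "\<phi> \<in> sentences L" "univ M \<noteq> {}"
  shows "holds M (Neg \<phi>) \<longleftrightarrow> \<not> holds M \<phi>"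
proof -
  obtain a where "a \<in> univ M" using assms(2) by blast
  then have "range (\<lambda>_. a) \<subseteq> univ M" by auto
  moreover have "sat M v \<phi> \<longleftrightarrow> sat M w \<phi>" for v w
    using assms(1) by (intro sat_cong) (auto simp: sentences_def)
  ultimately show ?thesis
    unfolding holds_def sat.simps by blast
qed

lemma complete_Th:
  fixes M :: "('s, nat) struct"
  assumes "univ M \<noteq> {}"
  shows "complete_theory L (Th L M)"
proof -
  have "Th L M \<subseteq> sentences L" by (auto simp: Th_def)
  moreover have "is_model (Th L M) M"
    using assms by (simp add: is_model_def Th_def)
  moreover have "\<phi> \<in> Th L M \<or> Neg \<phi> \<in> Th L M" if "\<phi> \<in> sentences L" for \<phi>
  proof -
    have "Neg \<phi> \<in> sentences L" using that by (simp add: sentences_def)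
    then show ?thesis using that holds_Neg_sentence[OF that assms] by (simp add: Th_def)
  qed
  ultimately show ?thesis
    unfolding complete_theory_def by blast
qed

text \<open>Semantic closure rules stand in for writing formulas out: a relation on structures and
  valuations is shown to be first-order by building it up from these.\<close>

definition definable :: "'s lang \<Rightarrow> (('s, 'a) struct \<Rightarrow> (nat \<Rightarrow> 'a) \<Rightarrow> bool) \<Rightarrow> bool" where
  "definable L R \<longleftrightarrow> (\<exists>\<phi>. fm_in L \<phi> \<and> (\<forall>M v. sat M v \<phi> \<longleftrightarrow> R M v))"

lemma definable_eq: "definable L (\<lambda>M v. v x = v y)"
  unfolding definable_def by (rule exI[of _ "Eq x y"]) simp

lemma definable_rel:
  "L s = Some (length xs) \<Longrightarrow> definable L (\<lambda>M v. interp M s (map v xs))"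
  unfolding definable_def by (rule exI[of _ "Rel s xs"]) simp

lemma definable_not: "definable L R \<Longrightarrow> definable L (\<lambda>M v. \<not> R M v)"
  unfolding definable_def
proof (elim exE conjE)
  fix \<phi> assume "fm_in L \<phi>" "\<forall>M v. sat M v \<phi> \<longleftrightarrow> R M v"
  then show "\<exists>\<phi>. fm_in L \<phi> \<and> (\<forall>M v. sat M v \<phi> \<longleftrightarrow> \<not> R M v)"
    by (intro exI[of _ "Neg \<phi>"]) simp
qed

lemma definable_conj:
  "definable L R \<Longrightarrow> definable L S \<Longrightarrow> definable L (\<lambda>M v. R M v \<and> S M v)"
  unfolding definable_def
proof (elim exE conjE)
  fix \<phi> \<psi> assume "fm_in L \<phi>" "\<forall>M v. sat M v \<phi> \<longleftrightarrow> R M v" "fm_in L \<psi>" "\<forall>M v. sat M v \<psi> \<longleftrightarrow> S M v"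
  then show "\<exists>\<phi>. fm_in L \<phi> \<and> (\<forall>M v. sat M v \<phi> \<longleftrightarrow> R M v \<and> S M v)"
    by (intro exI[of _ "And \<phi> \<psi>"]) simp
qed

lemma definable_ex:
  "definable L R \<Longrightarrow> definable L (\<lambda>M v. \<exists>a\<in>univ M. R M (v(x := a)))"
  unfolding definable_def
proof (elim exE conjE)
  fix \<phi> assume "fm_in L \<phi>" "\<forall>M v. sat M v \<phi> \<longleftrightarrow> R M v"
  then show "\<exists>\<phi>. fm_in L \<phi> \<and> (\<forall>M v. sat M v \<phi> \<longleftrightarrow> (\<exists>a\<in>univ M. R M (v(x := a))))"
    by (intro exI[of _ "Ex x \<phi>"]) simp
qed

lemma definable_disj:
  "definable L R \<Longrightarrow> definable L S \<Longrightarrow> definable L (\<lambda>M v. R M v \<or> S M v)"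
  using definable_not[OF definable_conj[OF definable_not definable_not], of L R S] by simp

lemma definable_imp:
  "definable L R \<Longrightarrow> definable L S \<Longrightarrow> definable L (\<lambda>M v. R M v \<longrightarrow> S M v)"
  unfolding imp_conv_disj by (intro definable_disj definable_not)

lemma definable_iff:
  "definable L R \<Longrightarrow> definable L S \<Longrightarrow> definable L (\<lambda>M v. R M v \<longleftrightarrow> S M v)"
  unfolding iff_conv_conj_imp by (intro definable_conj definable_imp)

lemma definable_all:
  "definable L R \<Longrightarrow> definable L (\<lambda>M v. \<forall>a\<in>univ M. R M (v(x := a)))"
  using definable_not[OF definable_ex[OF definable_not], of L R x] by simp

lemma definable_const: "definable L (\<lambda>M v. b)"
proof (cases b)
  case True
  then show ?thesis using definable_eq[of L 0 0] by simp
next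
  case False
  then show ?thesis using definable_not[OF definable_eq[of L 0 0]] by simp
qed

lemma definable_Ball:
  "finite I \<Longrightarrow> (\<And>i. i \<in> I \<Longrightarrow> definable L (R i)) \<Longrightarrow> definable L (\<lambda>M v. \<forall>i\<in>I. R i M v)"
proof (induction I rule: finite_induct)
  case empty
  then show ?case using definable_const[of L True] by simp
next
  case (insert i I)
  then show ?case using definable_conj[of L "R i"] by simp
qed

lemma definable_Bex:
  "finite I \<Longrightarrow> (\<And>i. i \<in> I \<Longrightarrow> definable L (R i)) \<Longrightarrow> definable L (\<lambda>M v. \<exists>i\<in>I. R i M v)"
proof (induction I rule: finite_induct)
  case empty
  then show ?case using definable_const[of L False] by simp
next
  case (insert i I)
  then show ?case using definable_disj[of L "R i"] by simp
qed

lemma definable_all_less: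
  "(\<And>i. i < (n::nat) \<Longrightarrow> definable L (R i)) \<Longrightarrow> definable L (\<lambda>M v. \<forall>i<n. R i M v)"
  using definable_Ball[of "{..<n}" L R] by (simp add: Ball_def)

lemma definable_ex_less:
  "(\<And>i. i < (n::nat) \<Longrightarrow> definable L (R i)) \<Longrightarrow> definable L (\<lambda>M v. \<exists>i<n. R i M v)"
  using definable_Bex[of "{..<n}" L R] by (simp add: Bex_def)

lemma definable_all_bool:
  "(\<And>b. definable L (R b)) \<Longrightarrow> definable L (\<lambda>M v. \<forall>b::bool. R b M v)"
  using definable_Ball[of "UNIV :: bool set" L R] by simp

definition assign :: "nat \<Rightarrow> 'a list \<Rightarrow> (nat \<Rightarrow> 'a) \<Rightarrow> nat \<Rightarrow> 'a" where
  "assign z xs v i = (if z \<le> i \<and> i < z + length xs then xs ! (i - z) else v i)"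

text \<open>A quantifier over n-tuples becomes n nested quantifiers over the variables
  \<open>z\<close>, ..., \<open>z + n - 1\<close>, the innermost one for the last entry.\<close>

lemma definable_ex_tuple:
  "definable L R \<Longrightarrow> definable L (\<lambda>M v. \<exists>xs\<in>tuples n (univ M). R M (assign z xs v))"
proof (induction n arbitrary: R)
  case 0
  have "(\<exists>xs\<in>tuples 0 (univ M). R M (assign z xs v)) \<longleftrightarrow> R M v" for M :: "('a, 'b) struct" and v
  proof -
    have "tuples 0 (univ M) = {[]}" by (auto simp: tuples_def)
    moreover have "assign z [] v = v" by (rule ext) (auto simp: assign_def)
    ultimately show ?thesis by simp
  qed
  then show ?case using 0 by simp
next
  case (Suc n)
  have "(\<exists>xs\<in>tuples (Suc n) (univ M). R M (assign z xs v)) \<longleftrightarrow>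
      (\<exists>xs\<in>tuples n (univ M). \<exists>a\<in>univ M. R M ((assign z xs v)(z + n := a)))" (is "?l \<longleftrightarrow> ?r")
    for M :: "('a, 'b) struct" and v
  proof -
    have e: "assign z (xs @ [a]) v = (assign z xs v)(z + n := a)" if "length xs = n" for xs a
      using that by (auto simp: assign_def nth_append fun_eq_iff)
    show ?thesis
    proof
      assume ?l
      then obtain ys where ys: "length ys = Suc n" "set ys \<subseteq> univ M" "R M (assign z ys v)"
        by (auto simp: tuples_def)
      then obtain xs a where eq: "ys = xs @ [a]"
        by (metis append_butlast_last_id length_0_conv nat.distinct(1))
      then have "length xs = n" "xs \<in> tuples n (univ M)" "a \<in> univ M"
        using ys by (auto simp: tuples_def)
      then show ?r using ys(3) e unfolding eq by metis
    next
      assume ?r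
      then obtain xs a where "length xs = n" "set xs \<subseteq> univ M" "a \<in> univ M" "R M (assign z (xs @ [a]) v)"
        using e by (auto simp: tuples_def)
      then show ?l by (intro bexI[of _ "xs @ [a]"]) (auto simp: tuples_def)
    qed
  qed
  moreover have "definable L (\<lambda>M v. \<exists>xs\<in>tuples n (univ M). \<exists>a\<in>univ M. R M ((assign z xs v)(z + n := a)))"
    using Suc.IH[OF definable_ex[OF Suc.prems]] .
  ultimately show ?case by simp
qed

lemma definable_all_tuple:
  "definable L R \<Longrightarrow> definable L (\<lambda>M v. \<forall>xs\<in>tuples n (univ M). R M (assign z xs v))"
  using definable_not[OF definable_ex_tuple[OF definable_not], of L R n z] by simp

text \<open>\<open>R\<close> ignores the valuation, but the formula that defines it may still
  contain free variables. Quantifying them existentially gives a sentence, and on nonempty universes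
  this leaves the truth value unchanged.\<close>

lemma definable_transfer:
  assumes "definable L (\<lambda>M v. R M)" "univ M \<noteq> {}" "R M" "is_model (Th L M) N"
  shows "R N"
proof -
  obtain \<phi> where \<phi>: "fm_in L \<phi>" "\<And>M v. sat M v \<phi> \<longleftrightarrow> R M"
    using assms(1) by (auto simp: definable_def)
  have "\<exists>\<psi>. fm_in L \<psi> \<and> free_vars \<psi> = free_vars \<phi> - set xs \<and>
      (\<forall>M. univ M \<noteq> {} \<longrightarrow> (\<forall>v. sat M v \<psi> \<longleftrightarrow> R M))" for xs
  proof (induction xs)
    case Nil
    then show ?case using \<phi> by auto
  next
    case (Cons x xs)
    then obtain \<psi> where "fm_in L \<psi>" "free_vars \<psi> = free_vars \<phi> - set xs"
      "\<And>M v. univ M \<noteq> {} \<Longrightarrow> sat M v \<psi> \<longleftrightarrow> R M" by blast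
    then show ?case by (intro exI[of _ "Ex x \<psi>"]) auto
  qed
  moreover have "finite (free_vars \<phi>)"
    by (induction \<phi>) auto
  then obtain xs where "set xs = free_vars \<phi>"
    using finite_list by blast
  ultimately obtain \<psi> where \<psi>: "fm_in L \<psi>" "free_vars \<psi> = {}"
      "\<And>M v. univ M \<noteq> {} \<Longrightarrow> sat M v \<psi> \<longleftrightarrow> R M"
    by (metis Diff_cancel)
  then have "\<psi> \<in> Th L M"
    using assms(2,3) by (auto simp: Th_def sentences_def holds_def)
  then have "holds N \<psi>" "univ N \<noteq> {}"
    using assms(4) by (auto simp: is_model_def)
  then obtain a where "a \<in> univ N" "holds N \<psi>" by blast
  then have "sat N (\<lambda>_. a) \<psi>" unfolding holds_def by auto
  then show ?thesis using \<psi>(3) \<open>univ N \<noteq> {}\<close> by blast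
qed

text \<open>The classes are the nonempty fibres of the complete invariant \<open>g\<close>.\<close>

lemma card_quotient_invariant:
  assumes "\<And>x y. x \<in> X \<Longrightarrow> y \<in> X \<Longrightarrow> R x y \<longleftrightarrow> g x = g y"
  shows "bij_betw (\<lambda>i. {x \<in> X. g x = i}) (g ` X) (X // {(x, y). x \<in> X \<and> y \<in> X \<and> R x y})"
proof -
  have "{(x, y). x \<in> X \<and> y \<in> X \<and> R x y} `` {x} = {y \<in> X. g y = g x}" if "x \<in> X" for x
    using that assms by auto
  then have "X // {(x, y). x \<in> X \<and> y \<in> X \<and> R x y} = (\<lambda>i. {x \<in> X. g x = i}) ` g ` X"
    unfolding quotient_def by auto
  then show ?thesis
    unfolding bij_betw_def by (auto intro!: inj_onI)
qed

section \<open>The order interpreted in an expansion\<close>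

text \<open>With \<open>s\<close> an extended natural, one family contains both the language with
  infinitely many intervals and its parts with finitely many, between which the proof moves.\<close>

fun exp_lang :: "nat \<Rightarrow> nat \<Rightarrow> enat \<Rightarrow> sym lang" where
  "exp_lang n k s K = Some n"
| "exp_lang n k s (P j) =
     (if (if even j then enat (j div 2) < s else j div 2 < k) then Some 1 else None)"

text \<open>The default \<open>s\<close> collects all points outside the first \<open>s\<close>
  intervals. Taking the least index makes the function total on arbitrary structures, also where the
  predicates overlap; \<open>good\<close> later excludes overlaps.\<close>

definition level :: "nat \<Rightarrow> (sym, 'a) struct \<Rightarrow> 'a \<Rightarrow> nat" where
  "level s M x = (LEAST i. i = s \<or> interp M (P (2 * i)) [x])"

definition colour :: "nat \<Rightarrow> (sym, 'a) struct \<Rightarrow> 'a \<Rightarrow> nat" where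
  "colour k M x = (LEAST c. c = k \<or> interp M (P (2 * c + 1)) [x])"

text \<open>The parameters come in increasing levels, one from each of n - 2 levels, and the jump
  from \<open>i\<close> to \<open>Suc i\<close> skips the level of \<open>x\<close> and
  \<open>y\<close>. Each parameter is thus on the same side of both points, its signs against them
  cancel, and \<open>K\<close> reports the order of \<open>x\<close> and \<open>y\<close>. On the
  levels n - 2 and n - 1 nothing is skipped: the parameters occupy the levels below n - 2.\<close>

definition order_of :: "nat \<Rightarrow> (sym, 'a) struct \<Rightarrow> 'a \<Rightarrow> 'a \<Rightarrow> bool" where
  "order_of n M x y \<longleftrightarrow>
     level (n - 1) M x < level (n - 1) M y \<or>
     (level (n - 1) M x = level (n - 1) M y \<and> x \<noteq> y \<and>
       (\<exists>ds\<in>tuples (n - 2) (univ M).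
          (\<forall>i<n - 2. level (n - 1) M (ds ! i) = (if i < level (n - 1) M x then i else Suc i)) \<and>
          interp M K (ds @ [x, y])))"

text \<open>The order is defined from \<open>K\<close>, and the first clause demands in turn that
  \<open>K\<close> be recovered from it. Thus structures on which the formula behaves as intended
  are singled out by first-order conditions.\<close>

definition good :: "nat \<Rightarrow> nat \<Rightarrow> nat \<Rightarrow> (sym, 'a) struct \<Rightarrow> bool" where
  "good n k s M \<longleftrightarrow>
     (\<forall>xs\<in>tuples n (univ M). interp M K xs \<longleftrightarrow> alternating (order_of n M) xs) \<and>
     (\<forall>x\<in>univ M. \<forall>i<s. interp M (P (2 * i)) [x] \<longrightarrow> level s M x = i) \<and>
     (\<forall>x\<in>univ M. \<forall>c<k. interp M (P (2 * c + 1)) [x] \<longrightarrow> colour k M x = c) \<and>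
     generic (univ M) (order_of n M) (level s M) (colour k M) {..s} {..<k}"

text \<open>Removes \<open>LEAST\<close>, so that for a fixed value \<open>l\<close> the condition
  is a finite Boolean combination of atoms.\<close>

lemma Least_bounded_eq:
  "(LEAST i. i = s \<or> Q i) = l \<longleftrightarrow> l \<le> s \<and> (l = s \<or> Q l) \<and> (\<forall>j<l. \<not> Q j)" for s l :: nat
proof
  assume l: "(LEAST i. i = s \<or> Q i) = l"
  have "l \<le> s" unfolding l[symmetric] by (rule Least_le) simp
  moreover have "l = s \<or> Q l" unfolding l[symmetric] by (rule LeastI[of _ s]) simp
  moreover have "\<not> Q j" if "j < l" for j
    using not_less_Least[of j "\<lambda>i. i = s \<or> Q i"] that unfolding l by blast
  ultimately show "l \<le> s \<and> (l = s \<or> Q l) \<and> (\<forall>j<l. \<not> Q j)" by blast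
next
  assume l: "l \<le> s \<and> (l = s \<or> Q l) \<and> (\<forall>j<l. \<not> Q j)"
  show "(LEAST i. i = s \<or> Q i) = l"
  proof (rule Least_equality)
    show "l = s \<or> Q l" using l by blast
    show "l \<le> j" if "j = s \<or> Q j" for j using that l by (metis leI)
  qed
qed

lemma level_eq_iff:
  "level s M x = l \<longleftrightarrow>
     l \<le> s \<and> (l = s \<or> interp M (P (2 * l)) [x]) \<and> (\<forall>j<l. \<not> interp M (P (2 * j)) [x])"
  unfolding level_def by (rule Least_bounded_eq)

lemma colour_eq_iff:
  "colour k M x = c \<longleftrightarrow>
     c \<le> k \<and> (c = k \<or> interp M (P (2 * c + 1)) [x]) \<and> (\<forall>j<c. \<not> interp M (P (2 * j + 1)) [x])"
  unfolding colour_def by (rule Least_bounded_eq)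

lemma level_le: "level s M x \<le> s"
  using level_eq_iff[of s M x "level s M x"] by simp

lemma level_pred:
  "good n k s M \<Longrightarrow> x \<in> univ M \<Longrightarrow> i < s \<Longrightarrow> interp M (P (2 * i)) [x] \<longleftrightarrow> level s M x = i"
  using level_eq_iff[of s M x i] unfolding good_def by (metis less_irrefl)

lemma colour_pred:
  "good n k s M \<Longrightarrow> x \<in> univ M \<Longrightarrow> c < k \<Longrightarrow> interp M (P (2 * c + 1)) [x] \<longleftrightarrow> colour k M x = c"
  using colour_eq_iff[of k M x c] unfolding good_def by (metis less_irrefl)

section \<open>Definability of levels, colours, the order and goodness\<close>

lemma definable_pred1:
  "L s = Some 1 \<Longrightarrow> definable L (\<lambda>M v. interp M s [v x])"
  using definable_rel[of L s "[x]"] by simp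

lemma definable_level:
  assumes "enat s \<le> s'"
  shows "definable (exp_lang n k s') (\<lambda>M v. level s M (v x) = l)"
proof (cases "l \<le> s")
  case True
  have lt: "enat i < s'" if "i < s" for i
    using that assms by (meson enat_ord_simps(2) less_le_trans)
  have p: "definable (exp_lang n k s') (\<lambda>M v. interp M (P (2 * i)) [v x])" if "i < s" for i
    using lt[OF that] by (intro definable_pred1) simp
  have "definable (exp_lang n k s') (\<lambda>M v. l = s \<or> interp M (P (2 * l)) [v x])"
  proof (cases "l = s")
    case True
    then show ?thesis using definable_const[of "exp_lang n k s'" True] by simp
  next
    case False
    then show ?thesis using p[of l] True by simp
  qed
  moreover have "definable (exp_lang n k s') (\<lambda>M v. \<forall>j<l. \<not> interp M (P (2 * j)) [v x])"
    using True by (intro definable_all_less definable_not p) simp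
  ultimately show ?thesis
    using True definable_conj unfolding level_eq_iff by auto
next
  case False
  then show ?thesis
    using definable_const[of "exp_lang n k s'" False] unfolding level_eq_iff by simp
qed

lemma definable_colour: "definable (exp_lang n k s') (\<lambda>M v. colour k M (v x) = c)"
proof (cases "c \<le> k")
  case True
  have p: "definable (exp_lang n k s') (\<lambda>M v. interp M (P (2 * i + 1)) [v x])" if "i < k" for i
    using that by (intro definable_pred1) simp
  have "definable (exp_lang n k s') (\<lambda>M v. c = k \<or> interp M (P (2 * c + 1)) [v x])"
  proof (cases "c = k")
    case True
    then show ?thesis using definable_const[of "exp_lang n k s'" True] by simp
  next
    case False
    then show ?thesis using p[of c] True by simp
  qed
  moreover have "definable (exp_lang n k s') (\<lambda>M v. \<forall>j<c. \<not> interp M (P (2 * j + 1)) [v x])"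
    using True by (intro definable_all_less definable_not p) simp
  ultimately show ?thesis
    using True definable_conj unfolding colour_eq_iff by auto
next
  case False
  then show ?thesis
    using definable_const[of "exp_lang n k s'" False] unfolding colour_eq_iff by simp
qed

lemma definable_level_less:
  assumes "enat s \<le> s'"
  shows "definable (exp_lang n k s') (\<lambda>M v. level s M (v x) < level s M (v y))"
proof -
  have "level s M a < level s M b \<longleftrightarrow>
      (\<exists>i<Suc s. \<exists>j<Suc s. i < j \<and> level s M a = i \<and> level s M b = j)" for M and a b :: 'a
    using level_le[of s M] by (auto simp: less_Suc_eq_le)
  then show ?thesis
    by (simp only:) (intro definable_ex_less definable_conj definable_const definable_level assms)
qed

lemma definable_level_eq:
  assumes "enat s \<le> s'"
  shows "definable (exp_lang n k s') (\<lambda>M v. level s M (v x) = level s M (v y))"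
proof -
  have "level s M a = level s M b \<longleftrightarrow>
      (\<not> level s M a < level s M b) \<and> \<not> level s M b < level s M a" for M and a b :: 'a
    by auto
  then show ?thesis
    by (simp only:) (intro definable_conj definable_not definable_level_less assms)
qed

lemma definable_order_of:
  assumes "enat (n - 1) \<le> s" "n \<ge> 2"
  shows "definable (exp_lang n k s) (\<lambda>M v. order_of n M (v x) (v y))"
proof -
  let ?L = "exp_lang n k s"
  \<comment> \<open>The parameter tuple is stored beyond both free variables, so that it does not
    overwrite them.\<close>
  define z where "z = Suc (max x y)"
  have z: "x < z" "y < z" by (auto simp: z_def)
  \<comment> \<open>The level of \<open>x\<close> is not a term of the language; the bounded
    quantifier over \<open>c\<close> names its value, which is below \<open>n\<close>.\<close>
  define S where "S M w \<longleftrightarrow>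
      (\<forall>i<n - 2. \<exists>c<n. level (n - 1) M (w x) = c \<and> level (n - 1) M (w (z + i)) = (if i < c then i else Suc i)) \<and>
      interp M K (map w ([z..<z + (n - 2)] @ [x, y]))" for M and w :: "nat \<Rightarrow> 'a"
  have S: "S M (assign z ds v) \<longleftrightarrow>
      (\<forall>i<n - 2. level (n - 1) M (ds ! i) = (if i < level (n - 1) M (v x) then i else Suc i)) \<and>
      interp M K (ds @ [v x, v y])" if "ds \<in> tuples (n - 2) (univ M)" for M v ds
  proof -
    have len: "length ds = n - 2" using that by (simp add: tuples_def)
    have a: "assign z ds v x = v x" "assign z ds v y = v y" "\<And>i. i < n - 2 \<Longrightarrow> assign z ds v (z + i) = ds ! i"
      using z len by (auto simp: assign_def)
    have "map (assign z ds v) [z..<z + (n - 2)] = ds"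
      using len by (intro nth_equalityI) (simp_all add: a)
    moreover have "level (n - 1) M b < n" for b
      using level_le[of "n - 1" M b] assms(2) by linarith
    ultimately show ?thesis
      unfolding S_def by (simp add: a)
  qed
  have "definable ?L S"
    unfolding S_def
    by (intro definable_conj definable_all_less definable_ex_less definable_level assms definable_rel)
      (use assms(2) in auto)
  then have "definable ?L (\<lambda>M v. \<exists>ds\<in>tuples (n - 2) (univ M). S M (assign z ds v))"
    by (rule definable_ex_tuple)
  then have "definable ?L (\<lambda>M v. level (n - 1) M (v x) < level (n - 1) M (v y) \<or>
      (level (n - 1) M (v x) = level (n - 1) M (v y) \<and> \<not> v x = v y \<and>
        (\<exists>ds\<in>tuples (n - 2) (univ M). S M (assign z ds v))))"
    by (intro definable_disj definable_conj definable_not definable_eq definable_level_less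
        definable_level_eq assms)
  then show ?thesis
    unfolding order_of_def by (simp add: S cong: bex_cong)
qed

lemma definable_ord_sgn:
  assumes "\<And>x y. definable L (\<lambda>M v. lt M (v x) (v y))"
  shows "definable L (\<lambda>M v. ord_sgn (lt M) (v x) (v y) = c)"
proof -
  have "ord_sgn (lt M) a b = c \<longleftrightarrow> (c = 1 \<and> lt M a b) \<or> (c = - 1 \<and> \<not> lt M a b \<and> lt M b a) \<or>
      (c = 0 \<and> \<not> lt M a b \<and> \<not> lt M b a)" for M a b
    by (auto simp: ord_sgn_def)
  then show ?thesis
    by (simp only:) (intro definable_disj definable_conj definable_not definable_const assms)
qed

text \<open>With only three possible values for each factor, an equation for the product is a finite
  disjunction of equations for the factors.\<close>

lemma definable_times_eq:
  fixes F G :: "('s, 'a) struct \<Rightarrow> (nat \<Rightarrow> 'a) \<Rightarrow> int"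
  assumes "\<And>c. definable L (\<lambda>M v. F M v = c)" "\<And>c. definable L (\<lambda>M v. G M v = c)"
    and "\<And>M v. F M v \<in> {- 1, 0, 1}" "\<And>M v. G M v \<in> {- 1, 0, 1}"
  shows "definable L (\<lambda>M v. F M v * G M v = c)"
proof -
  have "F M v * G M v = c \<longleftrightarrow>
      (\<exists>a\<in>{- 1, 0, 1}. \<exists>b\<in>{- 1, 0, 1}. a * b = c \<and> F M v = a \<and> G M v = b)" for M v
    using assms(3,4)[of M v] by metis
  then show ?thesis
    by (simp only:) (intro definable_Bex definable_conj definable_const assms(1,2) finite.intros)
qed

lemma definable_tuple_sgn:
  assumes "\<And>x y. definable L (\<lambda>M v. lt M (v x) (v y))"
  shows "definable L (\<lambda>M v. tuple_sgn (lt M) (map v xs) = c)"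
proof (induction xs arbitrary: c)
  case Nil
  then show ?case using definable_const[of L "1 = c"] by simp
next
  case (Cons x xs)
  have "definable L (\<lambda>M v. (\<Prod>y\<leftarrow>map v ys. ord_sgn (lt M) (v x) y) = c)" for ys c
  proof (induction ys arbitrary: c)
    case Nil
    then show ?case using definable_const[of L "1 = c"] by simp
  next
    case (Cons y ys)
    then show ?case
      unfolding list.map prod_list.Cons
      by (intro definable_times_eq definable_ord_sgn assms ord_sgn_range prod_ord_sgn_range)
  qed
  then show ?case
    unfolding list.map tuple_sgn.simps
    by (intro definable_times_eq Cons.IH tuple_sgn_range prod_ord_sgn_range)
qed

lemma definable_alternating:
  assumes "\<And>x y. definable L (\<lambda>M v. lt M (v x) (v y))"
  shows "definable L (\<lambda>M v. alternating (lt M) (map v xs))"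
proof -
  have "alternating lt ys \<longleftrightarrow> \<not> tuple_sgn lt ys = - 1" for lt :: "'b \<Rightarrow> 'b \<Rightarrow> bool" and ys
    using tuple_sgn_range[of lt ys] by auto
  then show ?thesis
    by (simp only:) (intro definable_not definable_tuple_sgn assms)
qed

lemma definable_all1:
  assumes "definable L (\<lambda>M v. Q M (v 0))"
  shows "definable L (\<lambda>M v. \<forall>a\<in>univ M. Q M a)"
  using definable_all[OF assms, of 0] by simp

lemma definable_all2:
  assumes "definable L (\<lambda>M v. Q M (v 0) (v 1))"
  shows "definable L (\<lambda>M v. \<forall>a\<in>univ M. \<forall>b\<in>univ M. Q M a b)"
  using definable_all[OF definable_all[OF assms, of 1], of 0] by simp

lemma definable_all3:
  assumes "definable L (\<lambda>M v. Q M (v 0) (v 1) (v 2))"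
  shows "definable L (\<lambda>M v. \<forall>a\<in>univ M. \<forall>b\<in>univ M. \<forall>c\<in>univ M. Q M a b c)"
  using definable_all[OF definable_all[OF definable_all[OF assms, of 2], of 1], of 0] by simp

lemma definable_strict_linear:
  assumes "\<And>x y. definable L (\<lambda>M v. lt M (v x) (v y))"
  shows "definable L (\<lambda>M v. strict_linear (univ M) (lt M))"
  unfolding strict_linear_def
  by (intro definable_conj definable_all1 definable_all2 definable_all3 definable_imp
      definable_disj definable_not definable_eq assms)

text \<open>The switches, levels and colours range over finite sets, so quantification over them is
  a finite conjunction; only points are quantified inside the formula.\<close>

lemma definable_generic:
  assumes lt: "\<And>x y. definable L (\<lambda>M v. lt M (v x) (v y))"
    and lev: "\<And>x l. definable L (\<lambda>M v. lev M (v x) = l)"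
    and col: "\<And>x c. definable L (\<lambda>M v. col M (v x) = c)"
    and le: "\<And>M a. lev M a \<le> (s::nat)"
  shows "definable L (\<lambda>M v. generic (univ M) (lt M) (lev M) (col M) {..s} {..<k::nat})"
proof -
  have lev_le: "definable L (\<lambda>M v. lev M (v x) \<le> l)" for x l
  proof -
    have "lev M a \<le> l \<longleftrightarrow> (\<exists>i<Suc l. lev M a = i)" for M a by auto
    then show ?thesis by (simp only:) (intro definable_ex_less lev)
  qed
  have lev_le2: "definable L (\<lambda>M v. lev M (v x) \<le> lev M (v y))" for x y
  proof -
    have "lev M a \<le> lev M b \<longleftrightarrow> (\<exists>i<Suc s. lev M b = i \<and> lev M a \<le> i)" for M a b
      using le[of M b] by auto
    then show ?thesis by (simp only:) (intro definable_ex_less definable_conj lev_le lev)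
  qed
  have lev_ge: "definable L (\<lambda>M v. l \<le> lev M (v x))" for x l
  proof -
    have "l \<le> lev M a \<longleftrightarrow> (\<exists>i<Suc s. lev M a = i \<and> l \<le> i)" for M a
      using le[of M a] by auto
    then show ?thesis by (simp only:) (intro definable_ex_less definable_conj definable_const lev)
  qed
  have "definable L (\<lambda>M v. \<exists>a\<in>univ M. True)"
    using definable_ex[OF definable_const[of L True]] by simp
  then have ne: "definable L (\<lambda>M v. univ M \<noteq> {})"
    by (simp add: ex_in_conv)
  have "col M ` univ M \<subseteq> {..<k} \<longleftrightarrow> (\<forall>a\<in>univ M. \<exists>c<k. col M a = c)" for M by auto
  then have col_ran: "definable L (\<lambda>M v. col M ` univ M \<subseteq> {..<k})"
    by (simp only:) (intro definable_all1 definable_ex_less col)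
  \<comment> \<open>By \<open>le\<close> this clause holds in every structure and contributes a
    constant.\<close>
  have lev_ran: "lev M ` univ M \<subseteq> {..s} \<longleftrightarrow> True" for M using le by auto
  have ex: "definable L (\<lambda>M v. \<exists>x\<in>univ M. lev M x = l \<and> col M x = c \<and> (p \<longrightarrow> lt M (v 0) x) \<and> (q \<longrightarrow> lt M x (v 1)))"
    for l c p q
  proof -
    have "definable L (\<lambda>M v. lev M (v 2) = l \<and> col M (v 2) = c \<and> (p \<longrightarrow> lt M (v 0) (v 2)) \<and> (q \<longrightarrow> lt M (v 2) (v 1)))"
      by (intro definable_conj definable_imp definable_const lev col lt)
    from definable_ex[OF this, of 2] show ?thesis by simp
  qed
  show ?thesis
    unfolding generic_def lev_ran
    by (intro definable_conj definable_strict_linear ne col_ran definable_all_bool definable_all2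
        definable_Ball definable_imp definable_const lev_le lev_le2 lev_ge lt ex finite_atMost
        finite_lessThan)
qed

lemma definable_good:
  assumes "n - 1 \<le> s" "enat s \<le> s'" "n \<ge> 2"
  shows "definable (exp_lang n k s') (\<lambda>(M :: (sym, 'a) struct) v. good n k s M)"
proof -
  let ?L = "exp_lang n k s'"
  have "enat (n - 1) \<le> s'"
    using assms(1,2) by (meson enat_ord_simps(1) order_trans)
  then have lt: "definable ?L (\<lambda>(M :: (sym, 'a) struct) v. order_of n M (v x) (v y))" for x y
    using definable_order_of assms(3) by blast
  have "definable ?L (\<lambda>(M :: (sym, 'a) struct) v. \<forall>xs\<in>tuples n (univ M).
      interp M K (map (assign 0 xs v) [0..<n]) \<longleftrightarrow> alternating (order_of n M) (map (assign 0 xs v) [0..<n]))"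
    by (intro definable_all_tuple definable_iff definable_alternating lt definable_rel) simp
  moreover have "(\<forall>xs\<in>tuples n (univ M).
      interp M K (map (assign 0 xs v) [0..<n]) \<longleftrightarrow> alternating (order_of n M) (map (assign 0 xs v) [0..<n])) \<longleftrightarrow>
      (\<forall>xs\<in>tuples n (univ M). interp M K xs \<longleftrightarrow> alternating (order_of n M) xs)"
    for M :: "(sym, 'a) struct" and v
  proof (rule ball_cong[OF refl])
    fix xs assume "xs \<in> tuples n (univ M)"
    then have "map (assign 0 xs v) [0..<n] = xs"
      by (intro nth_equalityI) (auto simp: tuples_def assign_def)
    then show "(interp M K (map (assign 0 xs v) [0..<n]) \<longleftrightarrow> alternating (order_of n M) (map (assign 0 xs v) [0..<n])) \<longleftrightarrow>
      (interp M K xs \<longleftrightarrow> alternating (order_of n M) xs)" by simp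
  qed
  ultimately have K: "definable ?L (\<lambda>(M :: (sym, 'a) struct) v. \<forall>xs\<in>tuples n (univ M).
      interp M K xs \<longleftrightarrow> alternating (order_of n M) xs)"
    by (simp only:)
  have lt: "enat i < s'" if "i < s" for i
    using that assms(2) by (meson enat_ord_simps(2) less_le_trans)
  have i: "definable ?L (\<lambda>(M :: (sym, 'a) struct) v. \<forall>x\<in>univ M. \<forall>i<s. interp M (P (2 * i)) [x] \<longrightarrow> level s M x = i)"
    by (intro definable_all1 definable_all_less definable_imp definable_pred1 definable_level assms)
      (simp add: lt)
  have c: "definable ?L (\<lambda>(M :: (sym, 'a) struct) v. \<forall>x\<in>univ M. \<forall>c<k. interp M (P (2 * c + 1)) [x] \<longrightarrow> colour k M x = c)"
    by (intro definable_all1 definable_all_less definable_imp definable_pred1 definable_colour) simp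
  show ?thesis
    unfolding good_def
    by (intro definable_conj K i c definable_generic \<open>\<And>x y. definable ?L (\<lambda>(M :: (sym, 'a) struct) v. order_of n M (v x) (v y))\<close>
        definable_level definable_colour level_le assms)
qed

section \<open>Models of the expanded theories\<close>

lemma good_strict_linear: "good n k s M \<Longrightarrow> strict_linear (univ M) (order_of n M)"
  by (simp add: good_def generic_def)

lemma good_alternating:
  "good n k s M \<Longrightarrow> set xs \<subseteq> univ M \<Longrightarrow> length xs = n \<Longrightarrow> interp M K xs \<longleftrightarrow> alternating (order_of n M) xs"
  by (simp add: good_def tuples_def)

lemma good_generic:
  "good n k s M \<Longrightarrow> generic (univ M) (order_of n M) (level s M) (colour k M) {..s} {..<k}"
  by (simp add: good_def)

lemma struct_isoI:
  assumes bij: "bij_betw f (univ M) (univ N)"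
    and K: "\<And>xs. set xs \<subseteq> univ M \<Longrightarrow> length xs = n \<Longrightarrow> interp M K xs \<longleftrightarrow> interp N K (map f xs)"
    and P: "\<And>j x. exp_lang n k s (P j) = Some 1 \<Longrightarrow> x \<in> univ M \<Longrightarrow> interp M (P j) [x] \<longleftrightarrow> interp N (P j) [f x]"
  shows "struct_iso (exp_lang n k s) f M N"
  unfolding struct_iso_def
proof (intro conjI allI impI bij)
  fix \<sigma> xs assume a: "exp_lang n k s \<sigma> = Some (length xs) \<and> set xs \<subseteq> univ M"
  show "interp M \<sigma> xs \<longleftrightarrow> interp N \<sigma> (map f xs)"
  proof (cases \<sigma>)
    case K
    then show ?thesis using a assms(2) by simp
  next
    case (P j)
    have "length xs = 1" using a P by (auto split: if_splits)
    then obtain x where "xs = [x]" by (metis One_nat_def length_0_conv length_Suc_conv)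
    then show ?thesis using a P assms(3)[of j x] by simp
  qed
qed

lemma alternating_transfer:
  assumes M: "\<And>xs. set xs \<subseteq> A \<Longrightarrow> length xs = n \<Longrightarrow> J xs \<longleftrightarrow> alternating lt xs"
    and N: "\<And>xs. set xs \<subseteq> B \<Longrightarrow> length xs = n \<Longrightarrow> J' xs \<longleftrightarrow> alternating lt' xs"
    and f: "f ` A = B" "\<And>x y. x \<in> A \<Longrightarrow> y \<in> A \<Longrightarrow> lt' (f x) (f y) \<longleftrightarrow> lt x y"
    and xs: "set xs \<subseteq> A" "length xs = n"
  shows "J xs \<longleftrightarrow> J' (map f xs)"
proof -
  have "set (map f xs) \<subseteq> B" using xs f(1) by auto
  moreover have "tuple_sgn lt' (map f xs) = tuple_sgn lt xs"
    using f(2) xs(1) by (intro tuple_sgn_map) blast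
  ultimately show ?thesis using M[OF xs] N[of "map f xs"] xs(2) by simp
qed

text \<open>Back-and-forth preserves order, level and colour. The predicates are read off from level
  and colour, and \<open>K\<close> is the alternating relation of the order.\<close>

lemma isomorphic_good:
  fixes M N :: "(sym, nat) struct"
  assumes M: "good n k s M" and N: "good n k s N"
  shows "isomorphic (exp_lang n k (enat s)) M N"
proof -
  obtain f where f: "bij_betw f (univ M) (univ N)"
    "\<And>x y. x \<in> univ M \<Longrightarrow> y \<in> univ M \<Longrightarrow> order_of n N (f x) (f y) \<longleftrightarrow> order_of n M x y"
    "\<And>x. x \<in> univ M \<Longrightarrow> level s N (f x) = level s M x"
    "\<And>x. x \<in> univ M \<Longrightarrow> colour k N (f x) = colour k M x"
    using back_and_forth[OF good_generic[OF M] good_generic[OF N]] by blast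
  have img: "f ` univ M = univ N" using f(1) by (simp add: bij_betw_def)
  have "struct_iso (exp_lang n k (enat s)) f M N"
  proof (rule struct_isoI[OF f(1)])
    fix xs assume "set xs \<subseteq> univ M" "length xs = n"
    then show "interp M K xs \<longleftrightarrow> interp N K (map f xs)"
      using alternating_transfer[OF good_alternating[OF M] good_alternating[OF N] img f(2)] by simp
  next
    fix j x assume j: "exp_lang n k (enat s) (P j) = Some 1" and x: "x \<in> univ M"
    then have fx: "f x \<in> univ N" using img by blast
    show "interp M (P j) [x] \<longleftrightarrow> interp N (P j) [f x]"
    proof (cases "even j")
      case True
      then obtain i where i: "j = 2 * i" by blast
      then have "i < s" using j by (simp split: if_splits)
      then show ?thesis
        unfolding i using level_pred[OF M x] level_pred[OF N fx] f(3)[OF x] by simp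
    next
      case False
      then obtain c where c: "j = 2 * c + 1" using oddE by blast
      then have "c < k" using j by (simp split: if_splits)
      then show ?thesis
        unfolding c using colour_pred[OF M x] colour_pred[OF N fx] f(4)[OF x] by simp
    qed
  qed
  then show ?thesis by (auto simp: isomorphic_struct_iso)
qed

lemma good_nonempty: "good n k s M \<Longrightarrow> univ M \<noteq> {}"
  by (simp add: good_def generic_def)

text \<open>Left to right, \<open>good\<close> is first-order and passes to all models of the
  theory; right to left, any two countable \<open>good\<close> structures are isomorphic.\<close>

lemma is_model_Th_good:
  fixes M N :: "(sym, nat) struct"
  assumes "n \<ge> 2" and s: "n - 1 \<le> s" and M: "good n k s M"
  shows "is_model (Th (exp_lang n k (enat s)) M) N \<longleftrightarrow> good n k s N"
proof
  assume "is_model (Th (exp_lang n k (enat s)) M) N"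
  then show "good n k s N"
    using definable_transfer[OF definable_good[OF s order_refl assms(1)] good_nonempty[OF M] M] by blast
next
  assume N: "good n k s N"
  then show "is_model (Th (exp_lang n k (enat s)) M) N"
    using holds_isomorphic[OF isomorphic_good[OF M N]] good_nonempty[OF N]
    by (auto simp: is_model_def Th_def sentences_def)
qed

text \<open>The bound starts at \<open>n - 1\<close> because \<open>order_of\<close> refers to the
  first n - 1 interval predicates.\<close>

definition limit_good :: "nat \<Rightarrow> nat \<Rightarrow> (sym, 'a) struct \<Rightarrow> bool" where
  "limit_good n k M \<longleftrightarrow> (\<forall>s\<ge>n - 1. good n k s M)"

lemma exp_lang_mono: "s \<le> s' \<Longrightarrow> exp_lang n k s \<sigma> = Some a \<Longrightarrow> exp_lang n k s' \<sigma> = Some a"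
  by (cases \<sigma>) (auto split: if_splits dest: less_le_trans)

lemma fm_in_mono: "s \<le> s' \<Longrightarrow> fm_in (exp_lang n k s) \<phi> \<Longrightarrow> fm_in (exp_lang n k s') \<phi>"
  by (induction \<phi>) (auto intro: exp_lang_mono)

text \<open>A formula mentions finitely many predicates. The bound \<open>r\<close> lets
  \<open>s\<close> be taken large enough for the order to be expressible.\<close>

lemma fm_in_finite_level:
  "fm_in (exp_lang n k \<infinity>) \<phi> \<Longrightarrow> \<exists>s\<ge>r. fm_in (exp_lang n k (enat s)) \<phi>"
proof (induction \<phi>)
  case (Rel \<sigma> xs)
  show ?case
  proof (cases \<sigma>)
    case K
    then show ?thesis using Rel by auto
  next
    case (P j)
    then show ?thesis using Rel
      by (intro exI[of _ "max r (Suc (j div 2))"]) (auto split: if_splits)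
  qed
next
  case (And \<phi> \<psi>)
  then obtain s t where "s \<ge> r" "fm_in (exp_lang n k (enat s)) \<phi>" "t \<ge> r" "fm_in (exp_lang n k (enat t)) \<psi>"
    by auto
  then show ?case
    using fm_in_mono[of "enat s" "enat (max s t)"] fm_in_mono[of "enat t" "enat (max s t)"]
    by (intro exI[of _ "max s t"]) auto
qed auto

text \<open>In the full language \<open>M\<close> and \<open>N\<close> may fail to be isomorphic.
  Each single sentence, however, lives in a finite part of the language, where their reducts are
  isomorphic.\<close>

lemma is_model_Th_limit_good:
  fixes M N :: "(sym, nat) struct"
  assumes "n \<ge> 2" and M: "limit_good n k M"
  shows "is_model (Th (exp_lang n k \<infinity>) M) N \<longleftrightarrow> limit_good n k N"
proof
  have g: "good n k s M" if "n - 1 \<le> s" for s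
    using M that by (simp add: limit_good_def)
  assume m: "is_model (Th (exp_lang n k \<infinity>) M) N"
  have "good n k s N" if s: "n - 1 \<le> s" for s
    using definable_transfer[OF definable_good[OF s _ assms(1)] good_nonempty[OF g[OF s]] g[OF s] m] by simp
  then show "limit_good n k N" by (simp add: limit_good_def)
next
  assume N: "limit_good n k N"
  have "holds N \<phi>" if \<phi>: "\<phi> \<in> Th (exp_lang n k \<infinity>) M" for \<phi>
  proof -
    have "fm_in (exp_lang n k \<infinity>) \<phi>" "holds M \<phi>"
      using \<phi> by (auto simp: Th_def sentences_def)
    then obtain s where s: "s \<ge> n - 1" "fm_in (exp_lang n k (enat s)) \<phi>"
      using fm_in_finite_level by blast
    have "isomorphic (exp_lang n k (enat s)) M N"
      using M N s(1) by (intro isomorphic_good) (auto simp: limit_good_def)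
    then show ?thesis
      using holds_isomorphic s(2) \<open>holds M \<phi>\<close> by blast
  qed
  moreover have "univ N \<noteq> {}"
    using N good_nonempty[of n k "n - 1" N] by (simp add: limit_good_def)
  ultimately show "is_model (Th (exp_lang n k \<infinity>) M) N"
    by (simp add: is_model_def)
qed

text \<open>The untruncated level. The value infinity is described by an infinite set of negated
  atoms; how it is realised is what separates the models.\<close>

definition ilevel :: "(sym, 'a) struct \<Rightarrow> 'a \<Rightarrow> enat" where
  "ilevel M x = (if \<exists>i. interp M (P (2 * i)) [x] then enat (LEAST i. interp M (P (2 * i)) [x]) else \<infinity>)"

lemma enat_level: "enat (level s M x) = min (ilevel M x) (enat s)"
proof (cases "\<exists>i. interp M (P (2 * i)) [x]")
  case False
  then have "level s M x = s"
    unfolding level_eq_iff by simp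
  then show ?thesis using False by (simp add: ilevel_def)
next
  case True
  define i where "i = (LEAST i. interp M (P (2 * i)) [x])"
  have i: "interp M (P (2 * i)) [x]" "\<And>j. j < i \<Longrightarrow> \<not> interp M (P (2 * j)) [x]"
    using True unfolding i_def by (auto intro: LeastI_ex dest: not_less_Least)
  then have "level s M x = min i s"
    unfolding level_eq_iff by (auto simp: min_def)
  then show ?thesis using True by (simp add: ilevel_def i_def[symmetric])
qed

lemma level_eq_ilevel: "i < s \<Longrightarrow> level s M x = i \<longleftrightarrow> ilevel M x = enat i"
  using enat_level[of s M x] by (cases "ilevel M x") (auto simp: min_def split: if_splits)

lemma level_eq_top: "level s M x = s \<longleftrightarrow> enat s \<le> ilevel M x"
  using enat_level[of s M x] by (cases "ilevel M x") (auto simp: min_def split: if_splits)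

lemma limit_good_ilevel_pred:
  assumes "limit_good n k M" "x \<in> univ M"
  shows "interp M (P (2 * i)) [x] \<longleftrightarrow> ilevel M x = enat i"
proof -
  have "good n k (max (n - 1) (Suc i)) M"
    using assms(1) by (simp add: limit_good_def)
  from level_pred[OF this assms(2), of i] show ?thesis
    using level_eq_ilevel[of i "max (n - 1) (Suc i)" M x] by simp
qed

lemma limit_good_0: "limit_good n k M \<Longrightarrow> good n k (n - 1) M"
  by (simp add: limit_good_def)

lemmas limit_good_linear = good_strict_linear[OF limit_good_0]

text \<open>A violation has \<open>y\<close> at a finite level \<open>i\<close>, so it is visible
  already after truncation beyond \<open>i\<close>.\<close>

lemma limit_good_mono:
  assumes M: "limit_good n k M" and xy: "x \<in> univ M" "y \<in> univ M" "order_of n M x y"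
  shows "ilevel M x \<le> ilevel M y"
proof (rule ccontr)
  assume "\<not> ilevel M x \<le> ilevel M y"
  then obtain i where i: "ilevel M y = enat i" "enat (Suc i) \<le> ilevel M x"
    by (cases "ilevel M y") (auto simp: not_le Suc_ile_eq)
  let ?s = "max (n - 1) (Suc i)"
  have "level ?s M x \<le> level ?s M y"
  proof (rule generic_mono[OF good_generic xy(3,1,2)])
    show "good n k ?s M" using M by (simp add: limit_good_def)
  qed
  moreover have "level ?s M y = i"
    using i(1) level_eq_ilevel[of i ?s M y] by simp
  moreover have "\<not> enat (level ?s M x) \<le> enat i"
    unfolding enat_level using i(2) by (cases "ilevel M x") (auto simp: min_def)
  ultimately show False by simp
qed

lemma limit_good_ilevel_less:
  assumes M: "limit_good n k M" and xy: "x \<in> univ M" "y \<in> univ M" "ilevel M x < ilevel M y"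
  shows "order_of n M x y"
  using strict_linear_total[OF limit_good_linear[OF M] xy(1,2)] limit_good_mono[OF M xy(2,1)] xy(3)
  by auto

text \<open>At a finite level \<open>i\<close> the truncation at \<open>max (n - 1) (Suc i)\<close>
  is exact. Level infinity is offered only above a point \<open>a\<close> already there, since
  monotonicity keeps everything above \<open>a\<close> at infinity. Whether such a point exists is
  left open, and this freedom gives rise to the different models.\<close>

lemma limit_good_between:
  assumes M: "limit_good n k M" and ab: "a \<in> univ M" "b \<in> univ M" and "c < k"
    and pq: "p \<Longrightarrow> q \<Longrightarrow> order_of n M a b" "p \<Longrightarrow> ilevel M a \<le> l" "q \<Longrightarrow> l \<le> ilevel M b"
    and l: "l \<noteq> \<infinity> \<or> (p \<and> ilevel M a = \<infinity>)"
  obtains x where "x \<in> univ M" "ilevel M x = l" "colour k M x = c"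
    "p \<Longrightarrow> order_of n M a x" "q \<Longrightarrow> order_of n M x b"
proof (cases l)
  case (enat i)
  let ?s = "max (n - 1) (Suc i)"
  have g: "generic (univ M) (order_of n M) (level ?s M) (colour k M) {..?s} {..<k}"
    using M by (intro good_generic) (simp add: limit_good_def)
  have "level ?s M a \<le> i" if p
    using pq(2)[OF that] enat_level[of ?s M a] unfolding enat
    by (metis enat_ord_simps(1) min.coboundedI1)
  moreover have "i \<le> level ?s M b" if q
  proof -
    have "enat i \<le> min (ilevel M b) (enat ?s)" using pq(3)[OF that] enat by simp
    then show ?thesis unfolding enat_level[symmetric] by simp
  qed
  ultimately obtain x where x: "x \<in> univ M" "level ?s M x = i" "colour k M x = c"
      "p \<Longrightarrow> order_of n M a x" "q \<Longrightarrow> order_of n M x b"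
    using generic_between[OF g ab, of i c p q] pq(1) assms(4) by (auto simp: le_max_iff_disj)
  then show thesis
    using that[of x] level_eq_ilevel[of i ?s M x] enat by simp
next
  case infinity
  then have p: p and a: "ilevel M a = \<infinity>" using l by auto
  let ?s = "n - 1"
  have g: "generic (univ M) (order_of n M) (level ?s M) (colour k M) {..?s} {..<k}"
    using M by (intro good_generic) (simp add: limit_good_def)
  have "level ?s M b = ?s" if q
    using pq(3)[OF that] infinity by (simp add: level_eq_top)
  then obtain x where x: "x \<in> univ M" "colour k M x = c" "p \<Longrightarrow> order_of n M a x" "q \<Longrightarrow> order_of n M x b"
    using generic_between[OF g ab, of ?s c p q] pq(1) assms(4) level_le[of ?s M a] by auto
  then have "ilevel M x = l"
    using limit_good_mono[OF M ab(1) x(1)] p a infinity by simp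
  then show thesis using that x by blast
qed

definition rest :: "(sym, 'a) struct \<Rightarrow> 'a set" where
  "rest M = {x \<in> univ M. ilevel M x = \<infinity>}"

lemma limit_good_colour: "limit_good n k M \<Longrightarrow> colour k M ` univ M \<subseteq> {..<k}"
  by (drule limit_good_0, drule good_generic) (simp add: generic_def)

lemma limit_good_k_pos: "limit_good n k M \<Longrightarrow> 0 < k"
  using limit_good_colour[of n k M] good_nonempty[OF limit_good_0, of n k M] by (cases k) auto

lemma generic_ilevel_rest_empty:
  assumes M: "limit_good n k M" and "rest M = {}"
  shows "generic (univ M) (order_of n M) (ilevel M) (colour k M) (- {\<infinity>}) {..<k}"
proof (rule genericI)
  show "univ M \<noteq> {}" using good_nonempty[OF limit_good_0[OF M]] .
  show "ilevel M ` univ M \<subseteq> - {\<infinity>}" using assms(2) by (auto simp: rest_def)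
  fix p q a b l c
  assume a: "a \<in> univ M" "b \<in> univ M" "l \<in> - {\<infinity>}" "c \<in> {..<k}" "p \<Longrightarrow> q \<Longrightarrow> order_of n M a b"
    "p \<Longrightarrow> ilevel M a \<le> l" "q \<Longrightarrow> l \<le> ilevel M b"
  then obtain x where "x \<in> univ M" "ilevel M x = l" "colour k M x = c"
    "p \<Longrightarrow> order_of n M a x" "q \<Longrightarrow> order_of n M x b"
    using limit_good_between[OF M a(1,2) _ a(5-7)] by blast
  then show "\<exists>x\<in>univ M. ilevel M x = l \<and> colour k M x = c \<and> (p \<longrightarrow> order_of n M a x) \<and> (q \<longrightarrow> order_of n M x b)"
    by blast
qed (use limit_good_linear[OF M] limit_good_colour[OF M] limit_good_mono[OF M] in auto)

text \<open>Used with \<open>Z\<close> empty or with \<open>Z\<close> the least point of the rest;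
  without that point infinity behaves like any other level. The lower point in \<open>nomin\<close>
  may belong to \<open>Z\<close>, because the point that is constructed lies strictly above
  it.\<close>

lemma generic_ilevel_rest:
  assumes M: "limit_good n k M" and ne: "rest M \<noteq> {}" and Z: "Z \<subseteq> rest M"
    and min: "\<And>z a. z \<in> Z \<Longrightarrow> a \<in> rest M \<Longrightarrow> \<not> order_of n M a z"
    and nomin: "\<And>b. b \<in> rest M - Z \<Longrightarrow> \<exists>a\<in>rest M. order_of n M a b"
  shows "generic (univ M - Z) (order_of n M) (ilevel M) (colour k M) UNIV {..<k}"
proof (rule genericI)
  obtain a0 where a0: "a0 \<in> rest M" using ne by blast
  then have "a0 \<in> univ M" by (simp add: rest_def)
  obtain x where "x \<in> univ M" "ilevel M x = 0"
    using limit_good_between[OF M \<open>a0 \<in> univ M\<close> \<open>a0 \<in> univ M\<close> limit_good_k_pos[OF M], of False False 0]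
    by (auto simp: zero_enat_def)
  then show "univ M - Z \<noteq> {}" using Z by (auto simp: rest_def)
  show "strict_linear (univ M - Z) (order_of n M)"
    using strict_linear_subset[OF limit_good_linear[OF M]] by blast
  fix p q a b l c
  assume a: "a \<in> univ M - Z" "b \<in> univ M - Z" "c \<in> {..<k}" "p \<Longrightarrow> q \<Longrightarrow> order_of n M a b"
    "p \<Longrightarrow> ilevel M a \<le> l" "q \<Longrightarrow> l \<le> ilevel M b"
  have ab: "a \<in> univ M" "b \<in> univ M" "c < k" using a by auto
  have "\<exists>x\<in>univ M. ilevel M x = l \<and> colour k M x = c \<and> (p \<longrightarrow> order_of n M a x) \<and>
      (q \<longrightarrow> order_of n M x b) \<and> x \<notin> Z"
  proof (cases "l \<noteq> \<infinity> \<or> (p \<and> ilevel M a = \<infinity>)")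
    case True
    obtain x where x: "x \<in> univ M" "ilevel M x = l" "colour k M x = c"
      "p \<Longrightarrow> order_of n M a x" "q \<Longrightarrow> order_of n M x b"
      using limit_good_between[OF M ab a(4-6) True] by blast
    have "x \<notin> Z"
    proof
      assume "x \<in> Z"
      then have "l = \<infinity>" using x(2) Z by (auto simp: rest_def)
      then have "p" "a \<in> rest M" using True ab by (auto simp: rest_def)
      then show False using min[OF \<open>x \<in> Z\<close>] x(4) by blast
    qed
    then show ?thesis using x by blast
  next
    case False
    then have l: "l = \<infinity>" and pa: "p \<Longrightarrow> ilevel M a \<noteq> \<infinity>" by auto
    \<comment> \<open>No lower bound at infinity is given here. A point \<open>a'\<close> of the
      rest, below \<open>b\<close> if \<open>b\<close> is a bound, takes its place, and the search
      continues above \<open>a'\<close>.\<close>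
    have "\<exists>a'\<in>rest M. q \<longrightarrow> order_of n M a' b"
    proof (cases q)
      case True
      then have "b \<in> rest M - Z" using a(2,6) l by (auto simp: rest_def)
      then show ?thesis using nomin by blast
    qed (use a0 in blast)
    then obtain a' where a': "a' \<in> rest M" "q \<Longrightarrow> order_of n M a' b" by blast
    then have A': "a' \<in> univ M" "ilevel M a' = \<infinity>" by (auto simp: rest_def)
    obtain x where x: "x \<in> univ M" "ilevel M x = \<infinity>" "colour k M x = c"
      "order_of n M a' x" "q \<Longrightarrow> order_of n M x b"
      using limit_good_between[OF M A'(1) ab(2,3), of True q \<infinity>] a'(2) a(6) A'(2) l by auto
    have "order_of n M a a'" if p
      using limit_good_ilevel_less[OF M ab(1) A'(1)] pa[OF that] A'(2) by (cases "ilevel M a") auto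
    then have "order_of n M a x" if p
      using that strict_linear_trans[OF limit_good_linear[OF M] _ x(4) ab(1) A'(1) x(1)] by blast
    moreover have "x \<notin> Z" using min[OF _ a'(1)] x(4) by blast
    ultimately show ?thesis using x l by blast
  qed
  then show "\<exists>x\<in>univ M - Z. ilevel M x = l \<and> colour k M x = c \<and> (p \<longrightarrow> order_of n M a x) \<and> (q \<longrightarrow> order_of n M x b)"
    by blast
qed (use limit_good_colour[OF M] limit_good_mono[OF M] in auto)

section \<open>Classification of the models with infinitely many levels\<close>

definition rest_min :: "nat \<Rightarrow> (sym, 'a) struct \<Rightarrow> 'a \<Rightarrow> bool" where
  "rest_min n M r \<longleftrightarrow> r \<in> rest M \<and> (\<forall>a\<in>rest M. \<not> order_of n M a r)"

text \<open>Colours occupy the values below \<open>k\<close>, so \<open>k\<close> and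
  \<open>Suc k\<close> are free for the two cases without a least point, and the values fill an
  initial segment.\<close>

definition rest_type :: "nat \<Rightarrow> nat \<Rightarrow> (sym, 'a) struct \<Rightarrow> nat" where
  "rest_type n k M =
     (if rest M = {} then Suc k
      else if \<exists>r. rest_min n M r then colour k M (SOME r. rest_min n M r) else k)"

lemma rest_min_unique:
  assumes "limit_good n k M" "rest_min n M r" "rest_min n M r'"
  shows "r = r'"
  using assms strict_linear_total[OF limit_good_linear[OF assms(1)], of r r']
  by (auto simp: rest_min_def rest_def)

lemma rest_type_min:
  assumes "limit_good n k M" "rest_min n M r"
  shows "rest_type n k M = colour k M r"
proof -
  have "(SOME r. rest_min n M r) = r"
    using assms by (intro some_equality) (auto intro: rest_min_unique)
  then show ?thesis
    using assms(2) by (auto simp: rest_type_def rest_min_def)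
qed

lemma limit_good_colour_less: "limit_good n k M \<Longrightarrow> x \<in> univ M \<Longrightarrow> colour k M x < k"
  using limit_good_colour[of n k M] by auto

lemma rest_min_univ: "rest_min n M r \<Longrightarrow> r \<in> univ M"
  by (simp add: rest_min_def rest_def)

lemma rest_type_cases:
  assumes M: "limit_good n k M"
  obtains (empty) "rest_type n k M = Suc k" "rest M = {}"
    | (no_min) "rest_type n k M = k" "rest M \<noteq> {}" "\<And>r. \<not> rest_min n M r"
    | (min) r where "rest_type n k M = colour k M r" "colour k M r < k" "rest_min n M r"
  using rest_type_min[OF M] limit_good_colour_less[OF M] rest_min_univ
  unfolding rest_type_def by (metis (full_types))

lemma rest_type_less: "limit_good n k M \<Longrightarrow> rest_type n k M < k + 2"
  by (erule rest_type_cases) auto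

lemma isomorphic_limit_good:
  assumes M: "limit_good n k M" and N: "limit_good n k N"
    and f: "bij_betw f (univ M) (univ N)"
      "\<And>x y. x \<in> univ M \<Longrightarrow> y \<in> univ M \<Longrightarrow> order_of n N (f x) (f y) \<longleftrightarrow> order_of n M x y"
      "\<And>x. x \<in> univ M \<Longrightarrow> ilevel N (f x) = ilevel M x"
      "\<And>x. x \<in> univ M \<Longrightarrow> colour k N (f x) = colour k M x"
  shows "isomorphic (exp_lang n k \<infinity>) M N"
proof -
  have img: "f ` univ M = univ N" using f(1) by (simp add: bij_betw_def)
  have "struct_iso (exp_lang n k \<infinity>) f M N"
  proof (rule struct_isoI[OF f(1)])
    fix xs assume "set xs \<subseteq> univ M" "length xs = n"
    then show "interp M K xs \<longleftrightarrow> interp N K (map f xs)"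
      using alternating_transfer[OF good_alternating[OF limit_good_0[OF M]]
          good_alternating[OF limit_good_0[OF N]] img f(2)] by simp
  next
    fix j x assume j: "exp_lang n k \<infinity> (P j) = Some 1" and x: "x \<in> univ M"
    then have fx: "f x \<in> univ N" using img by blast
    show "interp M (P j) [x] \<longleftrightarrow> interp N (P j) [f x]"
    proof (cases "even j")
      case True
      then obtain i where i: "j = 2 * i" by blast
      then show ?thesis
        unfolding i using limit_good_ilevel_pred[OF M x] limit_good_ilevel_pred[OF N fx] f(3)[OF x]
        by simp
    next
      case False
      then obtain c where c: "j = 2 * c + 1" using oddE by blast
      then have "c < k" using j by (simp split: if_splits)
      then show ?thesis
        unfolding c using colour_pred[OF limit_good_0[OF M] x] colour_pred[OF limit_good_0[OF N] fx] f(4)[OF x]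
        by simp
    qed
  qed
  then show ?thesis by (auto simp: isomorphic_struct_iso)
qed

lemma rest_no_min_below:
  assumes M: "limit_good n k M" and "\<And>r. \<not> rest_min n M r" "b \<in> rest M"
  shows "\<exists>a\<in>rest M. order_of n M a b"
  using assms by (auto simp: rest_min_def)

lemma rest_min_below:
  assumes M: "limit_good n k M" and r: "rest_min n M r" and "b \<in> rest M - {r}"
  shows "order_of n M r b"
  using assms strict_linear_total[OF limit_good_linear[OF M], of r b]
  by (auto simp: rest_min_def rest_def)

text \<open>If there are least points of the rest, they are removed and matched with each other, and
  back-and-forth treats the generic remainders.\<close>

lemma isomorphic_if_rest_type_eq:
  fixes M N :: "(sym, nat) struct"
  assumes M: "limit_good n k M" and N: "limit_good n k N" and eq: "rest_type n k M = rest_type n k N"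
  shows "isomorphic (exp_lang n k \<infinity>) M N"
  using M
proof (cases rule: rest_type_cases)
  case empty
  have "rest N = {}"
    using N by (cases rule: rest_type_cases) (use empty eq in auto)
  obtain f where f: "bij_betw f (univ M) (univ N)"
      "\<And>x y. x \<in> univ M \<Longrightarrow> y \<in> univ M \<Longrightarrow> order_of n N (f x) (f y) \<longleftrightarrow> order_of n M x y"
      "\<And>x. x \<in> univ M \<Longrightarrow> ilevel N (f x) = ilevel M x"
      "\<And>x. x \<in> univ M \<Longrightarrow> colour k N (f x) = colour k M x"
    using back_and_forth[OF generic_ilevel_rest_empty[OF M empty(2)]
        generic_ilevel_rest_empty[OF N \<open>rest N = {}\<close>]] by blast
  then show ?thesis by (rule isomorphic_limit_good[OF M N])
next
  case no_min
  have N': "rest N \<noteq> {}" "\<And>r. \<not> rest_min n N r"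
    by (use N in \<open>cases rule: rest_type_cases\<close>, use no_min eq in auto)+
  have gM: "generic (univ M - {}) (order_of n M) (ilevel M) (colour k M) UNIV {..<k}"
    by (rule generic_ilevel_rest[OF M no_min(2)]) (use rest_no_min_below[OF M no_min(3)] in auto)
  have gN: "generic (univ N - {}) (order_of n N) (ilevel N) (colour k N) UNIV {..<k}"
    by (rule generic_ilevel_rest[OF N N'(1)]) (use rest_no_min_below[OF N N'(2)] in auto)
  obtain f where f: "bij_betw f (univ M) (univ N)"
      "\<And>x y. x \<in> univ M \<Longrightarrow> y \<in> univ M \<Longrightarrow> order_of n N (f x) (f y) \<longleftrightarrow> order_of n M x y"
      "\<And>x. x \<in> univ M \<Longrightarrow> ilevel N (f x) = ilevel M x"
      "\<And>x. x \<in> univ M \<Longrightarrow> colour k N (f x) = colour k M x"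
    using back_and_forth[OF gM gN] unfolding Diff_empty by blast
  then show ?thesis by (rule isomorphic_limit_good[OF M N])
next
  case (min r)
  obtain r' where r': "rest_min n N r'" "colour k N r' = colour k M r"
    using N by (cases rule: rest_type_cases) (use min eq in auto)
  have gen: "generic (univ M - {r}) (order_of n M) (ilevel M) (colour k M) UNIV {..<k}"
    if M: "limit_good n k M" and r: "rest_min n M r" for M :: "(sym, nat) struct" and r
  proof (rule generic_ilevel_rest[OF M])
    show "{r} \<subseteq> rest M" "rest M \<noteq> {}" using r by (auto simp: rest_min_def)
    show "\<not> order_of n M a z" if "z \<in> {r}" "a \<in> rest M" for z a
      using r that by (auto simp: rest_min_def)
    show "\<exists>a\<in>rest M. order_of n M a b" if "b \<in> rest M - {r}" for b
      using rest_min_below[OF M r that] r by (auto simp: rest_min_def)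
  qed
  obtain f where f: "bij_betw f (univ M - {r}) (univ N - {r'})"
      "\<And>x y. x \<in> univ M - {r} \<Longrightarrow> y \<in> univ M - {r} \<Longrightarrow> order_of n N (f x) (f y) \<longleftrightarrow> order_of n M x y"
      "\<And>x. x \<in> univ M - {r} \<Longrightarrow> ilevel N (f x) = ilevel M x"
      "\<And>x. x \<in> univ M - {r} \<Longrightarrow> colour k N (f x) = colour k M x"
    using back_and_forth[OF gen[OF M min(3)] gen[OF N r'(1)]] by blast
  define g where "g x = (if x = r then r' else f x)" for x
  have R: "r \<in> univ M" "r' \<in> univ N" "ilevel M r = \<infinity>" "ilevel N r' = \<infinity>"
    using min(3) r'(1) by (auto simp: rest_min_def rest_def)
  have fN: "f x \<in> univ N - {r'}" if "x \<in> univ M - {r}" for x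
    using f(1) that by (auto simp: bij_betw_def)
  have "bij_betw g (univ M - {r}) (univ N - {r'})"
    using f(1) by (rule bij_betw_cong[THEN iffD1, rotated]) (simp add: g_def)
  then have "bij_betw g (insert r (univ M - {r})) (insert r' (univ N - {r'}))"
    using notIn_Un_bij_betw[of r "univ M - {r}" g "univ N - {r'}"] by (simp add: g_def)
  then have "bij_betw g (univ M) (univ N)"
    using R by (simp add: insert_absorb)
  \<comment> \<open>The position of any other point relative to the least point of the rest depends
    on its \<open>ilevel\<close> alone, which \<open>f\<close> preserves; so the extension by the
    least points respects the order.\<close>
  moreover have below: "order_of n M r x \<longleftrightarrow> ilevel M x = \<infinity>" "order_of n M x r \<longleftrightarrow> ilevel M x \<noteq> \<infinity>"
    if M: "limit_good n k M" and r: "rest_min n M r" and x: "x \<in> univ M - {r}"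
    for M :: "(sym, nat) struct" and r x
  proof -
    have r': "r \<in> univ M" "ilevel M r = \<infinity>" using r by (auto simp: rest_min_def rest_def)
    have 1: "order_of n M r x" if "ilevel M x = \<infinity>"
      using rest_min_below[OF M r] x that by (auto simp: rest_def)
    have 2: "order_of n M x r" if "ilevel M x \<noteq> \<infinity>"
      using limit_good_ilevel_less[OF M _ r'(1), of x] x that r'(2) by auto
    show "order_of n M r x \<longleftrightarrow> ilevel M x = \<infinity>" "order_of n M x r \<longleftrightarrow> ilevel M x \<noteq> \<infinity>"
      using 1 2 strict_linear_asym[OF limit_good_linear[OF M], of x r] x r'(1) by blast+
  qed
  have "order_of n N (g x) (g y) \<longleftrightarrow> order_of n M x y" if xy: "x \<in> univ M" "y \<in> univ M" for x y
  proof -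
    have irr: "\<not> order_of n M r r" "\<not> order_of n N r' r'"
      using strict_linear_irrefl[OF limit_good_linear[OF M] R(1)]
        strict_linear_irrefl[OF limit_good_linear[OF N] R(2)] by auto
    consider "x = r" "y = r" | "x = r" "y \<in> univ M - {r}" | "x \<in> univ M - {r}" "y = r"
      | "x \<in> univ M - {r}" "y \<in> univ M - {r}"
      using xy by blast
    then show ?thesis
    proof cases
      case 1
      then show ?thesis using irr by (simp add: g_def)
    next
      case 2
      then have "g x = r'" "g y = f y" by (auto simp: g_def)
      then show ?thesis
        using below(1)[OF M min(3) 2(2)] below(1)[OF N r'(1) fN[OF 2(2)]] f(3)[OF 2(2)] 2(1) by simp
    next
      case 3
      then have "g y = r'" "g x = f x" by (auto simp: g_def)
      then show ?thesis
        using below(2)[OF M min(3) 3(1)] below(2)[OF N r'(1) fN[OF 3(1)]] f(3)[OF 3(1)] 3(2) by simp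
    next
      case 4
      then have "g x = f x" "g y = f y" by (auto simp: g_def)
      then show ?thesis using f(2)[OF 4] by simp
    qed
  qed
  moreover have "ilevel N (g x) = ilevel M x" if "x \<in> univ M" for x
    using f(3)[of x] R that by (simp add: g_def)
  moreover have "colour k N (g x) = colour k M x" if "x \<in> univ M" for x
    using f(4)[of x] r'(2) that by (simp add: g_def)
  ultimately show ?thesis
    by (intro isomorphic_limit_good[OF M N, of g])
qed

text \<open>An isomorphism is only given to preserve \<open>K\<close> and the predicates; it
  preserves the order because one formula defines the order in both structures.\<close>

lemma order_of_struct_iso:
  fixes M N :: "(sym, 'a) struct"
  assumes "struct_iso (exp_lang n k \<infinity>) f M N" "n \<ge> 2" "x \<in> univ M" "y \<in> univ M"
  shows "order_of n N (f x) (f y) \<longleftrightarrow> order_of n M x y"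
proof -
  have "definable (exp_lang n k \<infinity>) (\<lambda>(M :: (sym, 'a) struct) v. order_of n M (v 0) (v 1))"
    using assms(2) by (intro definable_order_of) auto
  then obtain \<phi> where \<phi>: "fm_in (exp_lang n k \<infinity>) \<phi>"
      "\<And>(M :: (sym, 'a) struct) v. sat M v \<phi> \<longleftrightarrow> order_of n M (v 0) (v 1)"
    unfolding definable_def by blast
  define v where "v i = (if i = 0 then x else y)" for i :: nat
  have "range v \<subseteq> univ M" using assms(3,4) by (auto simp: v_def)
  from sat_struct_iso[OF assms(1) \<phi>(1) this] show ?thesis
    unfolding \<phi>(2) by (simp add: v_def)
qed

text \<open>All ingredients of \<open>rest_type\<close> are transported: levels and colours through
  the predicates, the order through \<open>order_of_struct_iso\<close>.\<close>

lemma rest_type_eq_if_isomorphic: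
  fixes M N :: "(sym, nat) struct"
  assumes M: "limit_good n k M" and N: "limit_good n k N" and "n \<ge> 2"
    and iso: "isomorphic (exp_lang n k \<infinity>) M N"
  shows "rest_type n k M = rest_type n k N"
proof -
  obtain f where f: "struct_iso (exp_lang n k \<infinity>) f M N"
    using iso by (auto simp: isomorphic_struct_iso)
  then have bij: "bij_betw f (univ M) (univ N)"
    by (simp add: struct_iso_def)
  then have img: "univ N = f ` univ M" by (simp add: bij_betw_def)
  have P: "interp N (P j) [f x] \<longleftrightarrow> interp M (P j) [x]"
    if "x \<in> univ M" "exp_lang n k \<infinity> (P j) = Some 1" for x j
    using f that unfolding struct_iso_def
    by (metis One_nat_def empty_set list.map list.set(2) list.size(3,4) plus_1_eq_Suc empty_subsetI insert_subset add.commute)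
  have lt: "order_of n N (f x) (f y) \<longleftrightarrow> order_of n M x y" if "x \<in> univ M" "y \<in> univ M" for x y
    using order_of_struct_iso[OF f assms(3) that] .
  have lev: "ilevel N (f x) = ilevel M x" if "x \<in> univ M" for x
    unfolding ilevel_def using P[OF that] by simp
  have col: "colour k N (f x) = colour k M x" if x: "x \<in> univ M" for x
  proof -
    have fx: "f x \<in> univ N" using x img by blast
    have c: "colour k M x < k" using limit_good_colour_less[OF M x] .
    then have "interp M (P (2 * colour k M x + 1)) [x]"
      using colour_pred[OF limit_good_0[OF M] x c] by simp
    then have "interp N (P (2 * colour k M x + 1)) [f x]"
      using P[OF x, of "2 * colour k M x + 1"] c by simp
    then show ?thesis
      using colour_pred[OF limit_good_0[OF N] fx c] by simp
  qed
  have rest: "rest N = f ` rest M"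
    unfolding rest_def img using lev by auto
  have sub: "rest M \<subseteq> univ M" by (auto simp: rest_def)
  have min: "rest_min n N (f r) \<longleftrightarrow> rest_min n M r" if "r \<in> rest M" for r
    unfolding rest_min_def rest using that lt sub by (simp add: subset_iff)
  show ?thesis
    using M
  proof (cases rule: rest_type_cases)
    case empty
    then show ?thesis using rest by (simp add: rest_type_def)
  next
    case no_min
    have "\<not> rest_min n N r" for r
      using no_min(3) min rest by (metis (full_types) imageE rest_min_def)
    then have "\<not> (\<exists>r. rest_min n N r)" by blast
    then show ?thesis
      using no_min(1,2) rest unfolding rest_type_def[of n k N] by auto
  next
    case (min r)
    then have r: "r \<in> rest M" "r \<in> univ M" using sub by (auto simp: rest_min_def)
    then have "rest_min n N (f r)"
      using \<open>\<And>r. r \<in> rest M \<Longrightarrow> rest_min n N (f r) \<longleftrightarrow> rest_min n M r\<close> min(3) by blast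
    then show ?thesis
      using rest_type_min[OF N] min(1) col[OF r(2)] by simp
  qed
qed

section \<open>Prototypes\<close>

lemma sqrt2_irrational: "sqrt 2 \<notin> \<rat>"
proof
  assume "sqrt 2 \<in> \<rat>"
  then obtain m n :: nat where mn: "n \<noteq> 0" "\<bar>sqrt 2\<bar> = real m / real n" "coprime m n"
    by (rule Rats_abs_nat_div_natE)
  then have "real m = sqrt 2 * real n" by (simp add: field_simps)
  then have "(real m)\<^sup>2 = 2 * (real n)\<^sup>2" by (simp add: power_mult_distrib)
  then have eq: "m\<^sup>2 = 2 * n\<^sup>2"
    by (metis of_nat_eq_iff of_nat_mult of_nat_numeral of_nat_power)
  then have "even m" by (metis dvd_triv_left even_power)
  then obtain k where "m = 2 * k" by blast
  then have "n\<^sup>2 = 2 * k\<^sup>2" using eq by (simp add: power2_eq_square)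
  then have "even n" by (metis dvd_triv_left even_power)
  then show False using \<open>even m\<close> mn(3) by (meson coprime_common_divisor odd_one)
qed

type_synonym point = "enat \<times> rat \<times> nat"

text \<open>Colour classes are the cosets \<open>\<rat> + c \<surd>2\<close>: pairwise disjoint and each dense in the reals.\<close>

definition point_val :: "point \<Rightarrow> real" where
  "point_val p = of_rat (fst (snd p)) + of_nat (snd (snd p)) * sqrt 2"

definition point_less :: "point \<Rightarrow> point \<Rightarrow> bool" where
  "point_less p q \<longleftrightarrow> fst p < fst q \<or> (fst p = fst q \<and> point_val p < point_val q)"

text \<open>Different colours at the same value would make \<open>sqrt 2\<close> a quotient of
  rationals.\<close>

lemma point_val_inj:
  assumes "point_val (l, q, c) = point_val (l', q', c')"
  shows "q = q' \<and> c = c'"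
proof -
  have e: "real_of_rat (q - q') = (real c' - real c) * sqrt 2"
    using assms by (simp add: point_val_def of_rat_diff algebra_simps)
  have "c = c'"
  proof (rule ccontr)
    assume "c \<noteq> c'"
    then have "sqrt 2 = real_of_rat (q - q') / (real c' - real c)"
      using e by simp
    moreover have "\<dots> \<in> \<rat>" by (intro Rats_divide Rats_diff) auto
    ultimately show False using sqrt2_irrational by simp
  qed
  then show ?thesis using e by simp
qed

lemma point_less_linear: "strict_linear UNIV point_less"
proof -
  have "p = q \<or> point_less p q \<or> point_less q p" for p q
  proof (cases "fst p = fst q")
    case True
    then have "point_val p = point_val q \<Longrightarrow> p = q"
      using point_val_inj by (metis prod.collapse)
    then show ?thesis using True unfolding point_less_def by (metis linorder_less_linear)
  next
    case False
    then show ?thesis unfolding point_less_def by (metis linorder_less_linear)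
  qed
  then show ?thesis
    unfolding strict_linear_def by (auto simp: point_less_def)
qed

text \<open>The shift \<open>w\<close> is later \<open>c * sqrt 2\<close>, so the point found has
  the prescribed colour \<open>c\<close>. A missing bound is replaced by one at distance 1 from the
  other.\<close>

lemma rat_translate_between:
  fixes u v w :: real
  assumes "p \<Longrightarrow> q \<Longrightarrow> u < v"
  shows "\<exists>r. (p \<longrightarrow> u < of_rat r + w) \<and> (q \<longrightarrow> of_rat r + w < v)"
proof -
  have "\<exists>a b. a < b \<and> (p \<longrightarrow> u \<le> a) \<and> (q \<longrightarrow> b \<le> v)"
  proof (cases "p \<and> q")
    case True
    then show ?thesis using assms by blast
  next
    case False
    then consider "\<not> q" | "\<not> p" by blast
    then show ?thesis
    proof cases
      case 1
      then show ?thesis by (intro exI[of _ u] exI[of _ "u + 1"]) simp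
    next
      case 2
      then show ?thesis by (intro exI[of _ "v - 1"] exI[of _ v]) simp
    qed
  qed
  then obtain a b where ab: "a < b" "p \<longrightarrow> u \<le> a" "q \<longrightarrow> b \<le> v" by blast
  then obtain r where "a - w < of_rat r" "of_rat r < b - w"
    using of_rat_dense[of "a - w" "b - w"] by auto
  then show ?thesis using ab by (intro exI[of _ r]) auto
qed

text \<open>Points are coded by natural numbers since the models to be counted have their universes
  in \<open>nat\<close>.\<close>

definition nat_less :: "nat \<Rightarrow> nat \<Rightarrow> bool" where
  "nat_less x y \<longleftrightarrow> point_less (from_nat x) (from_nat y)"

text \<open>Only the universe depends on \<open>S\<close>: all prototypes are cut out of one ambient
  structure.\<close>

definition point_struct :: "point set \<Rightarrow> (sym, nat) struct" where
  "point_struct S = \<lparr>univ = to_nat ` S,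
     interp = \<lambda>\<sigma> xs. case \<sigma> of
         K \<Rightarrow> alternating nat_less xs
       | P j \<Rightarrow> if even j then fst (from_nat (hd xs) :: point) = enat (j div 2)
               else snd (snd (from_nat (hd xs) :: point)) = j div 2\<rparr>"

lemma nat_less_to_nat [simp]: "nat_less (to_nat (p :: point)) (to_nat (q :: point)) \<longleftrightarrow> point_less p q"
  by (simp add: nat_less_def)

lemma univ_point_struct [simp]: "univ (point_struct S) = to_nat ` S"
  by (simp add: point_struct_def)

lemma interp_point_struct [simp]:
  "interp (point_struct S) K xs \<longleftrightarrow> alternating nat_less xs"
  "interp (point_struct S) (P (2 * i)) [to_nat (p :: point)] \<longleftrightarrow> fst p = enat i"
  "interp (point_struct S) (P (Suc (2 * i))) [to_nat p] \<longleftrightarrow> snd (snd p) = i"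
  by (simp_all add: point_struct_def)

lemma nat_less_linear: "strict_linear (to_nat ` S) nat_less" for S :: "point set"
proof -
  have "\<not> point_less p p" "point_less p q \<Longrightarrow> point_less q r \<Longrightarrow> point_less p r"
    "p = q \<or> point_less p q \<or> point_less q p" for p q r
    using strict_linear_irrefl[OF point_less_linear] strict_linear_trans[OF point_less_linear, of p q r]
      strict_linear_total[OF point_less_linear] by auto
  then show ?thesis
    unfolding strict_linear_def ball_simps(9) nat_less_to_nat by metis
qed

lemma ilevel_point_struct: "ilevel (point_struct S) (to_nat (p :: point)) = fst p"
proof (cases "fst p")
  case (enat i)
  have "(LEAST j. interp (point_struct S) (P (2 * j)) [to_nat p]) = i"
    by (rule Least_equality) (auto simp: enat)
  then show ?thesis using enat by (auto simp: ilevel_def)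
next
  case infinity
  then show ?thesis by (simp add: ilevel_def)
qed

lemma enat_level_point_struct: "enat (level s (point_struct S) (to_nat (p :: point))) = min (fst p) (enat s)"
  by (simp add: enat_level ilevel_point_struct)

lemma colour_point_struct: "snd (snd p) < k \<Longrightarrow> colour k (point_struct S) (to_nat (p :: point)) = snd (snd p)"
  unfolding colour_eq_iff by simp

text \<open>The finite levels are complete. At level infinity any upward closed part is allowed,
  including the empty one, and this is the room in which the different models are found.\<close>

definition admissible :: "nat \<Rightarrow> point set \<Rightarrow> bool" where
  "admissible k S \<longleftrightarrow> (\<forall>p\<in>S. snd (snd p) < k) \<and>
     (\<forall>l q c. l \<noteq> \<infinity> \<longrightarrow> c < k \<longrightarrow> (l, q, c) \<in> S) \<and>
     (\<forall>a\<in>S. \<forall>p. fst a = \<infinity> \<longrightarrow> fst p = \<infinity> \<longrightarrow> point_less a p \<longrightarrow> snd (snd p) < k \<longrightarrow> p \<in> S)"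

lemma tuple_sgn_sorted: "sorted_wrt lt xs \<Longrightarrow> tuple_sgn lt xs = 1"
proof (induction xs)
  case (Cons x xs)
  then have "map (ord_sgn lt x) xs = map (\<lambda>_. 1) xs"
    by (auto simp: ord_sgn_def)
  moreover have "prod_list (map (\<lambda>_. 1 :: int) xs) = 1"
    by (induction xs) auto
  ultimately show ?case using Cons by (simp only: tuple_sgn.simps) simp
qed simp

lemma level_less_imp_nat_less:
  fixes p q :: point
  assumes "level s (point_struct S) (to_nat p) < level s (point_struct S) (to_nat q)"
  shows "nat_less (to_nat p) (to_nat q)"
proof -
  have "min (fst p) (enat s) < min (fst q) (enat s)"
    using assms unfolding enat_level_point_struct[symmetric, where s = s and S = S] by simp
  then have "fst p < fst q" by (metis le_cases leD linorder_not_le min.absorb_iff2 min.mono order_refl)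
  then show ?thesis by (simp add: point_less_def)
qed

text \<open>In the main case the two points share a truncated level and the parameters
  \<open>ds\<close> are increasing, so these have sign 1 among themselves. Each of them lies on
  another level, hence on the same side of both points, and its two signs multiply to 1. Only the
  sign of the pair itself remains.\<close>

lemma order_of_point_struct:
  fixes p q :: point
  assumes S: "admissible k S" and "k > 0" and pq: "p \<in> S" "q \<in> S"
  shows "order_of n (point_struct S) (to_nat p) (to_nat q) \<longleftrightarrow> point_less p q"
proof -
  let ?M = "point_struct S" and ?x = "to_nat p" and ?y = "to_nat q"
  let ?L = "level (n - 1) (point_struct S)"
  note lin = nat_less_linear[of S]
  have A: "?x \<in> to_nat ` S" "?y \<in> to_nat ` S" using pq by auto
  consider "?L ?x < ?L ?y" | "?L ?y < ?L ?x" | "?x = ?y" | "?L ?x = ?L ?y" "?x \<noteq> ?y" by linarith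
  then show ?thesis
  proof cases
    case 1
    then show ?thesis using level_less_imp_nat_less[OF 1] by (simp add: order_of_def)
  next
    case 2
    then have "\<not> nat_less ?x ?y"
      using level_less_imp_nat_less[OF 2] strict_linear_asym[OF lin _ A(2,1)] by blast
    then show ?thesis using 2 by (simp add: order_of_def)
  next
    case 3
    then show ?thesis
      using strict_linear_irrefl[OF lin A(1)] by (simp add: order_of_def)
  next
    case 4
    define c where "c = ?L ?x"
    have sgn: "alternating nat_less (ds @ [?x, ?y]) \<longleftrightarrow> nat_less ?x ?y"
      if ds: "length ds = n - 2" "set ds \<subseteq> to_nat ` S"
        and lev: "\<And>i. i < n - 2 \<Longrightarrow> ?L (ds ! i) = (if i < c then i else Suc i)" for ds
    proof -
      have less: "nat_less u v" if "?L u < ?L v" "u \<in> to_nat ` S" "v \<in> to_nat ` S" for u v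
        using that level_less_imp_nat_less by auto
      have "sorted_wrt nat_less ds"
        unfolding sorted_wrt_iff_nth_less
      proof (intro allI impI)
        fix i j assume ij: "i < j" "j < length ds"
        then have "?L (ds ! i) < ?L (ds ! j)"
          using lev[of i] lev[of j] ds(1) by simp
        moreover have "ds ! i \<in> to_nat ` S" "ds ! j \<in> to_nat ` S"
          using ds(2) ij nth_mem[of i ds] nth_mem[of j ds] by auto
        ultimately show "nat_less (ds ! i) (ds ! j)" by (rule less)
      qed
      then have 1: "tuple_sgn nat_less ds = 1" by (rule tuple_sgn_sorted)
      have "ord_sgn nat_less d ?x * ord_sgn nat_less d ?y = 1" if "d \<in> set ds" for d
      proof -
        obtain i where i: "i < n - 2" "d = ds ! i"
          using \<open>d \<in> set ds\<close> ds(1) by (metis in_set_conv_nth)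
        have d: "d \<in> to_nat ` S" using \<open>d \<in> set ds\<close> ds(2) by blast
        have "?L d < c \<or> c < ?L d" using lev[OF i(1)] i(2) by auto
        then have "(nat_less d ?x \<and> nat_less d ?y) \<or> (nat_less ?x d \<and> nat_less ?y d)"
          using less[OF _ d A(1)] less[OF _ d A(2)] less[OF _ A(1) d] less[OF _ A(2) d] 4(1)
          unfolding c_def by metis
        then show ?thesis
          using strict_linear_asym[OF lin _ A(1) d] strict_linear_asym[OF lin _ A(2) d]
          by (auto simp: ord_sgn_def)
      qed
      then have "(\<Prod>d\<leftarrow>ds. \<Prod>y\<leftarrow>[?x, ?y]. ord_sgn nat_less d y) = 1"
        by (induction ds) auto
      then have "tuple_sgn nat_less (ds @ [?x, ?y]) = ord_sgn nat_less ?x ?y"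
        unfolding tuple_sgn_append 1 by simp
      then show ?thesis
        using strict_linear_total[OF lin A] 4(2) strict_linear_asym[OF lin _ A]
        by (auto simp: ord_sgn_def)
    qed
    \<comment> \<open>Rational part and colour 0 at a finite level: such points belong to every
      admissible \<open>S\<close>, as k > 0.\<close>
    define ds where "ds = map (\<lambda>i. to_nat (enat (if i < c then i else Suc i), 0 :: rat, 0 :: nat)) [0..<n - 2]"
    have ds: "ds \<in> tuples (n - 2) (to_nat ` S)"
      using S \<open>k > 0\<close> by (auto simp: ds_def tuples_def admissible_def)
    have lev: "?L (ds ! i) = (if i < c then i else Suc i)" if "i < n - 2" for i
    proof -
      have "enat (?L (ds ! i)) = enat (if i < c then i else Suc i)"
        unfolding ds_def using that by (simp add: enat_level_point_struct)
      then show ?thesis by simp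
    qed
    have "order_of n ?M ?x ?y \<longleftrightarrow> nat_less ?x ?y"
    proof
      assume "order_of n ?M ?x ?y"
      then obtain es where "es \<in> tuples (n - 2) (to_nat ` S)"
          "\<forall>i<n - 2. ?L (es ! i) = (if i < c then i else Suc i)" "alternating nat_less (es @ [?x, ?y])"
        using 4 unfolding order_of_def c_def by auto
      then show "nat_less ?x ?y" using sgn[of es] by (auto simp: tuples_def)
    next
      assume "nat_less ?x ?y"
      then have "alternating nat_less (ds @ [?x, ?y])"
        using sgn[of ds] ds lev by (auto simp: tuples_def)
      then show "order_of n ?M ?x ?y"
        unfolding order_of_def univ_point_struct interp_point_struct c_def[symmetric]
        using 4 ds lev by (intro disjI2 conjI bexI[of _ ds]) (auto simp: c_def)
    qed
    then show ?thesis by simp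
  qed
qed

lemma generic_cong:
  assumes "\<And>x y. x \<in> A \<Longrightarrow> y \<in> A \<Longrightarrow> lt x y \<longleftrightarrow> lt' x y"
    and "\<And>x. x \<in> A \<Longrightarrow> col x = col' x"
    and "generic A lt' lev col' Lv C"
  shows "generic A lt lev col Lv C"
proof (rule genericI)
  note g = assms(3)[unfolded generic_def]
  show "strict_linear A lt"
    unfolding strict_linear_def
  proof (intro conjI ballI impI)
    fix x assume x: "x \<in> A"
    show "\<not> lt x x" using strict_linear_irrefl[OF conjunct1[OF g] x] assms(1)[OF x x] by simp
    fix y assume y: "y \<in> A"
    show "x = y \<or> lt x y \<or> lt y x"
      using strict_linear_total[OF conjunct1[OF g] x y] assms(1)[OF x y] assms(1)[OF y x] by simp
    fix z assume z: "z \<in> A" and "lt x y" "lt y z"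
    then show "lt x z"
      using strict_linear_trans[OF conjunct1[OF g] _ _ x y z] assms(1)[OF x y] assms(1)[OF y z]
        assms(1)[OF x z] by simp
  qed
  show "A \<noteq> {}" using g by (elim conjE)
  show "lev ` A \<subseteq> Lv" using g by (elim conjE)
  have "col' ` A \<subseteq> C" using g by (elim conjE)
  then show "col ` A \<subseteq> C" using assms(2) by auto
  show "lev x \<le> lev y" if "x \<in> A" "y \<in> A" "lt x y" for x y
    using generic_mono[OF assms(3)] assms(1) that by blast
  fix p q a b l c
  assume h: "a \<in> A" "b \<in> A" "l \<in> Lv" "c \<in> C" "p \<Longrightarrow> q \<Longrightarrow> lt a b" "p \<Longrightarrow> lev a \<le> l" "q \<Longrightarrow> l \<le> lev b"
  have "p \<and> q \<longrightarrow> lt' a b" "p \<longrightarrow> lev a \<le> l" "q \<longrightarrow> l \<le> lev b"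
    using h(5-7) assms(1)[OF h(1,2)] by auto
  from generic_between_ex[OF assms(3) h(1-4) this]
  obtain x where x: "x \<in> A" "lev x = l" "col' x = c" "p \<longrightarrow> lt' a x" "q \<longrightarrow> lt' x b"
    by blast
  then show "\<exists>x\<in>A. lev x = l \<and> col x = c \<and> (p \<longrightarrow> lt a x) \<and> (q \<longrightarrow> lt x b)"
    using assms(1)[OF h(1) x(1)] assms(1)[OF x(1) h(2)] assms(2)[OF x(1)] by metis
qed

lemma generic_point_struct:
  assumes S: "admissible k S" and "k > 0"
  shows "generic (to_nat ` S) nat_less (level s (point_struct S)) (\<lambda>x. snd (snd (from_nat x :: point))) {..s} {..<k}"
proof (rule genericI)
  have "(0, 0, 0) \<in> S" using assms by (simp add: admissible_def zero_enat_def)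
  then show "to_nat ` S \<noteq> {}" by blast
  show "strict_linear (to_nat ` S) nat_less" by (rule nat_less_linear)
  show "level s (point_struct S) ` to_nat ` S \<subseteq> {..s}" using level_le by auto
  show "(\<lambda>x. snd (snd (from_nat x :: point))) ` to_nat ` S \<subseteq> {..<k}"
    using S by (auto simp: admissible_def)
  show "level s (point_struct S) x \<le> level s (point_struct S) y"
    if xy: "x \<in> to_nat ` S" "y \<in> to_nat ` S" "nat_less x y" for x y
  proof (rule ccontr)
    obtain p q :: point where pq: "x = to_nat p" "y = to_nat q" using xy(1,2) by blast
    assume "\<not> level s (point_struct S) x \<le> level s (point_struct S) y"
    then have "nat_less y x"
      using level_less_imp_nat_less[of s S q p] unfolding pq by simp
    then show False
      using strict_linear_asym[OF nat_less_linear, of x y S] xy by blast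
  qed
  fix p q x y l c
  assume xy: "x \<in> to_nat ` S" "y \<in> to_nat ` S" and l: "l \<in> {..s}" and c: "c \<in> {..<k}"
    and pq: "p \<Longrightarrow> q \<Longrightarrow> nat_less x y" "p \<Longrightarrow> level s (point_struct S) x \<le> l"
      "q \<Longrightarrow> l \<le> level s (point_struct S) y"
  obtain a b where a: "a \<in> S" "x = to_nat a" and b: "b \<in> S" "y = to_nat b" using xy by blast
  have ab: "p \<Longrightarrow> q \<Longrightarrow> point_less a b" using pq(1) a b by simp
  have la: "p \<Longrightarrow> min (fst a) (enat s) \<le> enat l"
    using pq(2) a enat_level_point_struct[where s = s and S = S and p = a] by (metis enat_ord_simps(1))
  have lb: "q \<Longrightarrow> enat l \<le> min (fst b) (enat s)"
    using pq(3) b enat_level_point_struct[where s = s and S = S and p = b] by (metis enat_ord_simps(1))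
  \<comment> \<open>The true level of the new point. Truncation at \<open>s\<close> lumps together
    all levels from \<open>s\<close> on; if the lower bound \<open>a\<close> is beyond
    \<open>s\<close>, the point is placed at the level of \<open>a\<close>. So \<open>t\<close> is
    infinity only when \<open>a\<close> is there, where \<open>S\<close> is closed upwards.\<close>
  define t where "t = (if p \<and> l = s \<and> enat s < fst a then fst a else enat l)"
  have ta: "p \<Longrightarrow> fst a \<le> t"
    using la l by (cases "l = s") (auto simp: t_def min_def split: if_splits)
  have tb: "q \<Longrightarrow> t \<le> fst b"
    using lb ab by (auto simp: t_def point_less_def)
  have tl: "min t (enat s) = enat l"
    using l by (auto simp: t_def min_def)
  \<comment> \<open>Values are compared only with a bound on the same level \<open>t\<close>; a
    bound on another level is respected by \<open>ta\<close> and \<open>tb\<close> alone.\<close>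
  have "p \<and> fst a = t \<Longrightarrow> q \<and> fst b = t \<Longrightarrow> point_val a < point_val b"
    using ab by (auto simp: point_less_def)
  then obtain r where r: "p \<and> fst a = t \<longrightarrow> point_val a < of_rat r + of_nat c * sqrt 2"
      "q \<and> fst b = t \<longrightarrow> of_rat r + of_nat c * sqrt 2 < point_val b"
    using rat_translate_between[of "p \<and> fst a = t" "q \<and> fst b = t" "point_val a" "point_val b"] by blast
  define z where "z = (t, r, c)"
  have za: "p \<Longrightarrow> point_less a z"
    using ta r(1) by (auto simp: z_def point_less_def point_val_def less_le)
  have zb: "q \<Longrightarrow> point_less z b"
    using tb r(2) by (auto simp: z_def point_less_def point_val_def less_le)
  have "z \<in> S"
  proof (cases "t = \<infinity>")
    case True
    then have "p" "fst a = \<infinity>" by (auto simp: t_def split: if_splits)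
    moreover have "\<forall>a\<in>S. \<forall>p. fst a = \<infinity> \<longrightarrow> fst p = \<infinity> \<longrightarrow> point_less a p \<longrightarrow> snd (snd p) < k \<longrightarrow> p \<in> S"
      using S unfolding admissible_def by (elim conjE)
    moreover have "fst z = \<infinity>" "snd (snd z) < k" using True c by (auto simp: z_def)
    ultimately show ?thesis using za a(1) by blast
  next
    case False
    then show ?thesis using S c by (simp add: z_def admissible_def)
  qed
  moreover have "level s (point_struct S) (to_nat z) = l"
    using enat_level_point_struct[where s = s and S = S and p = z] tl by (simp add: z_def)
  ultimately show "\<exists>w\<in>to_nat ` S. level s (point_struct S) w = l \<and> snd (snd (from_nat w :: point)) = c \<and>
      (p \<longrightarrow> nat_less x w) \<and> (q \<longrightarrow> nat_less w y)"
    using za zb a(2) b(2) by (intro bexI[of _ "to_nat z"]) (auto simp: z_def)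
qed

lemma limit_good_point_struct:
  assumes S: "admissible k S" and "k > 0"
  shows "limit_good n k (point_struct S)"
  unfolding limit_good_def good_def
proof (intro allI impI conjI)
  fix s
  let ?M = "point_struct S"
  have lt: "order_of n ?M x y \<longleftrightarrow> nat_less x y" if "x \<in> to_nat ` S" "y \<in> to_nat ` S" for x y
    using that order_of_point_struct[OF assms] by auto
  have col: "colour k ?M x = snd (snd (from_nat x :: point))" if "x \<in> to_nat ` S" for x
    using that S colour_point_struct by (auto simp: admissible_def)
  show "\<forall>xs\<in>tuples n (univ ?M). interp ?M K xs \<longleftrightarrow> alternating (order_of n ?M) xs"
  proof
    fix xs assume "xs \<in> tuples n (univ ?M)"
    then have "set xs \<subseteq> to_nat ` S" by (simp add: tuples_def)
    then have "tuple_sgn (order_of n ?M) xs = tuple_sgn nat_less xs"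
      using lt by (intro tuple_sgn_cong) blast
    then show "interp ?M K xs \<longleftrightarrow> alternating (order_of n ?M) xs" by simp
  qed
  show "\<forall>x\<in>univ ?M. \<forall>i<s. interp ?M (P (2 * i)) [x] \<longrightarrow> level s ?M x = i"
    by (auto simp: level_eq_ilevel ilevel_point_struct)
  show "\<forall>x\<in>univ ?M. \<forall>c<k. interp ?M (P (2 * c + 1)) [x] \<longrightarrow> colour k ?M x = c"
    using col by auto
  show "generic (univ ?M) (order_of n ?M) (level s ?M) (colour k ?M) {..s} {..<k}"
    unfolding univ_point_struct
    by (rule generic_cong[OF lt col generic_point_struct[OF assms]])
qed

text \<open>\<open>t\<close> is the intended \<open>rest_type\<close>: \<open>Suc k\<close> empties
  level infinity, \<open>k\<close> keeps all of it, and \<open>t < k\<close> cuts it off at the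
  point with rational part 0 and colour \<open>t\<close>, which becomes the least one there.\<close>

definition points :: "nat \<Rightarrow> nat \<Rightarrow> point set" where
  "points k t = {p. snd (snd p) < k \<and>
     (fst p = \<infinity> \<longrightarrow> t \<noteq> Suc k \<and> (t < k \<longrightarrow> point_val (\<infinity>, 0, t) \<le> point_val p))}"

lemma admissible_points: "admissible k (points k t)"
  by (auto simp: admissible_def points_def point_less_def)

lemma infinite_points:
  assumes "k > 0"
  shows "infinite (univ (point_struct (points k t)))"
proof
  assume fin: "finite (univ (point_struct (points k t)))"
  have "(\<lambda>q. to_nat (0 :: enat, q :: rat, 0 :: nat)) ` UNIV \<subseteq> univ (point_struct (points k t))"
    using assms by (auto simp: points_def)
  from finite_subset[OF this fin] have "finite (UNIV :: rat set)"
    by (rule finite_imageD) (auto intro!: injI)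
  then show False by (simp add: infinite_UNIV_char_0)
qed

lemma rest_type_points:
  assumes "k > 0" "t < k + 2"
  shows "rest_type n k (point_struct (points k t)) = t"
proof -
  let ?S = "points k t" and ?M = "point_struct (points k t)"
  note good = limit_good_point_struct[OF admissible_points assms(1), of n t]
  have lt: "order_of n ?M (to_nat p) (to_nat q) \<longleftrightarrow> point_less p q" if "p \<in> ?S" "q \<in> ?S" for p q
    using order_of_point_struct[OF admissible_points assms(1)] that .
  have rest: "rest ?M = to_nat ` {p \<in> ?S. fst p = \<infinity>}"
    by (auto simp: rest_def ilevel_point_struct)
  consider "t = Suc k" | "t = k" | "t < k" using assms(2) by linarith
  then show ?thesis
  proof cases
    case 1
    then have "rest ?M = {}" unfolding rest by (auto simp: points_def)
    then show ?thesis using 1 by (simp add: rest_type_def)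
  next
    case 2
    have "\<not> rest_min n ?M r" for r
    proof
      assume r: "rest_min n ?M r"
      then have "r \<in> rest ?M" by (simp add: rest_min_def)
      then obtain q c where p: "r = to_nat (\<infinity> :: enat, q :: rat, c :: nat)" "(\<infinity>, q, c) \<in> ?S"
        unfolding rest by auto
      then have p': "(\<infinity>, q - 1, c) \<in> ?S" using 2 by (simp add: points_def)
      then have "to_nat (\<infinity> :: enat, q - 1, c) \<in> rest ?M" unfolding rest by auto
      moreover have "point_less (\<infinity>, q - 1, c) (\<infinity>, q, c)"
        by (simp add: point_less_def point_val_def of_rat_diff)
      ultimately show False
        using r p lt[OF p' p(2)] by (auto simp: rest_min_def)
    qed
    moreover have "(\<infinity>, 0, 0) \<in> ?S" using 2 assms(1) by (simp add: points_def)
    then have "rest ?M \<noteq> {}" unfolding rest by auto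
    ultimately show ?thesis using 2 by (auto simp: rest_type_def)
  next
    case 3
    let ?r = "(\<infinity>, 0, t) :: point"
    have r: "?r \<in> ?S" using 3 by (simp add: points_def)
    have "rest_min n ?M (to_nat ?r)"
      unfolding rest_min_def
    proof
      show "to_nat ?r \<in> rest ?M" unfolding rest using r by auto
      show "\<forall>a\<in>rest ?M. \<not> order_of n ?M a (to_nat ?r)"
        unfolding rest using lt[OF _ r] 3 by (auto simp: point_less_def points_def)
    qed
    then show ?thesis
      using rest_type_min[OF good] colour_point_struct[of ?r k] 3 by simp
  qed
qed

section \<open>Spectra, and uniqueness for n at most 3\<close>

text \<open>The required points are sought with the level and colour of a given point, which are
  always admissible next to it.\<close>

lemma generic_imp_dense_linear:
  assumes g: "generic A lt lev col Lv C"
  shows "dense_linear A lt"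
proof -
  note gd = g[unfolded generic_def]
  have lin: "strict_linear A lt" using gd by (elim conjE)
  have ne: "A \<noteq> {}" using gd by (elim conjE)
  have sub1: "lev ` A \<subseteq> Lv" using gd by (elim conjE)
  have sub2: "col ` A \<subseteq> C" using gd by (elim conjE)
  have in_C: "col x \<in> C" "lev x \<in> Lv" if "x \<in> A" for x
    using sub1 sub2 that by blast+
  have "\<exists>z\<in>A. lt x z \<and> lt z y" if "x \<in> A" "y \<in> A" "lt x y" for x y
    using generic_between_ex[OF g that(1,2) in_C(2,1)[OF that(1)], of True True]
      generic_mono[OF g that(3,1,2)] that(3) by blast
  moreover have "\<exists>y\<in>A. lt y x" if "x \<in> A" for x
    using generic_between_ex[OF g that that in_C(2,1)[OF that], of False True] by blast
  moreover have "\<exists>z\<in>A. lt x z" if "x \<in> A" for x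
    using generic_between_ex[OF g that that in_C(2,1)[OF that], of True False] by blast
  ultimately show ?thesis
    using lin ne unfolding dense_linear_def by blast
qed

text \<open>With a single level and a single colour, \<open>back_and_forth\<close> specialises to
  Cantor's theorem.\<close>

lemma dense_linear_imp_generic:
  assumes d: "dense_linear A lt"
  shows "generic A lt (\<lambda>_. 0 :: nat) (\<lambda>_. 0 :: nat) {0} {0}"
proof (rule genericI)
  show "strict_linear A lt" using d unfolding dense_linear_def by (elim conjE)
  show "A \<noteq> {}" using d unfolding dense_linear_def by (elim conjE)
  fix p q a b and l c :: nat
  assume ab: "a \<in> A" "b \<in> A" "l \<in> {0}" "c \<in> {0}" and pq: "p \<Longrightarrow> q \<Longrightarrow> lt a b"
  have "\<exists>x\<in>A. (p \<longrightarrow> lt a x) \<and> (q \<longrightarrow> lt x b)"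
  proof (cases p; cases q)
    assume p q
    then show ?thesis using pq ab d unfolding dense_linear_def by blast
  next
    assume p "\<not> q"
    then show ?thesis using ab d unfolding dense_linear_def by blast
  next
    assume "\<not> p" q
    then show ?thesis using ab d unfolding dense_linear_def by blast
  next
    assume "\<not> p" "\<not> q"
    then show ?thesis using ab by blast
  qed
  then show "\<exists>x\<in>A. 0 = l \<and> 0 = c \<and> (p \<longrightarrow> lt a x) \<and> (q \<longrightarrow> lt x b)"
    using ab by simp
qed blast+

lemma dense_linear_order_iso:
  fixes A B :: "nat set"
  assumes "dense_linear A lt" "dense_linear B lt'"
  shows "\<exists>f. bij_betw f A B \<and> (\<forall>x\<in>A. \<forall>y\<in>A. lt' (f x) (f y) \<longleftrightarrow> lt x y)"
proof (rule back_and_forth[OF assms[THEN dense_linear_imp_generic]])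
  fix f assume "bij_betw f A B" "\<And>x y. x \<in> A \<Longrightarrow> y \<in> A \<Longrightarrow> lt' (f x) (f y) \<longleftrightarrow> lt x y"
  then show ?thesis by blast
qed

lemma isomorphic_sph_lang:
  assumes bij: "bij_betw f (univ M) (univ N)"
    and M: "\<And>xs. set xs \<subseteq> univ M \<Longrightarrow> length xs = n \<Longrightarrow> interp M K xs \<longleftrightarrow> alternating lt xs"
    and N: "\<And>xs. set xs \<subseteq> univ N \<Longrightarrow> length xs = n \<Longrightarrow> interp N K xs \<longleftrightarrow> alternating lt' xs"
    and f: "\<And>x y. x \<in> univ M \<Longrightarrow> y \<in> univ M \<Longrightarrow> lt' (f x) (f y) \<longleftrightarrow> lt x y"
  shows "isomorphic (sph_lang n) M N"
proof -
  have img: "f ` univ M = univ N" using bij by (simp add: bij_betw_def)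
  have "struct_iso (sph_lang n) f M N"
    unfolding struct_iso_def
  proof (intro conjI allI impI bij)
    fix s xs assume "sph_lang n s = Some (length xs) \<and> set xs \<subseteq> univ M"
    then have "s = K" "set xs \<subseteq> univ M" "length xs = n"
      by (auto simp: sph_lang_def split: if_splits)
    then show "interp M s xs \<longleftrightarrow> interp N s (map f xs)"
      using alternating_transfer[OF M N img f] by simp
  qed
  then show ?thesis by (auto simp: isomorphic_struct_iso)
qed

lemma isomorphic_dense_linear:
  fixes M N :: "(sym, nat) struct"
  assumes "dense_linear (univ M) lt" "dense_linear (univ N) lt'"
    and M: "\<And>xs. set xs \<subseteq> univ M \<Longrightarrow> length xs = n \<Longrightarrow> interp M K xs \<longleftrightarrow> alternating lt xs"
    and N: "\<And>xs. set xs \<subseteq> univ N \<Longrightarrow> length xs = n \<Longrightarrow> interp N K xs \<longleftrightarrow> alternating lt' xs"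
  shows "isomorphic (sph_lang n) M N"
proof -
  obtain f where f: "bij_betw f (univ M) (univ N)"
    "\<forall>x\<in>univ M. \<forall>y\<in>univ M. lt' (f x) (f y) \<longleftrightarrow> lt x y"
    using dense_linear_order_iso[OF assms(1,2)] by blast
  show ?thesis by (rule isomorphic_sph_lang[OF f(1) M N f(2)[rule_format]])
qed

lemma Th_isomorphic:
  assumes "isomorphic L M N"
  shows "Th L M = Th L N"
  using holds_isomorphic[OF assms] by (auto simp: Th_def sentences_def)

lemma dense_linear_point_struct:
  "admissible k S \<Longrightarrow> k > 0 \<Longrightarrow> dense_linear (univ (point_struct S)) nat_less"
  using generic_imp_dense_linear[OF generic_point_struct] by simp

text \<open>For one colour the value 2 is \<open>Suc k\<close>, so level infinity is empty. As a
  countable dense order without endpoints this is a copy of the rationals.\<close>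

definition base_struct :: "(sym, nat) struct" where
  "base_struct = point_struct (points 1 2)"

lemma dense_linear_base: "dense_linear (univ base_struct) nat_less"
  unfolding base_struct_def by (rule dense_linear_point_struct[OF admissible_points]) simp

lemma interp_base: "interp base_struct K xs \<longleftrightarrow> alternating nat_less xs"
  by (simp add: base_struct_def)

lemma interp_base_eq: "interp base_struct K = alternating nat_less"
  by (rule ext) (simp add: interp_base)

lemma infinite_base: "infinite (univ base_struct)"
  unfolding base_struct_def by (rule infinite_points) simp

lemma spherical_base: "n \<ge> 2 \<Longrightarrow> spherical_order n (univ base_struct) (interp base_struct K)"
  unfolding interp_base_eq using dense_linear_base
  by (intro spherical_order_alternating) (auto simp: dense_linear_def)

lemma dense_base: "n \<ge> 2 \<Longrightarrow> dense_spherical n (univ base_struct) (interp base_struct K)"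
  unfolding interp_base_eq by (rule dense_spherical_alternating[OF dense_linear_base])

lemma dense_spherical_theory_base:
  "n \<ge> 2 \<Longrightarrow> dense_spherical_theory n (Th (sph_lang n) base_struct)"
  unfolding dense_spherical_theory_def
  using infinite_base spherical_base dense_base no_endpoints_alternating[OF dense_linear_base]
  by (intro exI[of _ base_struct]) (simp add: interp_base_eq)

text \<open>Forgetting the predicates leaves a countable dense linear order with its alternating
  relation, isomorphic to \<open>base_struct\<close> for every admissible \<open>S\<close>; hence
  the base theory is contained in the expanded one.\<close>

lemma unary_expansion_point_struct:
  assumes S: "admissible k S" and "k > 0"
  shows "unary_expansion (sph_lang n) (Th (sph_lang n) base_struct)
    (exp_lang n k s) (Th (exp_lang n k s) (point_struct S))"
proof -
  let ?M = "point_struct S"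
  have map: "sph_lang n \<subseteq>\<^sub>m exp_lang n k s"
    by (auto simp: map_le_def sph_lang_def)
  have "univ ?M \<noteq> {}"
    using dense_linear_point_struct[OF assms] by (simp add: dense_linear_def)
  then have "complete_theory (exp_lang n k s) (Th (exp_lang n k s) ?M)"
    by (rule complete_Th)
  moreover have "exp_lang n k s \<sigma> = Some 1" if "\<sigma> \<in> dom (exp_lang n k s) - dom (sph_lang n)" for \<sigma>
    using that by (cases \<sigma>) (auto simp: sph_lang_def split: if_splits)
  moreover have "Th (sph_lang n) base_struct = Th (sph_lang n) ?M"
    by (rule Th_isomorphic[OF isomorphic_dense_linear[OF dense_linear_base dense_linear_point_struct[OF assms]]])
      (simp_all add: interp_base)
  moreover have "fm_in (exp_lang n k s) \<phi>" if "fm_in (sph_lang n) \<phi>" for \<phi>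
    using that
  proof (induction \<phi>)
    case (Rel \<sigma> xs)
    then have "\<sigma> = K" "length xs = n" by (auto simp: sph_lang_def split: if_splits)
    then show ?case by simp
  qed auto
  then have "Th (sph_lang n) ?M \<subseteq> Th (exp_lang n k s) ?M"
    by (auto simp: Th_def sentences_def)
  ultimately show ?thesis
    using map unfolding unary_expansion_def by blast
qed

section \<open>Counting the countable models\<close>

lemma has_spectrum_invariant:
  assumes "\<And>M N. M \<in> countable_models T \<Longrightarrow> N \<in> countable_models T \<Longrightarrow>
      isomorphic L M N \<longleftrightarrow> g M = g N"
    and "g ` countable_models T = {..<m :: nat}"
  shows "has_spectrum L T m"
proof -
  have b: "bij_betw (\<lambda>i. {M \<in> countable_models T. g M = i}) {..<m} (countable_iso_classes L T)"
    using card_quotient_invariant[OF assms(1)]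
    unfolding countable_iso_classes_def assms(2)[symmetric] by simp
  show ?thesis
    unfolding has_spectrum_def using bij_betw_finite[OF b] bij_betw_same_card[OF b] by simp
qed

text \<open>By \<open>mod\<close> every prototype \<open>points k i\<close> is a model of the same
  theory, and together they realise all k + 2 values of the invariant.\<close>

lemma has_spectrum_limit:
  assumes "n \<ge> 2" "k > 0"
  shows "has_spectrum (exp_lang n k \<infinity>) (Th (exp_lang n k \<infinity>) (point_struct (points k t))) (k + 2)"
proof (rule has_spectrum_invariant)
  let ?T = "Th (exp_lang n k \<infinity>) (point_struct (points k t))"
  have good: "limit_good n k (point_struct (points k i))" for i
    by (rule limit_good_point_struct[OF admissible_points assms(2)])
  have mod: "M \<in> countable_models ?T \<longleftrightarrow> infinite (univ M) \<and> limit_good n k M" for M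
    using is_model_Th_limit_good[OF assms(1) good] by (simp add: countable_models_def)
  show "isomorphic (exp_lang n k \<infinity>) M N \<longleftrightarrow> rest_type n k M = rest_type n k N"
    if "M \<in> countable_models ?T" "N \<in> countable_models ?T" for M N
    using that rest_type_eq_if_isomorphic[OF _ _ assms(1)] isomorphic_if_rest_type_eq unfolding mod by blast
  show "rest_type n k ` countable_models ?T = {..<k + 2}"
  proof
    show "rest_type n k ` countable_models ?T \<subseteq> {..<k + 2}"
    proof (rule image_subsetI)
      fix M assume "M \<in> countable_models ?T"
      then show "rest_type n k M \<in> {..<k + 2}"
        using rest_type_less[of n k M] unfolding mod by blast
    qed
    show "{..<k + 2} \<subseteq> rest_type n k ` countable_models ?T"
    proof
      fix i assume "i \<in> {..<k + 2}"
      then have "rest_type n k (point_struct (points k i)) = i"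
        using rest_type_points[OF assms(2)] by simp
      moreover have "point_struct (points k i) \<in> countable_models ?T"
        using good infinite_points[OF assms(2)] unfolding mod by blast
      ultimately show "i \<in> rest_type n k ` countable_models ?T" by force
    qed
  qed
qed

text \<open>The n - 1 intervals to which \<open>order_of\<close> refers already serve: all countable
  models are isomorphic, so a constant is a complete invariant.\<close>

lemma has_spectrum_finite:
  assumes "n \<ge> 2"
  shows "has_spectrum (exp_lang n 1 (enat (n - 1))) (Th (exp_lang n 1 (enat (n - 1))) base_struct) 1"
proof (rule has_spectrum_invariant[where g = "\<lambda>_. 0"])
  let ?T = "Th (exp_lang n 1 (enat (n - 1))) base_struct"
  have "limit_good n 1 base_struct"
    unfolding base_struct_def by (rule limit_good_point_struct[OF admissible_points]) simp
  then have good: "good n 1 (n - 1) base_struct" by (rule limit_good_0)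
  have mod: "M \<in> countable_models ?T \<longleftrightarrow> infinite (univ M) \<and> good n 1 (n - 1) M" for M
    using is_model_Th_good[OF assms order_refl good] by (simp add: countable_models_def)
  show "isomorphic (exp_lang n 1 (enat (n - 1))) M N \<longleftrightarrow> 0 = (0 :: nat)"
    if "M \<in> countable_models ?T" "N \<in> countable_models ?T" for M N
    using that isomorphic_good unfolding mod by blast
  have "base_struct \<in> countable_models ?T"
    using good infinite_base unfolding mod by blast
  then show "(\<lambda>_. 0) ` countable_models ?T = {..<1 :: nat}" by auto
qed

lemma unary_expansion_with_spectrum:
  assumes "n \<ge> 2" "m \<noteq> 0" "m \<noteq> 2"
  shows "\<exists>L' T'. unary_expansion (sph_lang n) (Th (sph_lang n) base_struct) L' T' \<and> has_spectrum L' T' m"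
proof (cases "m = 1")
  case True
  have "unary_expansion (sph_lang n) (Th (sph_lang n) base_struct)
      (exp_lang n 1 (enat (n - 1))) (Th (exp_lang n 1 (enat (n - 1))) base_struct)"
    using unary_expansion_point_struct[OF admissible_points, of 1 n "enat (n - 1)" 2]
    unfolding base_struct_def by simp
  then show ?thesis
    using has_spectrum_finite[OF assms(1)] True by blast
next
  case False
  define k where "k = m - 2"
  have k: "m = k + 2" "k > 0"
    using assms(2,3) False by (auto simp: k_def)
  show ?thesis
    unfolding k(1)
    using unary_expansion_point_struct[OF admissible_points k(2), of n \<infinity> 0] has_spectrum_limit[OF assms(1) k(2), of 0]
    by blast
qed

section \<open>Countable categoricity of the base order for n = 2 and n = 3\<close>

lemma linear_ord_categorical:
  fixes A :: "(sym, nat) struct"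
  assumes lin: "linear_ord (univ A) (interp A K)"
    and dense: "dense_spherical 2 (univ A) (interp A K)" and ends: "no_endpoints (univ A) (interp A K)"
  shows "isomorphic (sph_lang 2) A base_struct"
proof -
  let ?A = "univ A" and ?K = "interp A K"
  define lt where "lt x y \<longleftrightarrow> x \<noteq> y \<and> ?K [x, y]" for x y
  have lo: "linear_order_on ?A {(x, y) \<in> ?A \<times> ?A. ?K [x, y]}"
    using lin by (simp add: linear_ord_def)
  have refl: "?K [x, x]" if "x \<in> ?A" for x
    using lo that unfolding linear_order_on_def partial_order_on_def preorder_on_def refl_on_def by auto
  have anti: "x = y" if "x \<in> ?A" "y \<in> ?A" "?K [x, y]" "?K [y, x]" for x y
    using lo that unfolding linear_order_on_def partial_order_on_def antisym_def by auto
  have trans: "?K [x, z]" if "x \<in> ?A" "y \<in> ?A" "z \<in> ?A" "?K [x, y]" "?K [y, z]" for x y z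
    using lo that unfolding linear_order_on_def partial_order_on_def preorder_on_def trans_def by blast
  have total: "?K [x, y] \<or> ?K [y, x]" if "x \<in> ?A" "y \<in> ?A" "x \<noteq> y" for x y
    using lo that unfolding linear_order_on_def total_on_def by auto
  have sl: "strict_linear ?A lt"
    unfolding strict_linear_def lt_def
  proof (intro conjI ballI impI)
    fix x y z assume "x \<in> ?A" "y \<in> ?A" "z \<in> ?A" "x \<noteq> y \<and> ?K [x, y]" "y \<noteq> z \<and> ?K [y, z]"
    then show "x \<noteq> z" "?K [x, z]" using anti trans by blast+
  qed (use total in auto)
  have between: "\<exists>z\<in>?A. lt x z \<and> lt z y" if xy: "x \<in> ?A" "y \<in> ?A" "lt x y" for x y
  proof -
    have "[x, y] \<in> tuples 2 ?A" "?K [x, y] \<and> [x, y] ! 0 \<noteq> [x, y] ! 1"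
      using xy by (auto simp: tuples_def lt_def)
    then obtain b where "b \<in> ?A - set [x, y]" "?K ([x, y][1 := b])" "?K ([x, y][0 := b])"
      using dense unfolding dense_spherical_def by blast
    then show ?thesis by (intro bexI[of _ b]) (auto simp: lt_def)
  qed
  have ne: "?A \<noteq> {}" using dense by (auto simp: dense_spherical_def)
  have e: "(\<exists>y\<in>?A. lt y x) \<and> (\<exists>z\<in>?A. lt x z)" if "x \<in> ?A" for x
    using ends that unfolding no_endpoints_def lt_def by metis
  have "dense_linear ?A lt"
    unfolding dense_linear_def using sl between ne e by blast
  then show ?thesis
  proof (rule isomorphic_dense_linear[OF _ dense_linear_base])
    fix xs assume xs: "set xs \<subseteq> ?A" "length xs = 2"
    then obtain x y where xy: "xs = [x, y]" "x \<in> ?A" "y \<in> ?A"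
      by (auto simp: numeral_2_eq_2 length_Suc_conv)
    have "alternating lt [x, y] \<longleftrightarrow> x = y \<or> lt x y"
      using strict_linear_total[OF sl xy(2,3)] strict_linear_asym[OF sl _ xy(2,3)]
        strict_linear_irrefl[OF sl xy(2)]
      by (auto simp: ord_sgn_def)
    then show "?K xs \<longleftrightarrow> alternating lt xs"
      unfolding xy(1) using refl[OF xy(2)] by (auto simp: lt_def)
  qed (rule interp_base)
qed

text \<open>Cutting a circular order open at \<open>p\<close> makes \<open>p\<close> the least element.\<close>

definition cut :: "('a list \<Rightarrow> bool) \<Rightarrow> 'a \<Rightarrow> 'a \<Rightarrow> 'a \<Rightarrow> bool" where
  "cut J p x y \<longleftrightarrow> x \<noteq> y \<and> y \<noteq> p \<and> (x = p \<or> J [p, x, y])"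

lemma cut_circular_ord:
  assumes c: "circular_ord A J" and p: "p \<in> A"
  shows "strict_linear A (cut J p)"
    and "\<And>x y z. x \<in> A \<Longrightarrow> y \<in> A \<Longrightarrow> z \<in> A \<Longrightarrow> J [x, y, z] \<longleftrightarrow> alternating (cut J p) [x, y, z]"
proof -
  have c1: "J [x, y, z] \<Longrightarrow> J [y, z, x]"
    and c2: "J [x, y, z] \<and> J [y, x, z] \<longleftrightarrow> x = y \<or> y = z \<or> z = x"
    and c3: "J [x, y, z] \<Longrightarrow> t \<in> A \<Longrightarrow> J [x, y, t] \<or> J [t, y, z]"
    and c4: "J [x, y, z] \<or> J [y, x, z]"
    if "x \<in> A" "y \<in> A" "z \<in> A" for x y z t
    using c that unfolding circular_ord_def by blast+
  have cyc: "J [x, y, z] \<longleftrightarrow> J [y, z, x]" if "x \<in> A" "y \<in> A" "z \<in> A" for x y z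
    using c1 that by blast
  have asym: "\<not> cut J p y x" if "x \<in> A" "y \<in> A" "cut J p x y" for x y
    using that c2[OF p that(1,2)] cyc[OF that(1) p that(2)] unfolding cut_def by metis
  have total: "x = y \<or> cut J p x y \<or> cut J p y x" if "x \<in> A" "y \<in> A" for x y
    using c4[OF p that] cyc[OF that(1) p that(2)] unfolding cut_def by metis
  have flip: "\<not> J [x, p, y]" if "x \<in> A" "y \<in> A" "cut J p x y" "x \<noteq> p" for x y
    using that c2[OF p that(1,2)] unfolding cut_def by metis
  have trans: "cut J p x z" if xyz: "x \<in> A" "y \<in> A" "z \<in> A" "cut J p x y" "cut J p y z" for x y z
  proof (cases "x = p")
    case True
    then show ?thesis using xyz by (auto simp: cut_def)
  next
    case False
    have "x \<noteq> z" using asym[OF xyz(1,2,4)] xyz(5) by blast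
    have "y \<noteq> p" "z \<noteq> p" using xyz by (auto simp: cut_def)
    \<comment> \<open>Otherwise (co3) with the new point \<open>y\<close> would give
      \<open>J [x, p, y]\<close> or \<open>J [y, p, z]\<close>, and \<open>flip\<close> excludes
      both.\<close>
    have "\<not> J [x, p, z]"
      using c3[OF xyz(1) p xyz(3) _ xyz(2)] flip[OF xyz(1,2,4) False] flip[OF xyz(2,3,5) \<open>y \<noteq> p\<close>] by blast
    then have "J [p, x, z]" using c4[OF p xyz(1,3)] by blast
    then show ?thesis using \<open>x \<noteq> z\<close> \<open>z \<noteq> p\<close> by (simp add: cut_def)
  qed
  show lin: "strict_linear A (cut J p)"
    unfolding strict_linear_def
  proof (intro conjI ballI impI)
    show "\<not> cut J p x x" for x by (simp add: cut_def)
  qed (use trans total in blast)+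
  \<comment> \<open>An increasing triple belongs to \<open>J\<close>: (co3) applied to
    \<open>J [p, y, z]\<close> with the new point \<open>x\<close> leaves only
    \<open>J [x, y, z]\<close>, unless \<open>x\<close> is \<open>p\<close> itself.\<close>
  have inc: "J [x, y, z]" if xyz: "x \<in> A" "y \<in> A" "z \<in> A" "cut J p x y" "cut J p y z" for x y z
  proof -
    have "y \<noteq> p" "z \<noteq> p" using xyz by (auto simp: cut_def)
    then have yz: "J [p, y, z]" using xyz(5) by (simp add: cut_def)
    have "\<not> J [p, y, x]" if "x \<noteq> p"
      using flip[OF xyz(1,2,4) that] cyc[OF xyz(1) p xyz(2)] by blast
    then show ?thesis
      using c3[OF p xyz(2,3) yz xyz(1)] yz by blast
  qed
  show "J [x, y, z] \<longleftrightarrow> alternating (cut J p) [x, y, z]" if xyz: "x \<in> A" "y \<in> A" "z \<in> A" for x y z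
  proof (cases "x = y \<or> y = z \<or> z = x")
    case True
    then show ?thesis
      using alternating3[OF lin xyz] c2[OF xyz] by blast
  next
    case False
    let ?l = "cut J p"
    \<comment> \<open>Of the six orders of three distinct points, the even ones force
      \<open>J [x, y, z]\<close> and the odd ones force \<open>J [y, x, z]\<close>; (co2) forbids
      both at once.\<close>
    have "J [x, y, z]" if "(?l x y \<and> ?l y z) \<or> (?l y z \<and> ?l z x) \<or> (?l z x \<and> ?l x y)"
      using that inc xyz cyc by metis
    moreover have "J [y, x, z]" if "(?l y x \<and> ?l x z) \<or> (?l x z \<and> ?l z y) \<or> (?l z y \<and> ?l y x)"
      using that inc xyz cyc by metis
    moreover have "\<not> (J [x, y, z] \<and> J [y, x, z])" using c2[OF xyz] False by blast
    ultimately show ?thesis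
      using alternating3[OF lin xyz] False strict_linear_ground[OF lin xyz] by (smt (verit))
  qed
qed

text \<open>\<open>p\<close> is removed because it is the least element of the cut. Density between
  points comes from the triples \<open>[x, y, p]\<close>, and the absence of endpoints from density
  at the degenerate triples \<open>[x, p, p]\<close> and \<open>[p, x, x]\<close>.\<close>

lemma dense_cut:
  assumes c: "circular_ord A J" and d: "dense_spherical 3 A J" and p: "p \<in> A"
  shows "dense_linear (A - {p}) (cut J p)"
proof -
  have cyc: "J [y, z, x]" if "x \<in> A" "y \<in> A" "z \<in> A" "J [x, y, z]" for x y z
    using c that unfolding circular_ord_def by blast
  have deg: "J [x, y, z]" if "x \<in> A" "y \<in> A" "z \<in> A" "x = y \<or> y = z \<or> z = x" for x y z
    using c that unfolding circular_ord_def by blast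
  have dens: "\<exists>b\<in>A - {x, y, z}. J [x, b, z] \<and> J [b, y, z]"
    if xyz: "x \<in> A" "y \<in> A" "z \<in> A" "J [x, y, z]" "x \<noteq> y" for x y z
  proof -
    have "[x, y, z] \<in> tuples 3 A" "J [x, y, z] \<and> [x, y, z] ! 0 \<noteq> [x, y, z] ! 1"
      using xyz by (auto simp: tuples_def)
    then obtain b where "b \<in> A - set [x, y, z]" "J ([x, y, z][1 := b])" "J ([x, y, z][0 := b])"
      using d unfolding dense_spherical_def by blast
    then show ?thesis by (intro bexI[of _ b]) auto
  qed
  have lin: "strict_linear (A - {p}) (cut J p)"
    using strict_linear_subset[OF cut_circular_ord(1)[OF c p]] by blast
  have ne: "A - {p} \<noteq> {}"
    using d unfolding dense_spherical_def by blast
  have between: "\<exists>z\<in>A - {p}. cut J p x z \<and> cut J p z y" if xy: "x \<in> A - {p}" "y \<in> A - {p}" "cut J p x y" for x y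
  proof -
    have A: "x \<in> A" "y \<in> A" "x \<noteq> y" "J [p, x, y]"
      using xy by (simp_all add: cut_def)
    have "J [x, y, p]" using cyc[OF p A(1,2,4)] .
    obtain b where b: "b \<in> A - {x, y, p}" "J [x, b, p]" "J [b, y, p]"
      using dens[OF A(1,2) p \<open>J [x, y, p]\<close> A(3)] by blast
    then have "b \<in> A" by blast
    have "J [p, x, b]" using cyc[OF \<open>b \<in> A\<close> p A(1) cyc[OF A(1) \<open>b \<in> A\<close> p b(2)]] .
    moreover have "J [p, b, y]" using cyc[OF A(2) p \<open>b \<in> A\<close> cyc[OF \<open>b \<in> A\<close> A(2) p b(3)]] .
    ultimately show ?thesis using b(1) xy by (intro bexI[of _ b]) (auto simp: cut_def)
  qed
  have above: "\<exists>z\<in>A - {p}. cut J p x z" if x: "x \<in> A - {p}" for x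
  proof -
    have xA: "x \<in> A" "x \<noteq> p" using x by auto
    have "J [x, p, p]" using deg[OF xA(1) p p] by simp
    then obtain b where b: "b \<in> A - {x, p, p}" "J [x, b, p]"
      using dens[OF xA(1) p p _ xA(2)] by blast
    then have bA: "b \<in> A" by blast
    have "J [p, x, b]" using cyc[OF bA p xA(1) cyc[OF xA(1) bA p b(2)]] .
    then show ?thesis using b(1) x by (intro bexI[of _ b]) (auto simp: cut_def)
  qed
  have below: "\<exists>z\<in>A - {p}. cut J p z x" if x: "x \<in> A - {p}" for x
  proof -
    have xA: "x \<in> A" "p \<noteq> x" using x by auto
    have "J [p, x, x]" using deg[OF p xA(1,1)] by simp
    then obtain b where b: "b \<in> A - {p, x, x}" "J [p, b, x]"
      using dens[OF p xA(1,1) _ xA(2)] by blast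
    then show ?thesis using x by (intro bexI[of _ b]) (auto simp: cut_def)
  qed
  show ?thesis
    unfolding dense_linear_def using lin ne between above below by blast
qed

text \<open>Both circles are cut at arbitrary points. Without its least element each cut is a
  countable dense order without endpoints, and the order isomorphism extends by sending one cut
  point to the other.\<close>

lemma circular_ord_categorical:
  fixes M N :: "(sym, nat) struct"
  assumes M: "circular_ord (univ M) (interp M K)" "dense_spherical 3 (univ M) (interp M K)"
    and N: "circular_ord (univ N) (interp N K)" "dense_spherical 3 (univ N) (interp N K)"
  shows "isomorphic (sph_lang 3) M N"
proof -
  obtain p where p: "p \<in> univ M" using M(2) by (auto simp: dense_spherical_def)
  obtain q where q: "q \<in> univ N" using N(2) by (auto simp: dense_spherical_def)
  let ?l = "cut (interp M K) p" and ?l' = "cut (interp N K) q"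
  obtain f where f: "bij_betw f (univ M - {p}) (univ N - {q})"
    "\<forall>x\<in>univ M - {p}. \<forall>y\<in>univ M - {p}. ?l' (f x) (f y) \<longleftrightarrow> ?l x y"
    using dense_linear_order_iso[OF dense_cut[OF M p] dense_cut[OF N q]] by blast
  define g where "g x = (if x = p then q else f x)" for x
  have "bij_betw g (univ M - {p}) (univ N - {q})"
    using f(1) by (rule bij_betw_cong[THEN iffD1, rotated]) (simp add: g_def)
  then have "bij_betw g (insert p (univ M - {p})) (insert q (univ N - {q}))"
    using notIn_Un_bij_betw[of p "univ M - {p}" g "univ N - {q}"] by (simp add: g_def)
  then have bij: "bij_betw g (univ M) (univ N)"
    using p q by (simp add: insert_absorb)
  have fN: "f x \<noteq> q" if "x \<in> univ M" "x \<noteq> p" for x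
    using f(1) that by (auto simp: bij_betw_def)
  have g: "?l' (g x) (g y) \<longleftrightarrow> ?l x y" if xy: "x \<in> univ M" "y \<in> univ M" for x y
  proof (cases "x = p \<or> y = p")
    case True
    then show ?thesis
      using fN xy by (auto simp: g_def cut_def)
  next
    case False
    then show ?thesis using f(2) xy by (simp add: g_def)
  qed
  have alt: "J xs \<longleftrightarrow> alternating (cut J r) xs"
    if J: "circular_ord A J" "r \<in> A" "set xs \<subseteq> A" "length xs = 3" for A J r and xs :: "nat list"
  proof -
    obtain x y z where xs: "xs = [x, y, z]"
      using J(4) by (auto simp: numeral_3_eq_3 length_Suc_conv)
    then show ?thesis using cut_circular_ord(2)[OF J(1,2), of x y z] J(3) by simp
  qed
  show ?thesis
    by (rule isomorphic_sph_lang[OF bij alt[OF M(1) p] alt[OF N(1) q] g])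
qed

lemma dense_spherical_theory_unique:
  assumes "n \<ge> 2" "n \<le> 3" "dense_spherical_theory n T"
  shows "T = Th (sph_lang n) base_struct"
proof -
  obtain A :: "(sym, nat) struct" where A: "spherical_order n (univ A) (interp A K)"
      "dense_spherical n (univ A) (interp A K)" "n = 2 \<longrightarrow> no_endpoints (univ A) (interp A K)"
      "T = Th (sph_lang n) A"
    using assms(3) unfolding dense_spherical_theory_def by blast
  have "isomorphic (sph_lang n) A base_struct"
  proof (cases "n = 2")
    case True
    then show ?thesis
      using A linear_ord_categorical[of A] by (simp add: spherical_order_def)
  next
    case False
    then have n: "n = 3" using assms by simp
    then show ?thesis
      using A circular_ord_categorical[of A base_struct] spherical_base[of 3] dense_base[of 3]
      by (simp add: spherical_order_def)
  qed
  then show ?thesis using A(4) Th_isomorphic by blast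
qed

theorem theorem5p1:
  fixes n :: nat
  assumes "n \<ge> 2"
  shows "(\<exists>T. dense_spherical_theory n T \<and>
            (\<forall>m::nat. m \<noteq> 0 \<and> m \<noteq> 2 \<longrightarrow>
               (\<exists>L' T'. unary_expansion (sph_lang n) T L' T' \<and> has_spectrum L' T' m))) \<and>
         (n \<le> 3 \<longrightarrow>
            (\<forall>T. dense_spherical_theory n T \<longrightarrow>
               (\<forall>m::nat. m \<noteq> 0 \<and> m \<noteq> 2 \<longrightarrow>
                  (\<exists>L' T'. unary_expansion (sph_lang n) T L' T' \<and> has_spectrum L' T' m))))"
  using dense_spherical_theory_base[OF assms] unary_expansion_with_spectrum[OF assms]
    dense_spherical_theory_unique[OF assms] by blast

end
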